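(* Let $\mathcal{E}=(E,\sigma,a)$ with $s\neq 0$, $a\ne 0$, and $\mathrm{Deg}(\mathcal{E})=n=\prod_{i=1}^dp_i^{n_i}$ where $p_1,\ldots,p_d$ are distinct primes and $n_i\ge1$. For $i=1,\ldots,d$: 1. The polynomial $z^{p_i^{n_i}}-s\in F[z]$ is irreducible over $F$ if and only if $s\notin\bigcup_{j=1}^{n_i}F^{[p_i^j]}$. 2. Suppose that the polynomial $z^{p_i^{n_i}}-s\in F[z]$ is irreducible over $F$. Then $E_i/F$ is a Galois field extension with Galois group $G(E_i/F)=\langle\sigma_i\mid\sigma_i^{p_i^{n_i}}=1\rangle$, which is a cyclic group of order $p_i^{n_i}$, where $\sigma_i(h^{n_i'})=q^{(n_i')^2}h^{n_i'}$, and $[E_i:F]=p_i^{n_i}$. 3. The algebra $\mathcal{E}_i$ is a central simple $F$-algebra with $\mathrm{Deg}(\mathcal{E}_i)=p_i^{n_i}$. 4. The algebra $\mathcal{E}=\bigotimes_{i=1}^d\mathcal{E}_i$ is a tensor product (over $F$) of its subalgebras $\mathcal{E}_i$.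
   Context: $F$ is a field containing a primitive $n$'th root of unity $q$ ($n\ge2$), $s,a\in F$, $E=F[h]/(h^n-s)$, $\sigma(h)=qh$, and $\mathcal{E}=(E,\sigma,a)=E[x;\sigma]/(x^n-a)$ is the $F$-algebra generated by $h,x$ with relations $xh=qhx$, $h^n=s$, $x^n=a$. $F^{[k]}=\{u^k\mid u\in F\}$. $\mathrm{Deg}(A)=k$ if $A$ is central simple over $F$ with $\dim_FA=k^2$. For each $i$, $n_i'=n/p_i^{n_i}$; $\mathcal{E}_i$ is the $F$-subalgebra of $\mathcal{E}$ generated by $h^{n_i'}$ and $x^{n_i'}$; $E_i=F[h^{n_i'}]\simeq F[z]/(z^{p_i^{n_i}}-s)$ is the subalgebra generated by $h^{n_i'}$; and $\sigma_i$ is the $F$-automorphism of $E_i$ with $\sigma_i(h^{n_i'})=q^{(n_i')^2}h^{n_i'}$. *)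

theory Defs
  imports "HOL-Algebra.Algebra"
begin

section \<open>The base field\<close>

definition primitive_root_of_unity :: "('a, 'b) ring_scheme \<Rightarrow> nat \<Rightarrow> 'a \<Rightarrow> bool" where
  "primitive_root_of_unity F n q \<longleftrightarrow>
     q \<in> carrier F \<and> q [^]\<^bsub>F\<^esub> n = \<one>\<^bsub>F\<^esub> \<and> (\<forall>k. 0 < k \<and> k < n \<longrightarrow> q [^]\<^bsub>F\<^esub> k \<noteq> \<one>\<^bsub>F\<^esub>)"

text \<open>The set \<open>F\<^sup>[\<^sup>k\<^sup>] = {u\<^sup>k | u \<in> F}\<close>.\<close>

definition kth_powers :: "('a, 'b) ring_scheme \<Rightarrow> nat \<Rightarrow> 'a set" where
  "kth_powers F k = {u [^]\<^bsub>F\<^esub> k | u. u \<in> carrier F}"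

text \<open>The polynomial \<open>z\<^sup>k - s\<close> in \<open>F[z]\<close>.\<close>

definition binomial_poly :: "('a, 'b) ring_scheme \<Rightarrow> nat \<Rightarrow> 'a \<Rightarrow> 'a list" where
  "binomial_poly F k s =
     X\<^bsub>F\<^esub> [^]\<^bsub>poly_ring F\<^esub> k \<ominus>\<^bsub>poly_ring F\<^esub> ring.poly_of_const F s"


section \<open>The algebra \<open>E = F[h]/(h\<^sup>n - s)\<close>\<close>

definition radical_algebra :: "('a, 'b) ring_scheme \<Rightarrow> nat \<Rightarrow> 'a \<Rightarrow> 'a list set ring" where
  "radical_algebra F n s = Rupt\<^bsub>F\<^esub> (carrier F) (binomial_poly F n s)"

definition radical_class :: "('a, 'b) ring_scheme \<Rightarrow> nat \<Rightarrow> 'a \<Rightarrow> 'a list \<Rightarrow> 'a list set" where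
  "radical_class F n s f =
     (PIdl\<^bsub>poly_ring F\<^esub> (binomial_poly F n s)) +>\<^bsub>poly_ring F\<^esub> f"

definition radical_const :: "('a, 'b) ring_scheme \<Rightarrow> nat \<Rightarrow> 'a \<Rightarrow> 'a \<Rightarrow> 'a list set" where
  "radical_const F n s c = radical_class F n s (ring.poly_of_const F c)"

definition radical_gen :: "('a, 'b) ring_scheme \<Rightarrow> nat \<Rightarrow> 'a \<Rightarrow> 'a list set" where
  "radical_gen F n s = radical_class F n s X\<^bsub>F\<^esub>"


section \<open>Skew polynomial rings and the algebras \<open>(E,\<sigma>,\<alpha>) = E[x;\<sigma>]/(x\<^sup>n - \<alpha>)\<close>\<close>

text \<open>A skew polynomial is the sequence of its left coefficients, \<open>\<Sum>\<^sub>i f\<^sub>i x\<^sup>i\<close>; the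
  multiplication is the one determined by \<open>x e = \<sigma>(e) x\<close> for \<open>e \<in> E\<close>.\<close>

definition skew_poly_ring ::
    "('c, 'd) ring_scheme \<Rightarrow> ('c \<Rightarrow> 'c) \<Rightarrow> (nat \<Rightarrow> 'c) ring" where
  "skew_poly_ring E \<sigma> =
     \<lparr> carrier = {f. range f \<subseteq> carrier E \<and> finite {i. f i \<noteq> \<zero>\<^bsub>E\<^esub>}},
       monoid.mult = (\<lambda>f g k. \<Oplus>\<^bsub>E\<^esub>i\<in>{..k}. f i \<otimes>\<^bsub>E\<^esub> (\<sigma> ^^ i) (g (k - i))),
       one = (\<lambda>i. if i = 0 then \<one>\<^bsub>E\<^esub> else \<zero>\<^bsub>E\<^esub>),
       ring.zero = (\<lambda>i. \<zero>\<^bsub>E\<^esub>),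
       add = (\<lambda>f g i. f i \<oplus>\<^bsub>E\<^esub> g i) \<rparr>"

definition skew_const :: "('c, 'd) ring_scheme \<Rightarrow> 'c \<Rightarrow> nat \<Rightarrow> 'c" where
  "skew_const E e = (\<lambda>i. if i = 0 then e else \<zero>\<^bsub>E\<^esub>)"

definition skew_var :: "('c, 'd) ring_scheme \<Rightarrow> nat \<Rightarrow> 'c" where
  "skew_var E = (\<lambda>i. if i = 1 then \<one>\<^bsub>E\<^esub> else \<zero>\<^bsub>E\<^esub>)"

definition cyclic_ideal ::
    "('c, 'd) ring_scheme \<Rightarrow> ('c \<Rightarrow> 'c) \<Rightarrow> nat \<Rightarrow> 'c \<Rightarrow> (nat \<Rightarrow> 'c) set" where
  "cyclic_ideal E \<sigma> n \<alpha> =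
     Idl\<^bsub>skew_poly_ring E \<sigma>\<^esub>
       {skew_var E [^]\<^bsub>skew_poly_ring E \<sigma>\<^esub> n \<ominus>\<^bsub>skew_poly_ring E \<sigma>\<^esub> skew_const E \<alpha>}"

definition cyclic_algebra ::
    "('c, 'd) ring_scheme \<Rightarrow> ('c \<Rightarrow> 'c) \<Rightarrow> nat \<Rightarrow> 'c \<Rightarrow> (nat \<Rightarrow> 'c) set ring" where
  "cyclic_algebra E \<sigma> n \<alpha> = skew_poly_ring E \<sigma> Quot cyclic_ideal E \<sigma> n \<alpha>"

definition cyclic_class ::
    "('c, 'd) ring_scheme \<Rightarrow> ('c \<Rightarrow> 'c) \<Rightarrow> nat \<Rightarrow> 'c \<Rightarrow> (nat \<Rightarrow> 'c) \<Rightarrow> (nat \<Rightarrow> 'c) set" where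
  "cyclic_class E \<sigma> n \<alpha> f = cyclic_ideal E \<sigma> n \<alpha> +>\<^bsub>skew_poly_ring E \<sigma>\<^esub> f"


section \<open>Algebras over a field\<close>

text \<open>A \<open>K\<close>-algebra is represented by a ring \<open>A\<close> together with a subfield \<open>K\<close> lying in its centre,
  as in \<^theory>\<open>HOL-Algebra.Embedded_Algebras\<close>. The constant \<open>subalgebra\<close> of that theory does
  not require closure under multiplication; a \<open>K\<close>-subalgebra in the usual (unital) sense is a
  subring containing \<open>K\<close>, and the one generated by \<open>S\<close> is \<open>generate_ring A (K \<union> S)\<close>.\<close>

definition unital_subalgebra :: "'a set \<Rightarrow> 'a set \<Rightarrow> ('a, 'b) ring_scheme \<Rightarrow> bool" where
  "unital_subalgebra K V A \<longleftrightarrow> subring V A \<and> K \<subseteq> V"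

definition ring_center :: "('a, 'b) ring_scheme \<Rightarrow> 'a set" where
  "ring_center A = {z \<in> carrier A. \<forall>x\<in>carrier A. z \<otimes>\<^bsub>A\<^esub> x = x \<otimes>\<^bsub>A\<^esub> z}"

definition simple_ring :: "('a, 'b) ring_scheme \<Rightarrow> bool" where
  "simple_ring A \<longleftrightarrow> ring A \<and> \<one>\<^bsub>A\<^esub> \<noteq> \<zero>\<^bsub>A\<^esub> \<and>
     (\<forall>I. ideal I A \<longrightarrow> I = {\<zero>\<^bsub>A\<^esub>} \<or> I = carrier A)"

definition central_simple :: "'a set \<Rightarrow> ('a, 'b) ring_scheme \<Rightarrow> bool" where
  "central_simple K A \<longleftrightarrow>
     simple_ring A \<and> subfield K A \<and> ring_center A = K \<and>
     (\<exists>m. ring.dimension A m K (carrier A))"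

text \<open>\<open>Deg(A) = k\<close>.\<close>

definition has_Deg :: "'a set \<Rightarrow> ('a, 'b) ring_scheme \<Rightarrow> nat \<Rightarrow> bool" where
  "has_Deg K A k \<longleftrightarrow> central_simple K A \<and> ring.dimension A (k ^ 2) K (carrier A)"


section \<open>Automorphisms and Galois extensions\<close>

text \<open>The group of automorphisms of the ring \<open>L\<close> that fix \<open>K\<close> elementwise; as in
  \<^const>\<open>BijGroup\<close>, its elements are extensional functions on the carrier.\<close>

definition aut_group :: "('a, 'b) ring_scheme \<Rightarrow> 'a set \<Rightarrow> ('a \<Rightarrow> 'a) monoid" where
  "aut_group L K =
     BijGroup (carrier L)
       \<lparr> carrier := {\<tau> \<in> Bij (carrier L). \<tau> \<in> ring_hom L L \<and> (\<forall>k\<in>K. \<tau> k = k)} \<rparr>"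

definition finite_galois_extension :: "('a, 'b) ring_scheme \<Rightarrow> 'a set \<Rightarrow> bool" where
  "finite_galois_extension L K \<longleftrightarrow>
     field L \<and> subfield K L \<and> (\<exists>m. ring.dimension L m K (carrier L)) \<and>
     {y \<in> carrier L. \<forall>\<tau>\<in>carrier (aut_group L K). \<tau> y = y} = K"


section \<open>Tensor products of algebras\<close>

text \<open>The monoid algebra \<open>k[M]\<close>: finitely supported functions on \<open>M\<close>, with convolution.\<close>

definition monoid_algebra ::
    "('a, 'b) ring_scheme \<Rightarrow> ('m, 'c) monoid_scheme \<Rightarrow> ('m \<Rightarrow> 'a) ring" where
  "monoid_algebra k M =
     \<lparr> carrier = {\<phi>. range \<phi> \<subseteq> carrier k \<and> finite {u. \<phi> u \<noteq> \<zero>\<^bsub>k\<^esub>} \<and>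
                    {u. \<phi> u \<noteq> \<zero>\<^bsub>k\<^esub>} \<subseteq> carrier M},
       monoid.mult = (\<lambda>\<phi> \<psi> w.
         \<Oplus>\<^bsub>k\<^esub>r\<in>{(u, v). \<phi> u \<noteq> \<zero>\<^bsub>k\<^esub> \<and> \<psi> v \<noteq> \<zero>\<^bsub>k\<^esub> \<and> u \<otimes>\<^bsub>M\<^esub> v = w}.
           \<phi> (fst r) \<otimes>\<^bsub>k\<^esub> \<psi> (snd r)),
       one = (\<lambda>u. if u = \<one>\<^bsub>M\<^esub> then \<one>\<^bsub>k\<^esub> else \<zero>\<^bsub>k\<^esub>),
       ring.zero = (\<lambda>u. \<zero>\<^bsub>k\<^esub>),
       add = (\<lambda>\<phi> \<psi> u. \<phi> u \<oplus>\<^bsub>k\<^esub> \<psi> u) \<rparr>"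

definition ma_single :: "('a, 'b) ring_scheme \<Rightarrow> 'a \<Rightarrow> 'm \<Rightarrow> 'm \<Rightarrow> 'a" where
  "ma_single k c u = (\<lambda>v. if v = u then c else \<zero>\<^bsub>k\<^esub>)"

text \<open>The tensor product over \<open>k\<close> of a family \<open>A\<^sub>i\<close> (\<open>i \<in> I\<close>, \<open>I\<close> finite) of algebras containing the
  field \<open>k\<close>: the free vector space on \<open>\<Prod>\<^sub>i A\<^sub>i\<close> modulo the relations of multilinearity, with
  the factorwise multiplication. The free vector space with this multiplication is the monoid
  algebra of the multiplicative monoid \<open>\<Prod>\<^sub>i A\<^sub>i\<close>. The product of a relation with a basis element
  is again a relation, so the ideal generated by the relations is just their linear span.\<close>

definition tensor_relations ::
    "('a, 'b) ring_scheme \<Rightarrow> 'i set \<Rightarrow> ('i \<Rightarrow> ('a, 'c) ring_scheme) \<Rightarrow> (('i \<Rightarrow> 'a) \<Rightarrow> 'a) set" where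
  "tensor_relations k I A =
     (let P = monoid_algebra k (product_group I A) in
       {ma_single k \<one>\<^bsub>k\<^esub> (f(i := y \<oplus>\<^bsub>A i\<^esub> z))
          \<ominus>\<^bsub>P\<^esub> (ma_single k \<one>\<^bsub>k\<^esub> (f(i := y)) \<oplus>\<^bsub>P\<^esub> ma_single k \<one>\<^bsub>k\<^esub> (f(i := z)))
        | f i y z. f \<in> carrier (product_group I A) \<and> i \<in> I \<and> y \<in> carrier (A i) \<and> z \<in> carrier (A i)}
     \<union> {ma_single k \<one>\<^bsub>k\<^esub> (f(i := c \<otimes>\<^bsub>A i\<^esub> y)) \<ominus>\<^bsub>P\<^esub> ma_single k c (f(i := y))
        | f i c y. f \<in> carrier (product_group I A) \<and> i \<in> I \<and> c \<in> carrier k \<and> y \<in> carrier (A i)})"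

definition tensor_ideal ::
    "('a, 'b) ring_scheme \<Rightarrow> 'i set \<Rightarrow> ('i \<Rightarrow> ('a, 'c) ring_scheme) \<Rightarrow> (('i \<Rightarrow> 'a) \<Rightarrow> 'a) set" where
  "tensor_ideal k I A =
     Idl\<^bsub>monoid_algebra k (product_group I A)\<^esub> (tensor_relations k I A)"

definition tensor_algebra ::
    "('a, 'b) ring_scheme \<Rightarrow> 'i set \<Rightarrow> ('i \<Rightarrow> ('a, 'c) ring_scheme) \<Rightarrow> (('i \<Rightarrow> 'a) \<Rightarrow> 'a) set ring" where
  "tensor_algebra k I A = monoid_algebra k (product_group I A) Quot tensor_ideal k I A"

text \<open>\<open>c (\<Otimes>\<^sub>i f\<^sub>i)\<close>\<close>

definition pure_tensor ::
    "('a, 'b) ring_scheme \<Rightarrow> 'i set \<Rightarrow> ('i \<Rightarrow> ('a, 'c) ring_scheme) \<Rightarrow> 'a \<Rightarrow> ('i \<Rightarrow> 'a) \<Rightarrow>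
       (('i \<Rightarrow> 'a) \<Rightarrow> 'a) set" where
  "pure_tensor k I A c f =
     tensor_ideal k I A +>\<^bsub>monoid_algebra k (product_group I A)\<^esub> ma_single k c f"

text \<open>The \<open>K\<close>-algebra \<open>A\<close> is the (internal) tensor product of its subalgebras \<open>V\<^sub>i\<close>, \<open>i \<in> I\<close>: there is
  an isomorphism of \<open>K\<close>-algebras \<open>\<Otimes>\<^sub>i V\<^sub>i \<rightarrow> A\<close> restricting on each factor \<open>V\<^sub>i\<close> to the inclusion
  \<open>V\<^sub>i \<subseteq> A\<close>. Being multiplicative, it sends \<open>\<Otimes>\<^sub>i v\<^sub>i\<close> to the product of the \<open>v\<^sub>i\<close>.\<close>

definition tensor_product_of_subalgebras ::
    "'a set \<Rightarrow> ('a, 'c) ring_scheme \<Rightarrow> 'i set \<Rightarrow> ('i \<Rightarrow> 'a set) \<Rightarrow> bool" where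
  "tensor_product_of_subalgebras K A I V \<longleftrightarrow>
     (\<forall>i\<in>I. unital_subalgebra K (V i) A) \<and>
     (let k = A\<lparr>carrier := K\<rparr>; B = (\<lambda>i. A\<lparr>carrier := V i\<rparr>); u = \<one>\<^bsub>product_group I B\<^esub> in
       \<exists>\<mu>\<in>ring_iso (tensor_algebra k I B) A.
         (\<forall>c\<in>K. \<mu> (pure_tensor k I B c u) = c) \<and>
         (\<forall>i\<in>I. \<forall>v\<in>V i. \<mu> (pure_tensor k I B \<one>\<^bsub>k\<^esub> (u(i := v))) = v))"

end

theory Submission
  imports Defs
begin

text \<open>The generators \<open>h\<close> and \<open>x\<close> are units with \<open>xh = qhx\<close>, and for \<open>n = n' N\<close> with \<open>n'\<close> and \<open>N\<close>
  coprime the powers \<open>y = h\<^sup>n\<^sup>'\<close> and \<open>z = x\<^sup>n\<^sup>'\<close> satisfy the same kind of relation for the primitive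
  \<open>N\<close>-th root of unity \<open>\<omega> = q\<^sup>n\<^sup>'\<^sup>n\<^sup>'\<close>. The monomials \<open>y\<^sup>iz\<^sup>j\<close> with \<open>i, j < N\<close> are joint eigenvectors of the
  conjugations by \<open>z\<close> and \<open>y\<^sup>-\<^sup>1\<close> with pairwise distinct characters. Hence they are linearly independent,
  and every subspace stable under both conjugations is spanned by monomials, which are units: the algebra
  they span is simple with centre \<open>K\<close> and dimension \<open>N\<^sup>2\<close>.

  If \<open>L = K[y]\<close> is a field, conjugation by \<open>z\<close> generates its group of automorphisms over \<open>K\<close>, as an
  automorphism is determined by the image of \<open>y\<close>, a root of \<open>y\<^sup>N\<close>. If \<open>L\<close> is not a field, take a maximal
  ideal. Its stabilizer in the group generated by the conjugation by \<open>z\<close> has an order \<open>t < N\<close>; the product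
  of the distinct conjugates of the ideal vanishes, and the resulting idempotents show that the constant
  \<open>y\<^sup>N\<close> is a \<open>p\<close>-th power in \<open>K\<close> for some prime \<open>p\<close> dividing \<open>N\<close>.

  The subalgebras for distinct primes commute, and products of their monomials are again joint eigenvectors
  with distinct characters. This makes the multiplication map from their tensor product injective, and
  it is onto because \<open>h\<close> and \<open>x\<close> are, up to scalars, products of powers of the \<open>h\<^sup>n\<^sup>'\<close> and \<open>x\<^sup>n\<^sup>'\<close>.\<close>

section \<open>Finite sums\<close>

text \<open>The classical criterion for \<open>z^N - s\<close> has a second exceptional case,
  \<open>s = -4c^4\<close> when 4 divides \<open>N\<close>. It needs no treatment of its own:
  \<open>K\<close> then contains a square root \<open>i\<close> of -1, and
  \<open>-4c^4 = (2ic^2)^2\<close> is a square. The criterion is therefore proved directly from the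
  action of the roots of unity on \<open>L\<close>, and irreducibility is a translation of the
  statement that \<open>L\<close> is a field, through \<open>L = F[z]/(z^N - s)\<close>. The two
  quotients that define the algebra are awkward to compute in, since it is not evident how far their
  ideals collapse. What is extracted from them are the relations between \<open>h\<close>,
  \<open>x\<close> and the scalars, and the fact that these generate. All the rest takes place in a
  ring with a central subfield, where independence comes from distinct characters and not from
  normal forms. That the image \<open>K\<close> of \<open>F\<close> is a subfield and the whole
  centre is read off from the degree hypothesis.\<close>

lemma finsum_additive:
  assumes "abelian_monoid R" "abelian_monoid T"
    and add: "\<And>x y. x \<in> carrier R \<Longrightarrow> y \<in> carrier R \<Longrightarrow> g (x \<oplus>\<^bsub>R\<^esub> y) = g x \<oplus>\<^bsub>T\<^esub> g y"
    and zero: "g \<zero>\<^bsub>R\<^esub> = \<zero>\<^bsub>T\<^esub>" and closed: "\<And>x. x \<in> carrier R \<Longrightarrow> g x \<in> carrier T"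
    and f: "f \<in> A \<rightarrow> carrier R"
  shows "g (finsum R f A) = finsum T (\<lambda>i. g (f i)) A"
proof -
  interpret R: abelian_monoid R by fact
  interpret T: abelian_monoid T by fact
  show ?thesis
    using f
  \<comment> \<open>\<open>g\<close> preserving zero does not follow from additivity in a monoid. It
    also settles infinite \<open>A\<close>, where both sums are zero by convention.\<close>
  proof (induction A rule: infinite_finite_induct)
    case (insert a A)
    then have "f a \<in> carrier R" "f \<in> A \<rightarrow> carrier R" by auto
    moreover then have "(\<lambda>i. g (f i)) \<in> A \<rightarrow> carrier T" using closed by auto
    ultimately show ?case using insert by (simp add: add closed)
  qed (use zero in auto)
qed

context abelian_monoid
begin

lemma finsum_single:
  assumes "finite A" "i \<in> A" "f i \<in> carrier G" "\<And>j. j \<in> A \<Longrightarrow> j \<noteq> i \<Longrightarrow> f j = \<zero>"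
  shows "finsum G f A = f i"
proof -
  have "finsum G f A = finsum G f {i}"
    by (rule add.finprod_mono_neutral_cong_right) (use assms in fastforce)+
  then show ?thesis using assms(3) by simp
qed

lemma finsum_swap:
  assumes "finite A" "finite B" "\<And>i j. i \<in> A \<Longrightarrow> j \<in> B \<Longrightarrow> f i j \<in> carrier G"
  shows "(\<Oplus>i\<in>A. \<Oplus>j\<in>B. f i j) = (\<Oplus>j\<in>B. \<Oplus>i\<in>A. f i j)"
  using assms(1,3)
proof (induction A rule: finite_induct)
  case (insert a A)
  have "(\<Oplus>i\<in>insert a A. \<Oplus>j\<in>B. f i j) = (\<Oplus>j\<in>B. f a j) \<oplus> (\<Oplus>j\<in>B. \<Oplus>i\<in>A. f i j)"
    using insert by (subst finsum_insert) (auto intro!: finsum_closed)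
  also have "\<dots> = (\<Oplus>j\<in>B. f a j \<oplus> (\<Oplus>i\<in>A. f i j))"
    by (rule finsum_addf[symmetric]) (use insert in \<open>auto intro!: finsum_closed\<close>)
  also have "\<dots> = (\<Oplus>j\<in>B. \<Oplus>i\<in>insert a A. f i j)"
    by (rule finsum_cong') (use insert in \<open>auto intro!: finsum_closed\<close>)
  finally show ?case .
qed simp

lemma finsum_cartesian:
  assumes "finite A" "finite B" "\<And>i j. i \<in> A \<Longrightarrow> j \<in> B \<Longrightarrow> f (i, j) \<in> carrier G"
  shows "(\<Oplus>r\<in>A \<times> B. f r) = (\<Oplus>i\<in>A. \<Oplus>j\<in>B. f (i, j))"
  using assms(1,3)
proof (induction A rule: finite_induct)
  case (insert a A)
  have "(\<Oplus>r\<in>insert a A \<times> B. f r) = (\<Oplus>r\<in>(Pair a ` B) \<union> A \<times> B. f r)"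
    by (rule finsum_cong') (use insert in auto)
  also have "\<dots> = (\<Oplus>r\<in>Pair a ` B. f r) \<oplus> (\<Oplus>r\<in>A \<times> B. f r)"
    by (rule finsum_Un_disjoint) (use insert assms in auto)
  also have "(\<Oplus>r\<in>Pair a ` B. f r) = (\<Oplus>j\<in>B. f (a, j))"
    by (rule finsum_reindex) (use insert in \<open>auto simp: inj_on_def\<close>)
  finally show ?case
    using insert by (auto intro!: finsum_closed)
qed simp

end


section \<open>Skew monoid rings\<close>

text \<open>Covers both the skew polynomial ring (the naturals acting by powers of an endomorphism)
  and the monoid algebra (trivial action), so the ring axioms are checked once. The product rule
  \<open>mult_S\<close> admits any finite sets containing the supports, which allows several
  products to be expanded over one common index set.\<close>

locale skew_monoid_ring = R?: ring R + M: monoid M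
  for R :: "('a, 'b) ring_scheme" (structure) and M :: "('m, 'n) monoid_scheme" and S :: "('m \<Rightarrow> 'a, 'c) ring_scheme"
    and \<alpha> :: "'m \<Rightarrow> 'a \<Rightarrow> 'a" +
  assumes act_hom: "u \<in> carrier M \<Longrightarrow> \<alpha> u \<in> ring_hom R R"
    and act_one: "r \<in> carrier R \<Longrightarrow> \<alpha> \<one>\<^bsub>M\<^esub> r = r"
    and act_mult: "u \<in> carrier M \<Longrightarrow> v \<in> carrier M \<Longrightarrow> r \<in> carrier R \<Longrightarrow> \<alpha> (u \<otimes>\<^bsub>M\<^esub> v) r = \<alpha> u (\<alpha> v r)"
    and carrier_S: "carrier S =
      {\<phi>. range \<phi> \<subseteq> carrier R \<and> finite {u. \<phi> u \<noteq> \<zero>} \<and> {u. \<phi> u \<noteq> \<zero>} \<subseteq> carrier M}"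
    and one_S: "\<one>\<^bsub>S\<^esub> = (\<lambda>u. if u = \<one>\<^bsub>M\<^esub> then \<one> else \<zero>)"
    and zero_S: "\<zero>\<^bsub>S\<^esub> = (\<lambda>u. \<zero>)"
    and add_S: "\<phi> \<oplus>\<^bsub>S\<^esub> \<psi> = (\<lambda>u. \<phi> u \<oplus> \<psi> u)"
    and mult_S: "\<lbrakk>\<phi> \<in> carrier S; \<psi> \<in> carrier S; finite U; U \<subseteq> carrier M; {u. \<phi> u \<noteq> \<zero>} \<subseteq> U;
        finite V; V \<subseteq> carrier M; {u. \<psi> u \<noteq> \<zero>} \<subseteq> V\<rbrakk> \<Longrightarrow>
      (\<phi> \<otimes>\<^bsub>S\<^esub> \<psi>) w = (\<Oplus>u\<in>U. \<Oplus>v\<in>V. if u \<otimes>\<^bsub>M\<^esub> v = w then \<phi> u \<otimes> \<alpha> u (\<psi> v) else \<zero>)"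
begin

abbreviation supp :: "('m \<Rightarrow> 'a) \<Rightarrow> 'm set" where "supp \<phi> \<equiv> {u. \<phi> u \<noteq> \<zero>}"

lemma memI:
  assumes "\<And>u. \<phi> u \<in> carrier R" "finite U" "U \<subseteq> carrier M" "supp \<phi> \<subseteq> U"
  shows "\<phi> \<in> carrier S"
  using assms by (auto simp: carrier_S intro: finite_subset)

lemma carrier_SD:
  assumes "\<phi> \<in> carrier S"
  shows val [simp]: "\<phi> u \<in> carrier R" and supp [simp]: "finite (supp \<phi>)" "supp \<phi> \<subseteq> carrier M"
  using assms by (auto simp: carrier_S)

lemma suppD [dest]: "\<phi> u \<noteq> \<zero> \<Longrightarrow> \<phi> \<in> carrier S \<Longrightarrow> u \<in> carrier M"
  using supp(2) by blast

lemma act_closed [simp]: "u \<in> carrier M \<Longrightarrow> r \<in> carrier R \<Longrightarrow> \<alpha> u r \<in> carrier R"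
  using ring_hom_closed[OF act_hom] .

lemma act_zero [simp]: "u \<in> carrier M \<Longrightarrow> \<alpha> u \<zero> = \<zero>"
  using ring_hom_zero[OF act_hom ring_axioms ring_axioms] .

lemma act_ring_one [simp]: "u \<in> carrier M \<Longrightarrow> \<alpha> u \<one> = \<one>"
  using ring_hom_one[OF act_hom] .

lemma supp_mult:
  assumes "\<phi> \<in> carrier S" "\<psi> \<in> carrier S"
  shows "supp (\<phi> \<otimes>\<^bsub>S\<^esub> \<psi>) \<subseteq> (\<lambda>(u, v). u \<otimes>\<^bsub>M\<^esub> v) ` (supp \<phi> \<times> supp \<psi>)"
proof (rule subsetI, rule ccontr)
  fix w assume w: "w \<in> supp (\<phi> \<otimes>\<^bsub>S\<^esub> \<psi>)" "w \<notin> (\<lambda>(u, v). u \<otimes>\<^bsub>M\<^esub> v) ` (supp \<phi> \<times> supp \<psi>)"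
  have "(\<phi> \<otimes>\<^bsub>S\<^esub> \<psi>) w =
      (\<Oplus>u\<in>supp \<phi>. \<Oplus>v\<in>supp \<psi>. if u \<otimes>\<^bsub>M\<^esub> v = w then \<phi> u \<otimes> \<alpha> u (\<psi> v) else \<zero>)"
    by (rule mult_S) (use assms in auto)
  also have "\<dots> = \<zero>"
    by (intro add.finprod_one_eqI) (use w(2) in force)
  finally show False using w by simp
qed

lemma mult_closed [simp]:
  assumes "\<phi> \<in> carrier S" "\<psi> \<in> carrier S"
  shows "\<phi> \<otimes>\<^bsub>S\<^esub> \<psi> \<in> carrier S"
proof (rule memI[OF _ _ _ supp_mult[OF assms]])
  have "(\<phi> \<otimes>\<^bsub>S\<^esub> \<psi>) w =
      (\<Oplus>u\<in>supp \<phi>. \<Oplus>v\<in>supp \<psi>. if u \<otimes>\<^bsub>M\<^esub> v = w then \<phi> u \<otimes> \<alpha> u (\<psi> v) else \<zero>)" for w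
    by (rule mult_S) (use assms in auto)
  then show "(\<phi> \<otimes>\<^bsub>S\<^esub> \<psi>) w \<in> carrier R" for w
    using assms by (auto intro!: finsum_closed)
qed (use assms in \<open>auto intro!: M.m_closed\<close>)

text \<open>Each pair \<open>(u, v)\<close> feeds exactly one coefficient of the product, so an
  additive functional of the coefficients can be summed over pairs instead. Associativity takes a
  coefficient of a further product as \<open>g\<close>; the multiplication map of the tensor product
  takes the value of a term.\<close>

lemma finsum_mult:
  assumes \<phi>: "\<phi> \<in> carrier S" and \<psi>: "\<psi> \<in> carrier S"
    and U: "finite U" "U \<subseteq> carrier M" "supp \<phi> \<subseteq> U" and V: "finite V" "V \<subseteq> carrier M" "supp \<psi> \<subseteq> V"
    and C: "finite C" "\<And>u v. u \<in> U \<Longrightarrow> v \<in> V \<Longrightarrow> u \<otimes>\<^bsub>M\<^esub> v \<in> C" and T: "abelian_monoid T"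
    and g: "\<And>w r. w \<in> C \<Longrightarrow> r \<in> carrier R \<Longrightarrow> g w r \<in> carrier T" "\<And>w. w \<in> C \<Longrightarrow> g w \<zero> = \<zero>\<^bsub>T\<^esub>"
      "\<And>w r r'. w \<in> C \<Longrightarrow> r \<in> carrier R \<Longrightarrow> r' \<in> carrier R \<Longrightarrow> g w (r \<oplus> r') = g w r \<oplus>\<^bsub>T\<^esub> g w r'"
  shows "(\<Oplus>\<^bsub>T\<^esub>w\<in>C. g w ((\<phi> \<otimes>\<^bsub>S\<^esub> \<psi>) w)) = (\<Oplus>\<^bsub>T\<^esub>u\<in>U. \<Oplus>\<^bsub>T\<^esub>v\<in>V. g (u \<otimes>\<^bsub>M\<^esub> v) (\<phi> u \<otimes> \<alpha> u (\<psi> v)))"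
proof -
  interpret T: abelian_monoid T by fact
  let ?t = "\<lambda>u v. \<phi> u \<otimes> \<alpha> u (\<psi> v)"
  have t: "?t u v \<in> carrier R" if "u \<in> U" for u v using that \<phi> \<psi> U by auto
  have "(\<Oplus>\<^bsub>T\<^esub>w\<in>C. g w ((\<phi> \<otimes>\<^bsub>S\<^esub> \<psi>) w)) =
      (\<Oplus>\<^bsub>T\<^esub>w\<in>C. \<Oplus>\<^bsub>T\<^esub>u\<in>U. \<Oplus>\<^bsub>T\<^esub>v\<in>V. g w (if u \<otimes>\<^bsub>M\<^esub> v = w then ?t u v else \<zero>))"
  proof (rule T.finsum_cong')
    fix w assume w: "w \<in> C"
    have "g w ((\<phi> \<otimes>\<^bsub>S\<^esub> \<psi>) w) = g w (\<Oplus>u\<in>U. \<Oplus>v\<in>V. if u \<otimes>\<^bsub>M\<^esub> v = w then ?t u v else \<zero>)"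
      using mult_S[OF \<phi> \<psi> U V] by simp
    also have "\<dots> = (\<Oplus>\<^bsub>T\<^esub>u\<in>U. g w (\<Oplus>v\<in>V. if u \<otimes>\<^bsub>M\<^esub> v = w then ?t u v else \<zero>))"
      by (rule finsum_additive[OF abelian_monoid_axioms T])
        (use g w t in \<open>auto intro!: finsum_closed\<close>)
    also have "\<dots> = (\<Oplus>\<^bsub>T\<^esub>u\<in>U. \<Oplus>\<^bsub>T\<^esub>v\<in>V. g w (if u \<otimes>\<^bsub>M\<^esub> v = w then ?t u v else \<zero>))"
    proof (rule T.finsum_cong')
      fix u assume "u \<in> U"
      then show "g w (\<Oplus>v\<in>V. if u \<otimes>\<^bsub>M\<^esub> v = w then ?t u v else \<zero>) =
          (\<Oplus>\<^bsub>T\<^esub>v\<in>V. g w (if u \<otimes>\<^bsub>M\<^esub> v = w then ?t u v else \<zero>))"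
        by (intro finsum_additive[OF abelian_monoid_axioms T]) (use g w t in auto)
    qed (use g w t in \<open>auto intro!: T.finsum_closed\<close>)
    finally show "g w ((\<phi> \<otimes>\<^bsub>S\<^esub> \<psi>) w) =
        (\<Oplus>\<^bsub>T\<^esub>u\<in>U. \<Oplus>\<^bsub>T\<^esub>v\<in>V. g w (if u \<otimes>\<^bsub>M\<^esub> v = w then ?t u v else \<zero>))" .
  qed (use g t in \<open>auto intro!: T.finsum_closed\<close>)
  also have "\<dots> = (\<Oplus>\<^bsub>T\<^esub>u\<in>U. \<Oplus>\<^bsub>T\<^esub>w\<in>C. \<Oplus>\<^bsub>T\<^esub>v\<in>V. g w (if u \<otimes>\<^bsub>M\<^esub> v = w then ?t u v else \<zero>))"
    by (rule T.finsum_swap) (use C U g t in \<open>auto intro!: T.finsum_closed\<close>)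
  also have "\<dots> = (\<Oplus>\<^bsub>T\<^esub>u\<in>U. \<Oplus>\<^bsub>T\<^esub>v\<in>V. g (u \<otimes>\<^bsub>M\<^esub> v) (?t u v))"
  proof (rule T.finsum_cong')
    fix u assume u: "u \<in> U"
    have "(\<Oplus>\<^bsub>T\<^esub>w\<in>C. \<Oplus>\<^bsub>T\<^esub>v\<in>V. g w (if u \<otimes>\<^bsub>M\<^esub> v = w then ?t u v else \<zero>)) =
        (\<Oplus>\<^bsub>T\<^esub>v\<in>V. \<Oplus>\<^bsub>T\<^esub>w\<in>C. g w (if u \<otimes>\<^bsub>M\<^esub> v = w then ?t u v else \<zero>))"
      by (rule T.finsum_swap) (use C V g t u in auto)
    also have "\<dots> = (\<Oplus>\<^bsub>T\<^esub>v\<in>V. g (u \<otimes>\<^bsub>M\<^esub> v) (?t u v))"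
    proof (rule T.finsum_cong')
      fix v assume v: "v \<in> V"
      show "(\<Oplus>\<^bsub>T\<^esub>w\<in>C. g w (if u \<otimes>\<^bsub>M\<^esub> v = w then ?t u v else \<zero>)) = g (u \<otimes>\<^bsub>M\<^esub> v) (?t u v)"
        by (subst T.finsum_single[of _ "u \<otimes>\<^bsub>M\<^esub> v"]) (use C g t u v in auto)
    qed (use C g t u in auto)
    finally show "(\<Oplus>\<^bsub>T\<^esub>w\<in>C. \<Oplus>\<^bsub>T\<^esub>v\<in>V. g w (if u \<otimes>\<^bsub>M\<^esub> v = w then ?t u v else \<zero>)) =
        (\<Oplus>\<^bsub>T\<^esub>v\<in>V. g (u \<otimes>\<^bsub>M\<^esub> v) (?t u v))" .
  qed (use C g t in \<open>auto intro!: T.finsum_closed\<close>)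
  finally show ?thesis .
qed

text \<open>Both bracketings become the same triple sum over the supports. The terms agree because
  \<open>\<alpha>\<close> turns products in the monoid into composition and each
  \<open>\<alpha> u\<close> is a ring homomorphism.\<close>

lemma mult_assoc:
  assumes \<phi>: "\<phi> \<in> carrier S" and \<psi>: "\<psi> \<in> carrier S" and \<chi>: "\<chi> \<in> carrier S"
  shows "\<phi> \<otimes>\<^bsub>S\<^esub> \<psi> \<otimes>\<^bsub>S\<^esub> \<chi> = \<phi> \<otimes>\<^bsub>S\<^esub> (\<psi> \<otimes>\<^bsub>S\<^esub> \<chi>)"
proof
  fix t
  let ?P = "\<lambda>A B. (\<lambda>(u, v). u \<otimes>\<^bsub>M\<^esub> v) ` (A \<times> B)"
  let ?U = "supp \<phi>" and ?V = "supp \<psi>" and ?W = "supp \<chi>"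
  have P: "finite (?P (supp \<theta>) (supp \<eta>))" "?P (supp \<theta>) (supp \<eta>) \<subseteq> carrier M"
    if "\<theta> \<in> carrier S" "\<eta> \<in> carrier S" for \<theta> \<eta>
    using that by (auto intro!: M.m_closed)
  let ?g = "\<lambda>x r. \<Oplus>w\<in>?W. if x \<otimes>\<^bsub>M\<^esub> w = t then r \<otimes> \<alpha> x (\<chi> w) else \<zero>"
  have "(\<phi> \<otimes>\<^bsub>S\<^esub> \<psi> \<otimes>\<^bsub>S\<^esub> \<chi>) t = (\<Oplus>x\<in>?P ?U ?V. ?g x ((\<phi> \<otimes>\<^bsub>S\<^esub> \<psi>) x))"
    by (rule mult_S) (use \<phi> \<psi> \<chi> P[OF \<phi> \<psi>] supp_mult[OF \<phi> \<psi>] in auto)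
  also have "\<dots> = (\<Oplus>u\<in>?U. \<Oplus>v\<in>?V. ?g (u \<otimes>\<^bsub>M\<^esub> v) (\<phi> u \<otimes> \<alpha> u (\<psi> v)))"
  proof (rule finsum_mult[OF \<phi> \<psi>])
    fix x assume x: "x \<in> ?P ?U ?V"
    from x P[OF \<phi> \<psi>] have xM: "x \<in> carrier M" by auto
    show "?g x \<zero> = \<zero>"
      using xM \<chi> by (intro add.finprod_one_eqI) auto
    fix r assume r: "r \<in> carrier R"
    show "?g x r \<in> carrier R"
      using xM \<chi> r by (intro finsum_closed) auto
    fix r' assume r': "r' \<in> carrier R"
    have "?g x r \<oplus> ?g x r' = (\<Oplus>w\<in>?W. (if x \<otimes>\<^bsub>M\<^esub> w = t then r \<otimes> \<alpha> x (\<chi> w) else \<zero>) \<oplus>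
        (if x \<otimes>\<^bsub>M\<^esub> w = t then r' \<otimes> \<alpha> x (\<chi> w) else \<zero>))"
      using xM \<chi> r r' by (intro finsum_addf[symmetric]) auto
    also have "\<dots> = ?g x (r \<oplus> r')"
      using xM \<chi> r r' by (intro finsum_cong') (auto simp: l_distr)
    finally show "?g x (r \<oplus> r') = ?g x r \<oplus> ?g x r'" by simp
  qed (use \<phi> \<psi> \<chi> P[OF \<phi> \<psi>] abelian_monoid_axioms in auto)
  finally have L: "(\<phi> \<otimes>\<^bsub>S\<^esub> \<psi> \<otimes>\<^bsub>S\<^esub> \<chi>) t = (\<Oplus>u\<in>?U. \<Oplus>v\<in>?V. ?g (u \<otimes>\<^bsub>M\<^esub> v) (\<phi> u \<otimes> \<alpha> u (\<psi> v)))" .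
  have "(\<phi> \<otimes>\<^bsub>S\<^esub> (\<psi> \<otimes>\<^bsub>S\<^esub> \<chi>)) t =
      (\<Oplus>u\<in>?U. \<Oplus>y\<in>?P ?V ?W. if u \<otimes>\<^bsub>M\<^esub> y = t then \<phi> u \<otimes> \<alpha> u ((\<psi> \<otimes>\<^bsub>S\<^esub> \<chi>) y) else \<zero>)"
    by (rule mult_S) (use \<phi> \<psi> \<chi> P[OF \<psi> \<chi>] supp_mult[OF \<psi> \<chi>] in auto)
  also have "\<dots> = (\<Oplus>u\<in>?U. \<Oplus>v\<in>?V. ?g (u \<otimes>\<^bsub>M\<^esub> v) (\<phi> u \<otimes> \<alpha> u (\<psi> v)))"
  proof (rule finsum_cong')
    fix u assume u: "u \<in> ?U"
    with \<phi> have uM: "u \<in> carrier M" by auto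
    let ?k = "\<lambda>y r. if u \<otimes>\<^bsub>M\<^esub> y = t then \<phi> u \<otimes> \<alpha> u r else \<zero>"
    have "(\<Oplus>y\<in>?P ?V ?W. ?k y ((\<psi> \<otimes>\<^bsub>S\<^esub> \<chi>) y)) =
        (\<Oplus>v\<in>?V. \<Oplus>w\<in>?W. ?k (v \<otimes>\<^bsub>M\<^esub> w) (\<psi> v \<otimes> \<alpha> v (\<chi> w)))"
    proof (rule finsum_mult[OF \<psi> \<chi>])
      fix y r r' assume "r \<in> carrier R" "r' \<in> carrier R"
      then show "?k y (r \<oplus> r') = ?k y r \<oplus> ?k y r'"
        using uM \<phi> by (simp add: ring_hom_add[OF act_hom] r_distr)
    qed (use uM \<phi> \<psi> \<chi> P[OF \<psi> \<chi>] abelian_monoid_axioms in auto)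
    also have "\<dots> = (\<Oplus>v\<in>?V. ?g (u \<otimes>\<^bsub>M\<^esub> v) (\<phi> u \<otimes> \<alpha> u (\<psi> v)))"
    proof (intro finsum_cong')
      fix v w assume "v \<in> ?V" "w \<in> ?W"
      then have vM: "v \<in> carrier M" "w \<in> carrier M" using \<psi> \<chi> by auto
      with uM \<phi> \<psi> \<chi> show "?k (v \<otimes>\<^bsub>M\<^esub> w) (\<psi> v \<otimes> \<alpha> v (\<chi> w)) =
          (if u \<otimes>\<^bsub>M\<^esub> v \<otimes>\<^bsub>M\<^esub> w = t then \<phi> u \<otimes> \<alpha> u (\<psi> v) \<otimes> \<alpha> (u \<otimes>\<^bsub>M\<^esub> v) (\<chi> w) else \<zero>)"
        by (simp add: M.m_assoc m_assoc act_mult ring_hom_mult[OF act_hom])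
    qed (use uM \<phi> \<psi> \<chi> in \<open>auto intro!: finsum_closed\<close>)
    finally show "(\<Oplus>y\<in>?P ?V ?W. ?k y ((\<psi> \<otimes>\<^bsub>S\<^esub> \<chi>) y)) =
        (\<Oplus>v\<in>?V. ?g (u \<otimes>\<^bsub>M\<^esub> v) (\<phi> u \<otimes> \<alpha> u (\<psi> v)))" .
  next
    show "(\<lambda>u. \<Oplus>v\<in>?V. ?g (u \<otimes>\<^bsub>M\<^esub> v) (\<phi> u \<otimes> \<alpha> u (\<psi> v))) \<in> ?U \<rightarrow> carrier R"
      using \<phi> \<psi> \<chi>
      by (auto intro!: finsum_closed R.m_closed act_closed M.m_closed val simp: suppD)
  qed simp
  finally show "(\<phi> \<otimes>\<^bsub>S\<^esub> \<psi> \<otimes>\<^bsub>S\<^esub> \<chi>) t = (\<phi> \<otimes>\<^bsub>S\<^esub> (\<psi> \<otimes>\<^bsub>S\<^esub> \<chi>)) t"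
    using L by simp
qed

lemma one_closed_S: "\<one>\<^bsub>S\<^esub> \<in> carrier S"
  by (rule memI[of _ "{\<one>\<^bsub>M\<^esub>}"]) (auto simp: one_S)

lemma add_closed_S [simp]: "\<phi> \<in> carrier S \<Longrightarrow> \<psi> \<in> carrier S \<Longrightarrow> \<phi> \<oplus>\<^bsub>S\<^esub> \<psi> \<in> carrier S"
  by (rule memI[of _ "supp \<phi> \<union> supp \<psi>"]) (auto simp: add_S)

lemma ring_S: "ring S"
proof (rule ringI)
  show "abelian_group S"
  proof (rule abelian_groupI)
    show "\<zero>\<^bsub>S\<^esub> \<in> carrier S" by (rule memI[of _ "{}"]) (auto simp: zero_S)
    fix \<phi> assume \<phi>: "\<phi> \<in> carrier S"
    have "(\<lambda>u. \<ominus> \<phi> u) \<in> carrier S"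
      by (rule memI[of _ "supp \<phi>"]) (use \<phi> in auto)
    moreover have "(\<lambda>u. \<ominus> \<phi> u) \<oplus>\<^bsub>S\<^esub> \<phi> = \<zero>\<^bsub>S\<^esub>"
      using \<phi> by (auto simp: add_S zero_S l_neg)
    ultimately show "\<exists>\<psi>\<in>carrier S. \<psi> \<oplus>\<^bsub>S\<^esub> \<phi> = \<zero>\<^bsub>S\<^esub>" by blast
  qed (use add_closed_S in \<open>auto simp: add_S zero_S a_ac\<close>)
  show "monoid S"
  proof (rule monoidI)
    fix \<phi> assume \<phi>: "\<phi> \<in> carrier S"
    show "\<one>\<^bsub>S\<^esub> \<otimes>\<^bsub>S\<^esub> \<phi> = \<phi>"
    proof
      fix w
      \<comment> \<open>Adding \<open>w\<close> to the support allows its term to be singled out. If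
        \<open>w\<close> lies outside the monoid, the intersection discards it, and
        \<open>\<phi> w\<close> is zero.\<close>
      have "(\<one>\<^bsub>S\<^esub> \<otimes>\<^bsub>S\<^esub> \<phi>) w =
        (\<Oplus>u\<in>{\<one>\<^bsub>M\<^esub>}. \<Oplus>v\<in>insert w (supp \<phi>) \<inter> carrier M. if u \<otimes>\<^bsub>M\<^esub> v = w then \<one>\<^bsub>S\<^esub> u \<otimes> \<alpha> u (\<phi> v) else \<zero>)"
        by (rule mult_S) (use \<phi> one_closed_S in \<open>auto simp: one_S split: if_splits\<close>)
      also have "\<dots> = (\<Oplus>v\<in>insert w (supp \<phi>) \<inter> carrier M. if v = w then \<phi> v else \<zero>)"
        using \<phi> by (subst finsum_insert)
          (auto intro!: finsum_closed finsum_cong' simp: one_S act_one)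
      also have "\<dots> = \<phi> w"
      proof (cases "w \<in> carrier M")
        case True
        then show ?thesis using \<phi> by (subst finsum_single[of _ w]) auto
      next
        case False
        then have "\<phi> w = \<zero>" using \<phi> by auto
        with False show ?thesis by (auto intro!: add.finprod_one_eqI)
      qed
      finally show "(\<one>\<^bsub>S\<^esub> \<otimes>\<^bsub>S\<^esub> \<phi>) w = \<phi> w" .
    qed
    show "\<phi> \<otimes>\<^bsub>S\<^esub> \<one>\<^bsub>S\<^esub> = \<phi>"
    proof
      fix w
      have "(\<phi> \<otimes>\<^bsub>S\<^esub> \<one>\<^bsub>S\<^esub>) w =
        (\<Oplus>u\<in>insert w (supp \<phi>) \<inter> carrier M. \<Oplus>v\<in>{\<one>\<^bsub>M\<^esub>}. if u \<otimes>\<^bsub>M\<^esub> v = w then \<phi> u \<otimes> \<alpha> u (\<one>\<^bsub>S\<^esub> v) else \<zero>)"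
        by (rule mult_S) (use \<phi> one_closed_S in \<open>auto simp: one_S split: if_splits\<close>)
      also have "\<dots> = (\<Oplus>v\<in>insert w (supp \<phi>) \<inter> carrier M. if v = w then \<phi> v else \<zero>)"
        using \<phi> by (auto intro!: finsum_cong' simp: one_S)
      also have "\<dots> = \<phi> w"
      proof (cases "w \<in> carrier M")
        case True
        then show ?thesis using \<phi> by (subst finsum_single[of _ w]) auto
      next
        case False
        then have "\<phi> w = \<zero>" using \<phi> by auto
        with False show ?thesis by (auto intro!: add.finprod_one_eqI)
      qed
      finally show "(\<phi> \<otimes>\<^bsub>S\<^esub> \<one>\<^bsub>S\<^esub>) w = \<phi> w" .
    qed
  qed (auto simp: mult_assoc one_closed_S)
  fix \<phi> \<psi> \<chi> assume \<phi>: "\<phi> \<in> carrier S" and \<psi>: "\<psi> \<in> carrier S" and \<chi>: "\<chi> \<in> carrier S"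
  let ?A = "supp \<phi> \<union> supp \<psi>"
  let ?t = "\<lambda>w \<phi> \<chi> u v. if u \<otimes>\<^bsub>M\<^esub> v = w then \<phi> u \<otimes> \<alpha> u (\<chi> v) else \<zero>"
  have m: "(\<theta> \<otimes>\<^bsub>S\<^esub> \<eta>) w = (\<Oplus>u\<in>U. \<Oplus>v\<in>V. ?t w \<theta> \<eta> u v)"
    if "\<theta> \<in> carrier S" "\<eta> \<in> carrier S" "finite U" "U \<subseteq> carrier M" "supp \<theta> \<subseteq> U"
      "finite V" "V \<subseteq> carrier M" "supp \<eta> \<subseteq> V" for \<theta> \<eta> U V w
    using that by (rule mult_S)
  show "(\<phi> \<oplus>\<^bsub>S\<^esub> \<psi>) \<otimes>\<^bsub>S\<^esub> \<chi> = \<phi> \<otimes>\<^bsub>S\<^esub> \<chi> \<oplus>\<^bsub>S\<^esub> \<psi> \<otimes>\<^bsub>S\<^esub> \<chi>"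
  proof
    fix w
    have "(\<phi> \<otimes>\<^bsub>S\<^esub> \<chi> \<oplus>\<^bsub>S\<^esub> \<psi> \<otimes>\<^bsub>S\<^esub> \<chi>) w =
        (\<Oplus>u\<in>?A. \<Oplus>v\<in>supp \<chi>. ?t w \<phi> \<chi> u v) \<oplus> (\<Oplus>u\<in>?A. \<Oplus>v\<in>supp \<chi>. ?t w \<psi> \<chi> u v)"
      unfolding add_S by (intro arg_cong2[where f="(\<oplus>)"] m) (use \<phi> \<psi> \<chi> in auto)
    also have "\<dots> = (\<Oplus>u\<in>?A. (\<Oplus>v\<in>supp \<chi>. ?t w \<phi> \<chi> u v) \<oplus> (\<Oplus>v\<in>supp \<chi>. ?t w \<psi> \<chi> u v))"
      by (rule finsum_addf[symmetric]) (use \<phi> \<psi> \<chi> in \<open>auto intro!: finsum_closed\<close>)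
    also have "\<dots> = (\<Oplus>u\<in>?A. \<Oplus>v\<in>supp \<chi>. ?t w \<phi> \<chi> u v \<oplus> ?t w \<psi> \<chi> u v)"
      by (intro finsum_cong' finsum_addf[symmetric]) (use \<phi> \<psi> \<chi> in \<open>auto intro!: finsum_closed\<close>)
    also have "\<dots> = (\<Oplus>u\<in>?A. \<Oplus>v\<in>supp \<chi>. ?t w (\<phi> \<oplus>\<^bsub>S\<^esub> \<psi>) \<chi> u v)"
      by (intro finsum_cong') (use \<phi> \<psi> \<chi> in \<open>auto intro!: finsum_closed simp: add_S l_distr\<close>)
    also have "\<dots> = ((\<phi> \<oplus>\<^bsub>S\<^esub> \<psi>) \<otimes>\<^bsub>S\<^esub> \<chi>) w"
      by (rule m[symmetric]) (use \<phi> \<psi> \<chi> in \<open>auto simp: add_S add_closed_S[unfolded add_S]\<close>)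
    finally show "((\<phi> \<oplus>\<^bsub>S\<^esub> \<psi>) \<otimes>\<^bsub>S\<^esub> \<chi>) w = (\<phi> \<otimes>\<^bsub>S\<^esub> \<chi> \<oplus>\<^bsub>S\<^esub> \<psi> \<otimes>\<^bsub>S\<^esub> \<chi>) w" by simp
  qed
  show "\<chi> \<otimes>\<^bsub>S\<^esub> (\<phi> \<oplus>\<^bsub>S\<^esub> \<psi>) = \<chi> \<otimes>\<^bsub>S\<^esub> \<phi> \<oplus>\<^bsub>S\<^esub> \<chi> \<otimes>\<^bsub>S\<^esub> \<psi>"
  proof
    fix w
    have "(\<chi> \<otimes>\<^bsub>S\<^esub> \<phi> \<oplus>\<^bsub>S\<^esub> \<chi> \<otimes>\<^bsub>S\<^esub> \<psi>) w =
        (\<Oplus>u\<in>supp \<chi>. \<Oplus>v\<in>?A. ?t w \<chi> \<phi> u v) \<oplus> (\<Oplus>u\<in>supp \<chi>. \<Oplus>v\<in>?A. ?t w \<chi> \<psi> u v)"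
      unfolding add_S by (intro arg_cong2[where f="(\<oplus>)"] m) (use \<phi> \<psi> \<chi> in auto)
    also have "\<dots> = (\<Oplus>u\<in>supp \<chi>. (\<Oplus>v\<in>?A. ?t w \<chi> \<phi> u v) \<oplus> (\<Oplus>v\<in>?A. ?t w \<chi> \<psi> u v))"
      by (rule finsum_addf[symmetric]) (use \<phi> \<psi> \<chi> in \<open>auto intro!: finsum_closed\<close>)
    also have "\<dots> = (\<Oplus>u\<in>supp \<chi>. \<Oplus>v\<in>?A. ?t w \<chi> \<phi> u v \<oplus> ?t w \<chi> \<psi> u v)"
      by (intro finsum_cong' finsum_addf[symmetric]) (use \<phi> \<psi> \<chi> in \<open>auto intro!: finsum_closed\<close>)
    also have "\<dots> = (\<Oplus>u\<in>supp \<chi>. \<Oplus>v\<in>?A. ?t w \<chi> (\<phi> \<oplus>\<^bsub>S\<^esub> \<psi>) u v)"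
      by (intro finsum_cong') (use \<phi> \<psi> \<chi> in
        \<open>auto intro!: finsum_closed simp: add_S r_distr ring_hom_add[OF act_hom]\<close>)
    also have "\<dots> = (\<chi> \<otimes>\<^bsub>S\<^esub> (\<phi> \<oplus>\<^bsub>S\<^esub> \<psi>)) w"
      by (rule m[symmetric]) (use \<phi> \<psi> \<chi> in \<open>auto simp: add_S add_closed_S[unfolded add_S]\<close>)
    finally show "(\<chi> \<otimes>\<^bsub>S\<^esub> (\<phi> \<oplus>\<^bsub>S\<^esub> \<psi>)) w = (\<chi> \<otimes>\<^bsub>S\<^esub> \<phi> \<oplus>\<^bsub>S\<^esub> \<chi> \<otimes>\<^bsub>S\<^esub> \<psi>) w" by simp
  qed
qed

end


section \<open>Skew polynomial rings and monoid algebras as instances\<close>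

lemma ring_skew_poly_ring:
  assumes E: "ring E" and \<sigma>: "\<sigma> \<in> ring_hom E E"
  shows "ring (skew_poly_ring E \<sigma>)"
proof -
  interpret E: ring E by fact
  let ?M = "\<lparr>carrier = UNIV, monoid.mult = (+), one = 0\<rparr> :: nat monoid"
  have pow: "(\<sigma> ^^ i) \<in> ring_hom E E" for i
  proof (induction i)
    case (Suc i)
    then show ?case using ring_hom_trans[OF Suc \<sigma>] by (simp add: comp_def)
  qed (simp add: ring_hom_def)
  interpret skew_monoid_ring E ?M "skew_poly_ring E \<sigma>" "\<lambda>i. \<sigma> ^^ i"
  proof
    fix \<phi> \<psi> :: "nat \<Rightarrow> 'a" and U V w
    assume \<phi>\<psi>: "\<phi> \<in> carrier (skew_poly_ring E \<sigma>)" "\<psi> \<in> carrier (skew_poly_ring E \<sigma>)"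
      and UV: "finite U" "{u. \<phi> u \<noteq> \<zero>\<^bsub>E\<^esub>} \<subseteq> U" "finite V" "{u. \<psi> u \<noteq> \<zero>\<^bsub>E\<^esub>} \<subseteq> V"
    have c [simp]: "\<phi> i \<in> carrier E" "\<psi> i \<in> carrier E" for i
      using \<phi>\<psi> by (auto simp: skew_poly_ring_def)
    have \<phi>0: "\<phi> i = \<zero>\<^bsub>E\<^esub>" if "i \<notin> U" for i using UV(2) that by blast
    have p [simp]: "(\<sigma> ^^ i) y \<in> carrier E" if "y \<in> carrier E" for i y
      using ring_hom_closed[OF pow that] .
    have z [simp]: "(\<sigma> ^^ i) \<zero>\<^bsub>E\<^esub> = \<zero>\<^bsub>E\<^esub>" for i
      using ring_hom_zero[OF pow E E] .
    \<comment> \<open>Only \<open>v = w - u\<close> contributes. For \<open>u > w\<close> there is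
      no such \<open>v\<close>, which truncated subtraction would hide; hence the
      conditional.\<close>
    have i: "(\<Oplus>\<^bsub>E\<^esub>v\<in>V. if u + v = w then \<phi> u \<otimes>\<^bsub>E\<^esub> (\<sigma> ^^ u) (\<psi> v) else \<zero>\<^bsub>E\<^esub>) =
        (if u \<le> w then \<phi> u \<otimes>\<^bsub>E\<^esub> (\<sigma> ^^ u) (\<psi> (w - u)) else \<zero>\<^bsub>E\<^esub>)" for u
    proof (cases "u \<le> w \<and> w - u \<in> V")
      case True
      then show ?thesis by (subst E.finsum_single[of _ "w - u"]) (use UV in auto)
    next
      case False
      then have "u \<le> w \<Longrightarrow> \<psi> (w - u) = \<zero>\<^bsub>E\<^esub>" using UV by blast
      then show ?thesis using False by (auto intro!: E.add.finprod_one_eqI)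
    qed
    have "(\<phi> \<otimes>\<^bsub>skew_poly_ring E \<sigma>\<^esub> \<psi>) w = (\<Oplus>\<^bsub>E\<^esub>u\<in>{..w}. \<phi> u \<otimes>\<^bsub>E\<^esub> (\<sigma> ^^ u) (\<psi> (w - u)))"
      by (simp add: skew_poly_ring_def)
    also have "\<dots> = (\<Oplus>\<^bsub>E\<^esub>u\<in>U. if u \<le> w then \<phi> u \<otimes>\<^bsub>E\<^esub> (\<sigma> ^^ u) (\<psi> (w - u)) else \<zero>\<^bsub>E\<^esub>)"
      by (rule E.add.finprod_mono_neutral_cong) (use UV \<phi>0 in \<open>auto split: if_splits\<close>)
    finally show "(\<phi> \<otimes>\<^bsub>skew_poly_ring E \<sigma>\<^esub> \<psi>) w =
        (\<Oplus>\<^bsub>E\<^esub>u\<in>U. \<Oplus>\<^bsub>E\<^esub>v\<in>V. if u \<otimes>\<^bsub>?M\<^esub> v = w then \<phi> u \<otimes>\<^bsub>E\<^esub> (\<sigma> ^^ u) (\<psi> v) else \<zero>\<^bsub>E\<^esub>)"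
      by (simp add: i)
  qed (use pow in \<open>auto simp: skew_poly_ring_def funpow_add\<close>)
  show ?thesis by (rule ring_S)
qed

lemma skew_monoid_ring_monoid_algebra:
  assumes k: "cring k" and M: "monoid M"
  shows "skew_monoid_ring k M (monoid_algebra k M) (\<lambda>_ r. r)"
proof -
  interpret k: cring k by fact
  interpret M: monoid M by fact
  show ?thesis
  proof
    fix \<phi> \<psi> :: "'c \<Rightarrow> 'a" and U V w
    assume \<phi>\<psi>: "\<phi> \<in> carrier (monoid_algebra k M)" "\<psi> \<in> carrier (monoid_algebra k M)"
      and UV: "finite U" "{u. \<phi> u \<noteq> \<zero>\<^bsub>k\<^esub>} \<subseteq> U" "finite V" "{u. \<psi> u \<noteq> \<zero>\<^bsub>k\<^esub>} \<subseteq> V"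
    have c [simp]: "\<phi> i \<in> carrier k" "\<psi> i \<in> carrier k" for i
      using \<phi>\<psi> by (auto simp: monoid_algebra_def)
    have "(\<phi> \<otimes>\<^bsub>monoid_algebra k M\<^esub> \<psi>) w =
        (\<Oplus>\<^bsub>k\<^esub>r\<in>{(u, v). \<phi> u \<noteq> \<zero>\<^bsub>k\<^esub> \<and> \<psi> v \<noteq> \<zero>\<^bsub>k\<^esub> \<and> u \<otimes>\<^bsub>M\<^esub> v = w}. \<phi> (fst r) \<otimes>\<^bsub>k\<^esub> \<psi> (snd r))"
      by (simp add: monoid_algebra_def)
    also have "\<dots> = (\<Oplus>\<^bsub>k\<^esub>r\<in>U \<times> V. if fst r \<otimes>\<^bsub>M\<^esub> snd r = w then \<phi> (fst r) \<otimes>\<^bsub>k\<^esub> \<psi> (snd r) else \<zero>\<^bsub>k\<^esub>)"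
      by (rule k.add.finprod_mono_neutral_cong_left) (use UV in auto)
    also have "\<dots> = (\<Oplus>\<^bsub>k\<^esub>u\<in>U. \<Oplus>\<^bsub>k\<^esub>v\<in>V. if u \<otimes>\<^bsub>M\<^esub> v = w then \<phi> u \<otimes>\<^bsub>k\<^esub> \<psi> v else \<zero>\<^bsub>k\<^esub>)"
      by (subst k.finsum_cartesian) (use UV in \<open>auto cong: if_cong\<close>)
    finally show "(\<phi> \<otimes>\<^bsub>monoid_algebra k M\<^esub> \<psi>) w =
        (\<Oplus>\<^bsub>k\<^esub>u\<in>U. \<Oplus>\<^bsub>k\<^esub>v\<in>V. if u \<otimes>\<^bsub>M\<^esub> v = w then \<phi> u \<otimes>\<^bsub>k\<^esub> \<psi> v else \<zero>\<^bsub>k\<^esub>)" .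
  qed (auto simp: monoid_algebra_def ring_hom_def)
qed


section \<open>Algebras over a central subfield\<close>

locale central_subfield = ring R for R (structure) +
  fixes K
  assumes subfield_K: "subfield K R"
    and central: "k \<in> K \<Longrightarrow> y \<in> carrier R \<Longrightarrow> k \<otimes> y = y \<otimes> k"
begin

lemma K_carrier [simp, intro]: "k \<in> K \<Longrightarrow> k \<in> carrier R"
  using subfieldE(3)[OF subfield_K] by auto

lemma K_closed [simp, intro]:
  "\<zero> \<in> K" "\<one> \<in> K" "k \<in> K \<Longrightarrow> \<ominus> k \<in> K" "k \<in> K \<Longrightarrow> l \<in> K \<Longrightarrow> k \<oplus> l \<in> K"
  "k \<in> K \<Longrightarrow> l \<in> K \<Longrightarrow> k \<otimes> l \<in> K" "k \<in> K \<Longrightarrow> l \<in> K \<Longrightarrow> k \<ominus> l \<in> K"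
  using subringE(2,3,5,6,7)[OF subfieldE(1)[OF subfield_K]] by (auto simp: minus_eq)

lemma K_pow_closed [simp, intro]: "k \<in> K \<Longrightarrow> k [^] (i::nat) \<in> K"
  by (induction i) auto

lemma K_inv:
  assumes "k \<in> K" "k \<noteq> \<zero>"
  shows "inv k \<in> K" "inv k \<noteq> \<zero>" "k \<otimes> inv k = \<one>" "inv k \<otimes> k = \<one>"
  using subfield_m_inv[OF subfield_K, of k] assms by auto

lemma K_Units: "k \<in> K \<Longrightarrow> k \<noteq> \<zero> \<Longrightarrow> k \<in> Units R"
  using K_inv[of k] unfolding Units_def by blast

lemma one_neq_zero: "\<one> \<noteq> \<zero>"
  using subfieldE(6)[OF subfield_K] by simp

lemma K_lcomm: "k \<in> K \<Longrightarrow> y \<in> carrier R \<Longrightarrow> z \<in> carrier R \<Longrightarrow> y \<otimes> (k \<otimes> z) = k \<otimes> (y \<otimes> z)"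
  using central[of k y] by (simp flip: m_assoc)

lemma K_cancel: "k \<in> K \<Longrightarrow> y \<in> carrier R \<Longrightarrow> k \<otimes> y = \<zero> \<Longrightarrow> y \<noteq> \<zero> \<Longrightarrow> k = \<zero>"
proof (rule ccontr)
  assume k: "k \<in> K" "k \<noteq> \<zero>" and y: "y \<in> carrier R" "k \<otimes> y = \<zero>" "y \<noteq> \<zero>"
  have "inv k \<otimes> (k \<otimes> y) = y"
    using K_inv[OF k] k y(1) by (subst m_assoc[symmetric]) auto
  with y K_inv(1)[OF k] show False by simp
qed

lemma add_minus_cancel:
  assumes "u \<in> carrier R" "v \<in> carrier R" "w \<in> carrier R"
  shows "(u \<oplus> v) \<ominus> (u \<oplus> w) = v \<ominus> w"
proof -
  have "(u \<oplus> v) \<ominus> (u \<oplus> w) = (v \<oplus> u) \<oplus> (\<ominus> u \<oplus> \<ominus> w)"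
    using assms by (simp add: minus_eq minus_add a_comm)
  also have "\<dots> = v \<ominus> w"
    using assms by (simp add: minus_eq a_assoc r_neg2)
  finally show ?thesis .
qed

definition subspace :: "'a set \<Rightarrow> bool" where
  "subspace W \<longleftrightarrow> W \<subseteq> carrier R \<and> \<zero> \<in> W \<and> (\<forall>u\<in>W. \<forall>v\<in>W. u \<oplus> v \<in> W) \<and> (\<forall>k\<in>K. \<forall>v\<in>W. k \<otimes> v \<in> W)"

lemma subspaceD:
  assumes "subspace W"
  shows "u \<in> W \<Longrightarrow> u \<in> carrier R" "\<zero> \<in> W" "u \<in> W \<Longrightarrow> v \<in> W \<Longrightarrow> u \<oplus> v \<in> W"
    "k \<in> K \<Longrightarrow> v \<in> W \<Longrightarrow> k \<otimes> v \<in> W" "v \<in> W \<Longrightarrow> \<ominus> v \<in> W" "u \<in> W \<Longrightarrow> v \<in> W \<Longrightarrow> u \<ominus> v \<in> W"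
proof -
  show neg: "v \<in> W \<Longrightarrow> \<ominus> v \<in> W" for v
  proof -
    assume v: "v \<in> W"
    with assms have "\<ominus> \<one> \<otimes> v \<in> W" "v \<in> carrier R" unfolding subspace_def by auto
    then show "\<ominus> v \<in> W" by (simp add: l_minus)
  qed
  show "u \<in> W \<Longrightarrow> v \<in> W \<Longrightarrow> u \<ominus> v \<in> W"
    using assms neg unfolding subspace_def minus_eq by auto
qed (use assms in \<open>auto simp: subspace_def\<close>)

lemma subspace_finsum:
  assumes "subspace W" "\<And>i. i \<in> I \<Longrightarrow> f i \<in> W"
  shows "(\<Oplus>i\<in>I. f i) \<in> W"
  using assms(2)
proof (induction I rule: infinite_finite_induct)
  case (insert i I)
  then have "f \<in> I \<rightarrow> carrier R" "f i \<in> carrier R" using subspaceD(1)[OF assms(1)] by auto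
  with insert show ?case using subspaceD(3)[OF assms(1)] by simp
qed (use subspaceD(2)[OF assms(1)] in auto)

lemma subspace_zero: "subspace {\<zero>}"
  by (auto simp: subspace_def)

lemma subspace_ideal: "ideal I R \<Longrightarrow> subspace I"
  unfolding subspace_def
  using ideal.I_l_closed[of I R] additive_subgroup.a_subset[OF ideal.axioms(1), of I R]
    additive_subgroup.a_closed[OF ideal.axioms(1), of I R]
    additive_subgroup.zero_closed[OF ideal.axioms(1), of I R] by auto

definition lincombs :: "'i set \<Rightarrow> ('i \<Rightarrow> 'a) \<Rightarrow> 'a set" where
  "lincombs I w = {\<Oplus>i\<in>I. c i \<otimes> w i | c. c \<in> I \<rightarrow> K}"

lemma lincombs_subspace:
  assumes "w \<in> I \<rightarrow> carrier R"
  shows "subspace (lincombs I w)"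
  unfolding subspace_def
proof (intro conjI ballI)
  show "lincombs I w \<subseteq> carrier R"
    using assms by (fastforce simp: lincombs_def Pi_iff intro!: finsum_closed)
  have "(\<Oplus>i\<in>I. \<zero> \<otimes> w i) = \<zero>"
    using assms by (intro add.finprod_one_eqI) (auto simp: Pi_iff)
  then show "\<zero> \<in> lincombs I w"
    unfolding lincombs_def by (intro CollectI exI[of _ "\<lambda>_. \<zero>"]) auto
  fix u v assume "u \<in> lincombs I w" "v \<in> lincombs I w"
  then obtain c d where c: "c \<in> I \<rightarrow> K" "u = (\<Oplus>i\<in>I. c i \<otimes> w i)"
    and d: "d \<in> I \<rightarrow> K" "v = (\<Oplus>i\<in>I. d i \<otimes> w i)"
    by (auto simp: lincombs_def)
  have "u \<oplus> v = (\<Oplus>i\<in>I. c i \<otimes> w i \<oplus> d i \<otimes> w i)"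
    unfolding c d by (rule finsum_addf[symmetric]) (use assms c d in \<open>auto simp: Pi_iff\<close>)
  also have "\<dots> = (\<Oplus>i\<in>I. (c i \<oplus> d i) \<otimes> w i)"
    by (rule finsum_cong') (use assms c d in \<open>auto simp: Pi_iff l_distr\<close>)
  finally show "u \<oplus> v \<in> lincombs I w"
    using c d unfolding lincombs_def by (auto intro!: exI[of _ "\<lambda>i. c i \<oplus> d i"])
next
  fix k v assume k: "k \<in> K" and "v \<in> lincombs I w"
  then obtain d where d: "d \<in> I \<rightarrow> K" "v = (\<Oplus>i\<in>I. d i \<otimes> w i)"
    by (auto simp: lincombs_def)
  have "k \<otimes> v = (\<Oplus>i\<in>I. k \<otimes> (d i \<otimes> w i))"
  proof (cases "finite I")
    case True
    then show ?thesis
      unfolding d by (intro finsum_rdistr) (use assms k d in \<open>auto simp: Pi_iff\<close>)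
  qed (use k d in auto)
  also have "\<dots> = (\<Oplus>i\<in>I. (k \<otimes> d i) \<otimes> w i)"
    by (rule finsum_cong') (use assms k d in \<open>auto simp: Pi_iff m_assoc\<close>)
  finally show "k \<otimes> v \<in> lincombs I w"
    using k d unfolding lincombs_def by (auto intro!: exI[of _ "\<lambda>i. k \<otimes> d i"])
qed

lemma lincombs_incl:
  assumes "finite I" "w \<in> I \<rightarrow> carrier R" "i \<in> I"
  shows "w i \<in> lincombs I w"
proof -
  have "(\<Oplus>j\<in>I. (if j = i then \<one> else \<zero>) \<otimes> w j) = (if i = i then \<one> else \<zero>) \<otimes> w i"
    by (rule finsum_single) (use assms in \<open>auto simp: Pi_iff\<close>)
  then have "w i = (\<Oplus>j\<in>I. (if j = i then \<one> else \<zero>) \<otimes> w j)" using assms by (auto simp: Pi_iff)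
  then show ?thesis unfolding lincombs_def
    by (intro CollectI exI[of _ "\<lambda>j. if j = i then \<one> else \<zero>"]) auto
qed

lemma lincombs_min: "subspace W \<Longrightarrow> (\<And>i. i \<in> I \<Longrightarrow> w i \<in> W) \<Longrightarrow> lincombs I w \<subseteq> W"
  by (auto simp: lincombs_def intro!: subspace_finsum subspaceD(4))

text \<open>Minimality of the span is used twice, first for left multiplication by a fixed
  \<open>w i\<close>, which is linear because \<open>K\<close> is central, then for right
  multiplication by the fixed \<open>z\<close>.\<close>

lemma lincombs_mult_closed:
  assumes w: "finite I" "w \<in> I \<rightarrow> carrier R" and v: "finite J" "v \<in> J \<rightarrow> carrier R"
    and W: "subspace W" and wv: "\<And>i j. i \<in> I \<Longrightarrow> j \<in> J \<Longrightarrow> w i \<otimes> v j \<in> W"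
    and y: "y \<in> lincombs I w" and z: "z \<in> lincombs J v"
  shows "y \<otimes> z \<in> W"
proof -
  have "lincombs J v \<subseteq> {z \<in> carrier R. w i \<otimes> z \<in> W}" if i: "i \<in> I" for i
  proof (rule lincombs_min)
    have wi: "w i \<in> carrier R" using w i by auto
    show "subspace {z \<in> carrier R. w i \<otimes> z \<in> W}"
      using subspaceD[OF W] wi by (auto simp: subspace_def r_distr K_lcomm)
  qed (use wv i v in auto)
  then have iz: "w i \<otimes> z \<in> W" if "i \<in> I" for i using z that by auto
  have zR: "z \<in> carrier R" using z subspaceD(1)[OF lincombs_subspace[OF v(2)]] by auto
  have "lincombs I w \<subseteq> {y \<in> carrier R. y \<otimes> z \<in> W}"
  proof (rule lincombs_min)
    show "subspace {y \<in> carrier R. y \<otimes> z \<in> W}"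
      using subspaceD[OF W] zR by (auto simp: subspace_def l_distr m_assoc)
  qed (use iz w in auto)
  then show ?thesis using y by auto
qed

definition lin_indep :: "'i set \<Rightarrow> ('i \<Rightarrow> 'a) \<Rightarrow> bool" where
  "lin_indep I w \<longleftrightarrow> (\<forall>c \<in> I \<rightarrow> K. (\<Oplus>i\<in>I. c i \<otimes> w i) = \<zero> \<longrightarrow> (\<forall>i\<in>I. c i = \<zero>))"

text \<open>\<open>dimension\<close> grows by adjoining a vector outside the space reached so far,
  so independence is consumed one vector at a time.\<close>

lemma dimension_lincombs:
  assumes "finite I" "w \<in> I \<rightarrow> carrier R" "lin_indep I w"
  shows "dimension (card I) K (lincombs I w)"
  using assms
proof (induction I rule: finite_induct)
  case empty
  then show ?case by (auto simp: lincombs_def)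
next
  case (insert i I)
  then have w: "w \<in> I \<rightarrow> carrier R" "w i \<in> carrier R" by auto
  have upd: "(\<Oplus>j\<in>insert i I. (c(i := k)) j \<otimes> w j) = k \<otimes> w i \<oplus> (\<Oplus>j\<in>I. c j \<otimes> w j)"
    if "c \<in> I \<rightarrow> K" "k \<in> K" for c k
  proof -
    have "(\<Oplus>j\<in>I. (c(i := k)) j \<otimes> w j) = (\<Oplus>j\<in>I. c j \<otimes> w j)"
      by (rule finsum_cong') (use that w insert in \<open>auto simp: Pi_iff\<close>)
    moreover have "(\<Oplus>j\<in>insert i I. (c(i := k)) j \<otimes> w j) =
        (c(i := k)) i \<otimes> w i \<oplus> (\<Oplus>j\<in>I. (c(i := k)) j \<otimes> w j)"
      by (rule finsum_insert) (use that w insert in \<open>auto simp: Pi_iff\<close>)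
    ultimately show ?thesis by simp
  qed
  have ext: "lincombs (insert i I) w = line_extension K (w i) (lincombs I w)"
  proof (rule subset_antisym; rule subsetI)
    fix u assume "u \<in> lincombs (insert i I) w"
    then obtain c where c: "c \<in> insert i I \<rightarrow> K" "u = (\<Oplus>j\<in>insert i I. c j \<otimes> w j)"
      by (auto simp: lincombs_def)
    then have "u = c i \<otimes> w i \<oplus> (\<Oplus>j\<in>I. c j \<otimes> w j)" using upd[of c "c i"] by auto
    moreover have "c i \<in> K" "(\<Oplus>j\<in>I. c j \<otimes> w j) \<in> lincombs I w"
      using c(1) by (auto simp: lincombs_def)
    ultimately show "u \<in> line_extension K (w i) (lincombs I w)"
      unfolding line_extension_mem_iff by blast
  next
    fix u assume "u \<in> line_extension K (w i) (lincombs I w)"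
    then obtain c k where "k \<in> K" "c \<in> I \<rightarrow> K" "u = k \<otimes> w i \<oplus> (\<Oplus>j\<in>I. c j \<otimes> w j)"
      by (auto simp: line_extension_mem_iff lincombs_def)
    with upd[of c k] show "u \<in> lincombs (insert i I) w"
      unfolding lincombs_def by (intro CollectI exI[of _ "c(i := k)"]) auto
  qed
  have indep: "lin_indep I w"
    unfolding lin_indep_def
  proof (intro ballI impI)
    fix c j assume c: "c \<in> I \<rightarrow> K" "(\<Oplus>i\<in>I. c i \<otimes> w i) = \<zero>" and j: "j \<in> I"
    from c have "c(i := \<zero>) \<in> insert i I \<rightarrow> K" by auto
    moreover have "(\<Oplus>j\<in>insert i I. (c(i := \<zero>)) j \<otimes> w j) = \<zero>" using upd[of c \<zero>] c w by simp
    ultimately have "(c(i := \<zero>)) j = \<zero>"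
      using insert.prems(2) j unfolding lin_indep_def by blast
    then show "c j = \<zero>" using j insert(2) by (auto split: if_splits)
  qed
  \<comment> \<open>Membership would produce a vanishing combination whose coefficient at
    \<open>i\<close> is the nonzero scalar \<open>\<ominus> \<one>\<close>.\<close>
  have "w i \<notin> lincombs I w"
  proof
    assume "w i \<in> lincombs I w"
    then obtain c where c: "c \<in> I \<rightarrow> K" "w i = (\<Oplus>j\<in>I. c j \<otimes> w j)" by (auto simp: lincombs_def)
    have "(\<Oplus>j\<in>insert i I. (c(i := \<ominus> \<one>)) j \<otimes> w j) = \<ominus> \<one> \<otimes> w i \<oplus> w i"
      using upd[of c "\<ominus> \<one>"] c by simp
    also have "\<dots> = \<zero>" using w by (simp add: l_minus l_neg)
    finally have sum: "(\<Oplus>j\<in>insert i I. (c(i := \<ominus> \<one>)) j \<otimes> w j) = \<zero>" .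
    have "c(i := \<ominus> \<one>) \<in> insert i I \<rightarrow> K" using c by auto
    then have "\<forall>j\<in>insert i I. (c(i := \<ominus> \<one>)) j = \<zero>"
      using insert.prems(2) sum unfolding lin_indep_def by blast
    then have "\<ominus> \<one> = \<zero>" by simp
    then have "\<ominus> (\<ominus> \<one>) = \<zero>" by simp
    then show False using one_neq_zero by simp
  qed
  then show ?case
    unfolding ext using Suc_dim[OF w(2) _ insert.IH[OF w(1) indep]] insert(1,2) by simp
qed

definition lin_map :: "('a \<Rightarrow> 'a) \<Rightarrow> bool" where
  "lin_map \<theta> \<longleftrightarrow> (\<forall>u\<in>carrier R. \<theta> u \<in> carrier R) \<and>
     (\<forall>u\<in>carrier R. \<forall>v\<in>carrier R. \<theta> (u \<oplus> v) = \<theta> u \<oplus> \<theta> v) \<and>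
     (\<forall>k\<in>K. \<forall>u\<in>carrier R. \<theta> (k \<otimes> u) = k \<otimes> \<theta> u)"

text \<open>Subtracting from a sum of joint eigenvectors a multiple of its image under an operator
  kills one summand, so a shortest counterexample can be shortened.\<close>

lemma eigenvector_separation:
  assumes W: "subspace W" and \<Theta>: "\<And>\<theta>. \<theta> \<in> \<Theta> \<Longrightarrow> lin_map (D \<theta>)"
    and stable: "\<And>\<theta> u. \<theta> \<in> \<Theta> \<Longrightarrow> u \<in> W \<Longrightarrow> D \<theta> u \<in> W"
    and I: "finite I" "w \<in> I \<rightarrow> carrier R"
    and eigen: "\<And>\<theta> i. \<theta> \<in> \<Theta> \<Longrightarrow> i \<in> I \<Longrightarrow> D \<theta> (w i) = \<chi> \<theta> i \<otimes> w i"
    and \<chi>: "\<And>\<theta> i. \<theta> \<in> \<Theta> \<Longrightarrow> i \<in> I \<Longrightarrow> \<chi> \<theta> i \<in> K"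
    and separated: "\<And>i j. i \<in> I \<Longrightarrow> j \<in> I \<Longrightarrow> i \<noteq> j \<Longrightarrow> \<exists>\<theta>\<in>\<Theta>. \<chi> \<theta> i \<noteq> \<chi> \<theta> j"
    and sum: "(\<Oplus>i\<in>I. w i) \<in> W"
  shows "\<forall>i\<in>I. w i \<in> W"
  using I eigen \<chi> separated sum
proof (induction I arbitrary: w rule: finite_induct)
  case (insert k T)
  let ?Y = "\<Oplus>i\<in>T. w i"
  have w: "w k \<in> carrier R" "w \<in> T \<rightarrow> carrier R" "?Y \<in> carrier R"
    using insert.prems by (auto intro!: finsum_closed)
  have y: "(\<Oplus>i\<in>insert k T. w i) = w k \<oplus> ?Y" using insert w by simp
  have wT: "w j \<in> W" if j: "j \<in> T" for j
  proof -
    obtain \<theta> where \<theta>: "\<theta> \<in> \<Theta>" "\<chi> \<theta> j \<noteq> \<chi> \<theta> k"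
      using insert.prems(4)[of j k] j insert(2) by blast
    have \<chi>K: "\<chi> \<theta> i \<in> K" if "i \<in> insert k T" for i using insert.prems(3)[OF \<theta>(1) that] .
    let ?w = "\<lambda>i. (\<chi> \<theta> i \<ominus> \<chi> \<theta> k) \<otimes> w i"
    have lin: "\<And>u v. u \<in> carrier R \<Longrightarrow> v \<in> carrier R \<Longrightarrow> D \<theta> (u \<oplus> v) = D \<theta> u \<oplus> D \<theta> v"
      "\<And>u. u \<in> carrier R \<Longrightarrow> D \<theta> u \<in> carrier R"
      "\<And>l u. l \<in> K \<Longrightarrow> u \<in> carrier R \<Longrightarrow> D \<theta> (l \<otimes> u) = l \<otimes> D \<theta> u"
      using \<Theta>[OF \<theta>(1)] unfolding lin_map_def by auto
    have \<theta>0: "D \<theta> \<zero> = \<zero>" using lin(3)[of \<zero> \<zero>] lin(2)[of \<zero>] by auto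
    have "D \<theta> (w k \<oplus> ?Y) = \<chi> \<theta> k \<otimes> w k \<oplus> D \<theta> ?Y"
      using lin w insert.prems(2)[OF \<theta>(1)] by auto
    then have "D \<theta> (w k \<oplus> ?Y) \<ominus> \<chi> \<theta> k \<otimes> (w k \<oplus> ?Y) = D \<theta> ?Y \<ominus> \<chi> \<theta> k \<otimes> ?Y"
      using add_minus_cancel[of "\<chi> \<theta> k \<otimes> w k" "D \<theta> ?Y" "\<chi> \<theta> k \<otimes> ?Y"] w \<chi>K[of k] lin(2)[OF w(3)]
      by (simp add: r_distr)
    also have "D \<theta> ?Y = (\<Oplus>i\<in>T. D \<theta> (w i))"
      by (rule finsum_additive) (use abelian_monoid_axioms lin w \<theta>0 in auto)
    also have "\<dots> = (\<Oplus>i\<in>T. \<chi> \<theta> i \<otimes> w i)"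
      by (rule finsum_cong') (use insert.prems(2)[OF \<theta>(1)] \<chi>K w in \<open>auto simp: Pi_iff\<close>)
    also have "(\<Oplus>i\<in>T. \<chi> \<theta> i \<otimes> w i) \<ominus> \<chi> \<theta> k \<otimes> ?Y =
        (\<Oplus>i\<in>T. \<chi> \<theta> i \<otimes> w i) \<oplus> (\<ominus> \<chi> \<theta> k) \<otimes> ?Y"
      using \<chi>K[of k] w by (simp add: minus_eq l_minus)
    also have "(\<ominus> \<chi> \<theta> k) \<otimes> ?Y = (\<Oplus>i\<in>T. (\<ominus> \<chi> \<theta> k) \<otimes> w i)"
      by (rule finsum_rdistr) (use \<chi>K[of k] w insert in auto)
    also have "(\<Oplus>i\<in>T. \<chi> \<theta> i \<otimes> w i) \<oplus> (\<Oplus>i\<in>T. (\<ominus> \<chi> \<theta> k) \<otimes> w i) =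
        (\<Oplus>i\<in>T. \<chi> \<theta> i \<otimes> w i \<oplus> (\<ominus> \<chi> \<theta> k) \<otimes> w i)"
      by (rule finsum_addf[symmetric]) (use \<chi>K w in \<open>auto simp: Pi_iff\<close>)
    also have "\<dots> = (\<Oplus>i\<in>T. ?w i)"
      by (rule finsum_cong') (use \<chi>K w in \<open>auto simp: Pi_iff minus_eq l_distr\<close>)
    finally have "(\<Oplus>i\<in>T. ?w i) = D \<theta> (w k \<oplus> ?Y) \<ominus> \<chi> \<theta> k \<otimes> (w k \<oplus> ?Y)" by (rule sym)
    also have "\<dots> \<in> W"
      using insert.prems(5) \<chi>K[of k] y by (auto intro!: subspaceD(4,6)[OF W] stable[OF \<theta>(1)])
    finally have s: "(\<Oplus>i\<in>T. ?w i) \<in> W" .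
    have "\<forall>i\<in>T. ?w i \<in> W"
    proof (rule insert.IH[OF _ _ _ _ s])
      fix \<theta>' i assume i: "\<theta>' \<in> \<Theta>" "i \<in> T"
      show "D \<theta>' (?w i) = \<chi> \<theta>' i \<otimes> ?w i"
        using \<Theta>[OF i(1)] \<chi>K w i insert.prems(2,3)[OF i(1), of i]
        by (simp add: lin_map_def K_lcomm Pi_iff)
    qed (use \<chi>K w insert.prems(3,4) in \<open>auto simp: Pi_iff\<close>)
    then have jw: "(\<chi> \<theta> j \<ominus> \<chi> \<theta> k) \<otimes> w j \<in> W" using j by auto
    have d: "\<chi> \<theta> j \<ominus> \<chi> \<theta> k \<in> K" "\<chi> \<theta> j \<ominus> \<chi> \<theta> k \<noteq> \<zero>"
      using \<chi>K j \<theta>(2) by auto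
    have "inv (\<chi> \<theta> j \<ominus> \<chi> \<theta> k) \<otimes> ((\<chi> \<theta> j \<ominus> \<chi> \<theta> k) \<otimes> w j) \<in> W"
      using subspaceD(4)[OF W K_inv(1)[OF d] jw] .
    also have "inv (\<chi> \<theta> j \<ominus> \<chi> \<theta> k) \<otimes> ((\<chi> \<theta> j \<ominus> \<chi> \<theta> k) \<otimes> w j) = w j"
      using K_inv[OF d] d w j by (subst m_assoc[symmetric]) (auto simp: Pi_iff)
    finally show ?thesis .
  qed
  have "w k \<oplus> ?Y \<ominus> ?Y \<in> W"
    using subspaceD(6)[OF W insert.prems(5) subspace_finsum[OF W wT]] y by simp
  moreover have "w k \<oplus> ?Y \<ominus> ?Y = w k" using w by (simp add: minus_eq a_assoc r_neg)
  ultimately show ?case using wT by auto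
qed simp

text \<open>The case \<open>W = {\<zero>}\<close> of the separation, applied to the scaled vectors
  \<open>c i \<otimes> w i\<close>, which have the same characters as the
  \<open>w i\<close>.\<close>

lemma eigenvectors_lin_indep:
  assumes \<Theta>: "\<And>\<theta>. \<theta> \<in> \<Theta> \<Longrightarrow> lin_map (D \<theta>)"
    and I: "finite I" "w \<in> I \<rightarrow> carrier R" "\<And>i. i \<in> I \<Longrightarrow> w i \<noteq> \<zero>"
    and eigen: "\<And>\<theta> i. \<theta> \<in> \<Theta> \<Longrightarrow> i \<in> I \<Longrightarrow> D \<theta> (w i) = \<chi> \<theta> i \<otimes> w i"
    and \<chi>: "\<And>\<theta> i. \<theta> \<in> \<Theta> \<Longrightarrow> i \<in> I \<Longrightarrow> \<chi> \<theta> i \<in> K"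
    and separated: "\<And>i j. i \<in> I \<Longrightarrow> j \<in> I \<Longrightarrow> i \<noteq> j \<Longrightarrow> \<exists>\<theta>\<in>\<Theta>. \<chi> \<theta> i \<noteq> \<chi> \<theta> j"
  shows "lin_indep I w"
  unfolding lin_indep_def
proof (intro ballI impI)
  fix c i assume c: "c \<in> I \<rightarrow> K" "(\<Oplus>i\<in>I. c i \<otimes> w i) = \<zero>" and i: "i \<in> I"
  have "\<forall>i\<in>I. c i \<otimes> w i \<in> {\<zero>}"
  proof (rule eigenvector_separation[OF subspace_zero \<Theta> _ I(1) _ _ \<chi> separated])
    fix \<theta> u assume "\<theta> \<in> \<Theta>" "u \<in> {\<zero>}"
    then show "D \<theta> u \<in> {\<zero>}"
      using \<Theta>[of \<theta>] K_closed(1) unfolding lin_map_def by (metis l_null singletonD singletonI zero_closed)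
  next
    fix \<theta> i assume i: "\<theta> \<in> \<Theta>" "i \<in> I"
    show "D \<theta> (c i \<otimes> w i) = \<chi> \<theta> i \<otimes> (c i \<otimes> w i)"
      using \<Theta>[OF i(1)] eigen[OF i] \<chi>[OF i] c I i by (simp add: lin_map_def K_lcomm Pi_iff)
  qed (use c I in \<open>auto simp: Pi_iff\<close>)
  then show "c i = \<zero>" using K_cancel[of "c i" "w i"] c I i by auto
qed


section \<open>Conjugation by units, radicals of scalars, and passage to subrings\<close>

definition conj_by :: "'a \<Rightarrow> 'a \<Rightarrow> 'a" where "conj_by g u = g \<otimes> u \<otimes> inv g"

lemma lin_map_conj: "g \<in> Units R \<Longrightarrow> lin_map (conj_by g)"
  unfolding lin_map_def conj_by_def by (auto simp: r_distr l_distr K_lcomm m_assoc Units_closed)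

lemma conj_by_mult:
  assumes "g \<in> Units R" "u \<in> carrier R" "v \<in> carrier R"
  shows "conj_by g (u \<otimes> v) = conj_by g u \<otimes> conj_by g v"
proof -
  have "conj_by g u \<otimes> conj_by g v = g \<otimes> u \<otimes> (inv g \<otimes> g) \<otimes> v \<otimes> inv g"
    unfolding conj_by_def using assms by (simp add: m_assoc Units_closed del: Units_l_inv)
  then show ?thesis unfolding conj_by_def using assms by (simp add: m_assoc Units_closed)
qed

lemma conj_by_add:
  "g \<in> Units R \<Longrightarrow> u \<in> carrier R \<Longrightarrow> v \<in> carrier R \<Longrightarrow> conj_by g (u \<oplus> v) = conj_by g u \<oplus> conj_by g v"
  and conj_by_closed: "g \<in> Units R \<Longrightarrow> u \<in> carrier R \<Longrightarrow> conj_by g u \<in> carrier R"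
  and conj_by_smult: "g \<in> Units R \<Longrightarrow> k \<in> K \<Longrightarrow> u \<in> carrier R \<Longrightarrow> conj_by g (k \<otimes> u) = k \<otimes> conj_by g u"
  using lin_map_conj by (auto simp: lin_map_def)

lemma conj_by_commute:
  "g \<in> Units R \<Longrightarrow> u \<in> carrier R \<Longrightarrow> g \<otimes> u = u \<otimes> g \<Longrightarrow> conj_by g u = u"
  unfolding conj_by_def by (simp add: m_assoc Units_closed)

lemma conj_by_eigen:
  "g \<in> Units R \<Longrightarrow> u \<in> carrier R \<Longrightarrow> k \<in> K \<Longrightarrow> g \<otimes> u = k \<otimes> (u \<otimes> g) \<Longrightarrow> conj_by g u = k \<otimes> u"
  unfolding conj_by_def by (simp add: m_assoc Units_closed)

text \<open>\<open>y\<close> times its power with exponent \<open>N - 1\<close> is an invertible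
  scalar. As this scalar is central, the same inverse works on both sides.\<close>

lemma Units_of_pow:
  assumes "y \<in> carrier R" "y [^] N \<in> K" "y [^] N \<noteq> \<zero>" "(N::nat) > 0"
  shows "y \<in> Units R"
proof -
  obtain M where N: "N = Suc M" using assms(4) by (cases N) auto
  let ?i = "inv (y [^] N) \<otimes> y [^] M"
  have i: "inv (y [^] N) \<in> K" using K_inv(1)[OF assms(2,3)] .
  have "?i \<otimes> y = \<one>"
    using m_assoc[OF K_carrier[OF i] nat_pow_closed[OF assms(1)] assms(1), of M]
      K_inv(4)[OF assms(2,3)]
    unfolding N by simp
  moreover have "y \<otimes> ?i = inv (y [^] N) \<otimes> (y \<otimes> y [^] M)"
    by (rule K_lcomm) (use i assms(1) in auto)
  then have "y \<otimes> ?i = \<one>"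
    using K_inv(4)[OF assms(2,3)] nat_pow_Suc2[OF assms(1), of M] N by simp
  ultimately show ?thesis using assms(1) i unfolding Units_def by auto
qed

lemma Units_neq_zero:
  assumes "u \<in> Units R"
  shows "u \<noteq> \<zero>"
proof
  assume "u = \<zero>"
  then have "inv u \<otimes> u = inv u \<otimes> \<zero>" by (rule arg_cong)
  also have "\<dots> = \<zero>" by (rule r_null[OF Units_inv_closed[OF assms]])
  finally show False using Units_l_inv[OF assms] one_neq_zero by metis
qed

lemma Units_pow: "u \<in> Units R \<Longrightarrow> u [^] (i::nat) \<in> Units R"
  by (induction i) auto

text \<open>The inverse is a scalar multiple of \<open>y [^] (N - 1)\<close>, so it never leaves a
  subring that contains \<open>K\<close> and \<open>y\<close>.\<close>

lemma inv_in_generated: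
  assumes "subring V R" "K \<subseteq> V" "y \<in> V" "y [^] N \<in> K" "y [^] N \<noteq> \<zero>" "(N::nat) > 0"
  shows "inv y \<in> V"
proof -
  have yR: "y \<in> carrier R" using subringE(1)[OF assms(1)] assms(3) by auto
  obtain M where N: "N = Suc M" using assms(6) by (cases N) auto
  have pow: "y [^] (i::nat) \<in> V" for i
  proof (induction i)
    case 0
    show ?case using subringE(3)[OF assms(1)] by simp
  next
    case (Suc i)
    then show ?case using assms(3) subringE(6)[OF assms(1)] by simp
  qed
  have i: "inv (y [^] N) \<in> K" using K_inv(1)[OF assms(4,5)] .
  have "inv (y [^] N) \<otimes> y [^] M \<otimes> y = \<one>"
    using m_assoc[OF K_carrier[OF i] nat_pow_closed[OF yR] yR, of M] K_inv(4)[OF assms(4,5)]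
    unfolding N by simp
  then have "inv (y [^] N) \<otimes> y [^] M = inv y"
    using inv_unique[of "inv (y [^] N) \<otimes> y [^] M" y "inv y"] Units_of_pow[OF yR assms(4-6)] i yR
    by (simp add: Units_closed)
  moreover have "inv (y [^] N) \<otimes> y [^] M \<in> V"
    using i pow[of M] assms(2) subringE(6)[OF assms(1)] by blast
  ultimately show ?thesis by simp
qed

lemma subfield_of_subring:
  assumes "subring V R" "K \<subseteq> V"
  shows "subfield K (R\<lparr>carrier := V\<rparr>)"
  using ring.subfield_iff(1)[OF subring_is_ring[OF assms(1)], of K] subfield_iff(2)[OF subfield_K] assms(2)
  by simp

text \<open>Dimension refers to the carrier from which new vectors may be taken. The vectors
  adjoined to reach \<open>W\<close> lie in \<open>W\<close>, hence in \<open>V\<close>, so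
  shrinking the carrier to \<open>V\<close> changes nothing.\<close>

lemma dimension_subring:
  assumes V: "subring V R" and "dimension n K W" "W \<subseteq> V" "K \<subseteq> V"
  shows "ring.dimension (R\<lparr>carrier := V\<rparr>) n K W"
  using assms(2-3)
proof (induction n arbitrary: W)
  case 0
  then have "W = {\<zero>}" using dimension_zero[OF subfield_K] by simp
  then show ?case using ring.zero_dim[OF subring_is_ring[OF V], of K] by simp
next
  case (Suc n)
  obtain v W' where W': "v \<in> carrier R" "v \<notin> W'" "dimension n K W'" "W = line_extension K v W'"
    using dimension_backwards[OF subfield_K Suc.prems(1)] by (elim bexE exE conjE)
  note sub = space_subgroup_props(1,2)[OF subfield_K W'(3)]
  have "v = \<one> \<otimes> v \<oplus> \<zero>" using W'(1) by simp
  then have "v \<in> W"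
    unfolding W'(4) line_extension_mem_iff using sub(2) K_closed(2) by blast
  moreover have "W' \<subseteq> W"
  proof
    fix w assume w: "w \<in> W'"
    then have "w = \<zero> \<otimes> v \<oplus> w" using W'(1) subsetD[OF sub(1) w] by simp
    then show "w \<in> W" unfolding W'(4) line_extension_mem_iff using w K_closed(1) by blast
  qed
  ultimately have "v \<in> V" "W' \<subseteq> V" using Suc.prems(2) by auto
  have "line_extension K v W' = ring.line_extension (R\<lparr>carrier := V\<rparr>) K v W'"
    by (simp add: line_extension_consistent[OF V])
  then show ?case
    using ring.Suc_dim[OF subring_is_ring[OF V], of v W' n K] W'(2,4)
      Suc.IH[OF W'(3) \<open>W' \<subseteq> V\<close>] \<open>v \<in> V\<close>
    by simp
qed

end


section \<open>Two units commuting up to a root of unity\<close>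

text \<open>The relations of a symbol algebra. \<open>R\<close> is not assumed to be generated by
  \<open>y\<close> and \<open>z\<close>, so the powers belonging to a single prime form such a pair
  inside the same ring.\<close>

locale quantum_pair = central_subfield R K for R (structure) and K +
  fixes \<omega> y z :: 'a and N :: nat
  assumes N_pos: "N > 0"
    and \<omega>_K: "\<omega> \<in> K" and \<omega>_pow_N: "\<omega> [^] N = \<one>"
    and \<omega>_primitive: "0 < i \<Longrightarrow> i < N \<Longrightarrow> \<omega> [^] i \<noteq> \<one>"
    and y_closed: "y \<in> carrier R" and y_pow_N: "y [^] N \<in> K" "y [^] N \<noteq> \<zero>"
    and z_closed: "z \<in> carrier R" and z_pow_N: "z [^] N \<in> K" "z [^] N \<noteq> \<zero>"
    and zy: "z \<otimes> y = \<omega> \<otimes> (y \<otimes> z)"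
begin

lemma y_Unit: "y \<in> Units R"
  using Units_of_pow[OF y_closed y_pow_N N_pos] .

lemma z_Unit: "z \<in> Units R"
  using Units_of_pow[OF z_closed z_pow_N N_pos] .

lemma \<omega>_neq_zero: "\<omega> \<noteq> \<zero>"
proof
  assume "\<omega> = \<zero>"
  then have "\<omega> [^] N = \<zero>" using N_pos by (cases N) auto
  with \<omega>_pow_N one_neq_zero show False by simp
qed

lemma \<omega>_pow_inj:
  assumes "\<omega> [^] i = \<omega> [^] j" "i < N" "j < N"
  shows "i = j"
proof -
  have *: "i = j" if eq: "\<omega> [^] i = \<omega> [^] j" and "i \<le> j" "j < N" for i j
  proof (rule ccontr)
    assume "i \<noteq> j"
    with that have d: "0 < j - i" "j - i < N" by auto
    have "\<omega> [^] i \<otimes> \<omega> [^] (j - i) = \<omega> [^] i \<otimes> \<one>"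
      using nat_pow_mult[of \<omega> i "j - i"] that \<omega>_K eq by simp
    then have "\<omega> [^] (j - i) = \<one>"
      using Units_l_cancel[OF Units_pow[OF K_Units[OF \<omega>_K \<omega>_neq_zero]], of "\<omega> [^] (j - i)" \<one> i] \<omega>_K
      by (simp add: K_carrier)
    with \<omega>_primitive[OF d] show False ..
  qed
  show ?thesis using *[of i j] *[of j i] assms by (cases "i \<le> j") auto
qed

lemma z_y_pow: "z \<otimes> y [^] j = \<omega> [^] j \<otimes> (y [^] j \<otimes> z)" for j :: nat
proof (induction j)
  case 0
  then show ?case using z_closed by simp
next
  case (Suc j)
  have "z \<otimes> y [^] Suc j = (z \<otimes> y [^] j) \<otimes> y"
    using z_closed y_closed by (simp add: m_assoc)
  also have "\<dots> = \<omega> [^] j \<otimes> (y [^] j \<otimes> (z \<otimes> y))"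
    using z_closed y_closed \<omega>_K by (simp only: Suc) (simp add: m_assoc)
  also have "y [^] j \<otimes> (z \<otimes> y) = \<omega> \<otimes> (y [^] j \<otimes> (y \<otimes> z))"
    unfolding zy by (rule K_lcomm) (use z_closed y_closed \<omega>_K in auto)
  also have "\<omega> [^] j \<otimes> (\<omega> \<otimes> (y [^] j \<otimes> (y \<otimes> z))) = \<omega> [^] Suc j \<otimes> (y [^] Suc j \<otimes> z)"
    using z_closed y_closed \<omega>_K by (simp add: m_assoc)
  finally show ?case .
qed

lemma z_pow_y_pow: "z [^] i \<otimes> y [^] j = \<omega> [^] (i * j) \<otimes> (y [^] j \<otimes> z [^] i)" for i j :: nat
proof (induction i)
  case 0
  then show ?case using y_closed by simp
next
  case (Suc i)
  have "z [^] Suc i \<otimes> y [^] j = z [^] i \<otimes> (z \<otimes> y [^] j)"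
    using z_closed y_closed by (simp add: m_assoc)
  also have "\<dots> = \<omega> [^] j \<otimes> (z [^] i \<otimes> (y [^] j \<otimes> z))"
    unfolding z_y_pow by (rule K_lcomm) (use z_closed y_closed \<omega>_K in auto)
  also have "z [^] i \<otimes> (y [^] j \<otimes> z) = (z [^] i \<otimes> y [^] j) \<otimes> z"
    using z_closed y_closed by (simp add: m_assoc)
  also have "\<dots> = \<omega> [^] (i * j) \<otimes> (y [^] j \<otimes> z [^] Suc i)"
    using z_closed y_closed \<omega>_K by (simp only: Suc) (simp add: m_assoc)
  also have "\<omega> [^] j \<otimes> (\<omega> [^] (i * j) \<otimes> (y [^] j \<otimes> z [^] Suc i)) =
      \<omega> [^] (Suc i * j) \<otimes> (y [^] j \<otimes> z [^] Suc i)"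
    using z_closed y_closed \<omega>_K by (subst m_assoc[symmetric]) (auto simp: nat_pow_mult)
  finally show ?case .
qed

definition mono :: "nat \<times> nat \<Rightarrow> 'a" where "mono r = y [^] fst r \<otimes> z [^] snd r"

lemma mono_closed [simp]: "mono r \<in> carrier R"
  using y_closed z_closed by (simp add: mono_def)

lemma mono_Unit: "mono r \<in> Units R"
  using Units_pow[OF y_Unit] Units_pow[OF z_Unit] by (simp add: mono_def)

lemma mono_mult:
  "mono (i, j) \<otimes> mono (k, l) = \<omega> [^] (j * k) \<otimes> mono (i + k, j + l)"
proof -
  have "mono (i, j) \<otimes> mono (k, l) = y [^] i \<otimes> (z [^] j \<otimes> y [^] k) \<otimes> z [^] l"
    using y_closed z_closed by (simp add: mono_def m_assoc)
  also have "y [^] i \<otimes> (z [^] j \<otimes> y [^] k) = \<omega> [^] (j * k) \<otimes> (y [^] i \<otimes> (y [^] k \<otimes> z [^] j))"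
    unfolding z_pow_y_pow by (rule K_lcomm) (use z_closed y_closed \<omega>_K in auto)
  also have "\<dots> \<otimes> z [^] l = \<omega> [^] (j * k) \<otimes> ((y [^] i \<otimes> y [^] k) \<otimes> (z [^] j \<otimes> z [^] l))"
    using y_closed z_closed \<omega>_K by (simp add: m_assoc)
  finally show ?thesis using y_closed z_closed by (simp add: mono_def nat_pow_mult)
qed

lemma conj_z_y_pow: "conj_by z (y [^] i) = \<omega> [^] i \<otimes> y [^] i" for i :: nat
  by (rule conj_by_eigen) (use z_Unit y_closed \<omega>_K z_y_pow in auto)

lemma conj_z_mono: "conj_by z (mono r) = \<omega> [^] fst r \<otimes> mono r"
proof -
  have "conj_by z (mono r) = conj_by z (y [^] fst r) \<otimes> conj_by z (z [^] snd r)"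
    unfolding mono_def by (rule conj_by_mult) (use z_Unit y_closed z_closed in auto)
  also have "conj_by z (z [^] snd r) = z [^] snd r"
    by (rule conj_by_commute) (use z_Unit z_closed nat_pow_Suc2[of z "snd r"] in auto)
  finally show ?thesis
    using y_closed z_closed \<omega>_K by (simp add: conj_z_y_pow mono_def m_assoc)
qed

text \<open>With the inverse of \<open>y\<close> the eigenvalue is a natural power of
  \<open>\<omega>\<close>; conjugation by \<open>y\<close> itself would bring in negative
  exponents.\<close>

lemma conj_inv_y_mono: "conj_by (inv y) (mono r) = \<omega> [^] snd r \<otimes> mono r"
proof (rule conj_by_eigen)
  have "mono r = inv y \<otimes> (y \<otimes> mono r)"
    using y_Unit y_closed by (simp add: m_assoc[symmetric])
  have "mono r \<otimes> y = \<omega> [^] snd r \<otimes> mono (Suc (fst r), snd r)"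
    using mono_mult[of "fst r" "snd r" 1 0] y_closed by (simp add: mono_def)
  also have "mono (Suc (fst r), snd r) = y \<otimes> mono r"
    using nat_pow_Suc2[OF y_closed, of "fst r"] y_closed z_closed by (simp add: mono_def m_assoc)
  finally have *: "mono r \<otimes> y = \<omega> [^] snd r \<otimes> (y \<otimes> mono r)" .
  have "inv y \<otimes> mono r = inv y \<otimes> (mono r \<otimes> y) \<otimes> inv y"
    using y_Unit y_closed by (simp add: m_assoc)
  also have "inv y \<otimes> (mono r \<otimes> y) = \<omega> [^] snd r \<otimes> (inv y \<otimes> (y \<otimes> mono r))"
    unfolding * by (rule K_lcomm) (use y_Unit y_closed \<omega>_K in auto)
  also have "inv y \<otimes> (y \<otimes> mono r) = mono r"
    using y_Unit y_closed by (simp add: m_assoc[symmetric])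
  finally show "inv y \<otimes> mono r = \<omega> [^] snd r \<otimes> (mono r \<otimes> inv y)"
    using y_Unit \<omega>_K by (simp add: m_assoc)
qed (use y_Unit \<omega>_K in auto)

section \<open>Monomials as joint eigenvectors, and the subrings they span\<close>

abbreviation (input) D :: "bool \<Rightarrow> 'a \<Rightarrow> 'a" where
  "D b \<equiv> conj_by (if b then z else inv y)"

abbreviation (input) \<chi> :: "bool \<Rightarrow> nat \<times> nat \<Rightarrow> 'a" where
  "\<chi> b r \<equiv> \<omega> [^] (if b then fst r else snd r)"

abbreviation indices :: "(nat \<times> nat) set" where "indices \<equiv> {..<N} \<times> {..<N}"

lemma D_lin: "lin_map (D b)"
  by (rule lin_map_conj) (use z_Unit y_Unit in auto)

lemma D_mono: "D b (mono r) = \<chi> b r \<otimes> mono r"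
  by (simp add: conj_z_mono conj_inv_y_mono)

lemma separated:
  "r \<in> indices \<Longrightarrow> r' \<in> indices \<Longrightarrow> r \<noteq> r' \<Longrightarrow> \<exists>b\<in>UNIV. \<chi> b r \<noteq> \<chi> b r'"
  using \<omega>_pow_inj by (metis UNIV_I lessThan_iff mem_Times_iff prod_eq_iff)

lemma mono_separation:
  assumes W: "subspace W" and stable: "\<And>b u. u \<in> W \<Longrightarrow> D b u \<in> W"
    and c: "c \<in> indices \<rightarrow> K" and sum: "(\<Oplus>r\<in>indices. c r \<otimes> mono r) \<in> W"
  shows "\<forall>r\<in>indices. c r \<otimes> mono r \<in> W"
proof (rule eigenvector_separation[OF W D_lin stable _ _ _ _ separated sum])
  fix b r assume "r \<in> indices"
  then have cr: "c r \<in> K" using c by auto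
  show "D b (c r \<otimes> mono r) = \<chi> b r \<otimes> (c r \<otimes> mono r)"
    using conj_by_smult[OF _ cr mono_closed, of "if b then z else inv y"] D_mono[of b r]
      z_Unit y_Unit cr \<omega>_K by (simp add: K_lcomm)
qed (use c \<omega>_K in \<open>auto simp: Pi_iff\<close>)

lemma mono_lin_indep: "lin_indep indices mono"
  by (rule eigenvectors_lin_indep[OF D_lin _ _ _ D_mono _ separated])
    (use \<omega>_K Units_neq_zero[OF mono_Unit] in auto)

lemma pow_lin_indep: "lin_indep {..<N} (\<lambda>i. y [^] i)"
\<comment> \<open>Conjugation by \<open>z\<close> alone separates the powers of \<open>y\<close>, so
  the operators are indexed by a one-point type.\<close>
proof (rule eigenvectors_lin_indep[where D = "\<lambda>_::unit. conj_by z" and \<Theta> = UNIV])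
  show "conj_by z (y [^] i) = (\<lambda>_ i. \<omega> [^] i) (u :: unit) i \<otimes> y [^] i" for u and i :: nat
    by (simp add: conj_z_y_pow)
  show "\<And>i j. i \<in> {..<N} \<Longrightarrow> j \<in> {..<N} \<Longrightarrow> i \<noteq> j \<Longrightarrow> \<exists>u\<in>UNIV. \<omega> [^] i \<noteq> \<omega> [^] j"
    using \<omega>_pow_inj by auto
qed (use \<omega>_K y_closed z_Unit lin_map_conj Units_neq_zero[OF Units_pow[OF y_Unit]] in auto)

lemma pow_reduce: "u \<in> carrier R \<Longrightarrow> u [^] i = (u [^] N) [^] (i div N) \<otimes> u [^] (i mod N)" for i :: nat
  by (simp add: nat_pow_pow nat_pow_mult)

text \<open>Both are introduced as spans, which gives dimension and separation at once;
  \<open>generate_B\<close> and \<open>generate_L\<close> identify them with the generated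
  subrings.\<close>

definition B where "B = lincombs indices mono"
definition L where "L = lincombs {..<N} (\<lambda>i. y [^] i)"

lemma B_subspace: "subspace B"
  unfolding B_def by (rule lincombs_subspace) auto

lemma L_subspace: "subspace L"
  unfolding L_def by (rule lincombs_subspace) (use y_closed in auto)

lemma pow_in_L: "y [^] i \<in> L" for i :: nat
proof -
  have "y [^] (i mod N) \<in> L"
    unfolding L_def by (rule lincombs_incl[of "{..<N}" "\<lambda>i. y [^] i"]) (use y_closed N_pos in auto)
  then show ?thesis
    using subspaceD(4)[OF L_subspace] y_pow_N pow_reduce[OF y_closed, of i] by simp
qed

text \<open>Exponents are reduced modulo \<open>N\<close>; the surplus factors are powers of the
  scalars \<open>y [^] N\<close> and \<open>z [^] N\<close>.\<close>

lemma mono_in_B: "mono r \<in> B"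
proof -
  have "mono (fst r mod N, snd r mod N) \<in> B"
    unfolding B_def by (rule lincombs_incl[of indices]) (use N_pos in auto)
  then have *: "(y [^] N) [^] (fst r div N) \<otimes> ((z [^] N) [^] (snd r div N) \<otimes> mono (fst r mod N, snd r mod N)) \<in> B"
    using subspaceD(4)[OF B_subspace] y_pow_N(1) z_pow_N(1) by simp
  have "mono r = (y [^] N) [^] (fst r div N) \<otimes> (y [^] (fst r mod N)
      \<otimes> ((z [^] N) [^] (snd r div N) \<otimes> z [^] (snd r mod N)))"
    unfolding mono_def pow_reduce[OF y_closed, of "fst r"] pow_reduce[OF z_closed, of "snd r"]
    using y_closed z_closed by (simp add: m_assoc)
  also have "y [^] (fst r mod N) \<otimes> ((z [^] N) [^] (snd r div N) \<otimes> z [^] (snd r mod N)) =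
      (z [^] N) [^] (snd r div N) \<otimes> mono (fst r mod N, snd r mod N)"
    unfolding mono_def fst_conv snd_conv by (rule K_lcomm) (use y_closed z_closed z_pow_N in auto)
  finally show ?thesis using * by simp
qed

lemma subring_L: "subring L R"
proof (rule subringI)
  show "L \<subseteq> carrier R" using subspaceD(1)[OF L_subspace] by auto
  show "\<one> \<in> L" using pow_in_L[of 0] by simp
  show "\<And>u. u \<in> L \<Longrightarrow> \<ominus> u \<in> L" "\<And>u v. u \<in> L \<Longrightarrow> v \<in> L \<Longrightarrow> u \<oplus> v \<in> L"
    using subspaceD[OF L_subspace] by auto
  show "u \<otimes> v \<in> L" if "u \<in> L" "v \<in> L" for u v
    by (rule lincombs_mult_closed[OF _ _ _ _ L_subspace _ that[unfolded L_def]])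
      (use y_closed pow_in_L in \<open>auto simp: nat_pow_mult\<close>)
qed

lemma subring_B: "subring B R"
proof (rule subringI)
  show "B \<subseteq> carrier R" using subspaceD(1)[OF B_subspace] by auto
  show "\<one> \<in> B" using mono_in_B[of "(0, 0)"] by (simp add: mono_def)
  show "\<And>u. u \<in> B \<Longrightarrow> \<ominus> u \<in> B" "\<And>u v. u \<in> B \<Longrightarrow> v \<in> B \<Longrightarrow> u \<oplus> v \<in> B"
    using subspaceD[OF B_subspace] by auto
  show "u \<otimes> v \<in> B" if "u \<in> B" "v \<in> B" for u v
  proof (rule lincombs_mult_closed[OF _ _ _ _ B_subspace _ that[unfolded B_def]])
    show "mono r \<otimes> mono r' \<in> B" for r r'
      using mono_mult[of "fst r" "snd r" "fst r'" "snd r'"] subspaceD(4)[OF B_subspace _ mono_in_B] \<omega>_K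
      by simp
  qed auto
qed

lemma subspace_subring: "subring V R \<Longrightarrow> K \<subseteq> V \<Longrightarrow> subspace V"
  unfolding subspace_def using subringE(1,2,6,7)[of V R] by (auto dest: subsetD)

lemma K_subset: "subspace V \<Longrightarrow> \<one> \<in> V \<Longrightarrow> K \<subseteq> V"
proof
  fix k assume "subspace V" "\<one> \<in> V" "k \<in> K"
  then have "k \<otimes> \<one> \<in> V" using subspaceD(4)[of V k \<one>] by simp
  then show "k \<in> V" using \<open>k \<in> K\<close> by simp
qed

lemma K_L: "K \<subseteq> L"
  using K_subset[OF L_subspace] subringE(3)[OF subring_L] by simp

lemma K_B: "K \<subseteq> B"
  using K_subset[OF B_subspace] subringE(3)[OF subring_B] by simp

lemma pow_in_subring: "subring V R \<Longrightarrow> u \<in> V \<Longrightarrow> u [^] (i::nat) \<in> V"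
proof (induction i)
  case 0
  then show ?case using subringE(3) by simp
next
  case (Suc i)
  then show ?case using subringE(6)[of V R "u [^] i" u] by simp
qed

lemma generate_L: "generate_ring R (K \<union> {y}) = L"
proof (rule subset_antisym)
  have KR: "K \<union> {y} \<subseteq> carrier R" using y_closed by auto
  have "y \<in> L" using pow_in_L[of 1] y_closed by simp
  then show "generate_ring R (K \<union> {y}) \<subseteq> L"
    by (intro generate_ring_min_subring1[OF KR subring_L]) (use K_L in auto)
  note g = generate_ringE[OF KR refl]
  show "L \<subseteq> generate_ring R (K \<union> {y})"
    unfolding L_def
    by (rule lincombs_min) (use subspace_subring[OF g(1)] g(2) pow_in_subring[OF g(1)] in auto)
qed

lemma generate_B: "generate_ring R (K \<union> {y, z}) = B"
proof (rule subset_antisym)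
  have KR: "K \<union> {y, z} \<subseteq> carrier R" using y_closed z_closed by auto
  have "y \<in> B" "z \<in> B"
    using mono_in_B[of "(1, 0)"] mono_in_B[of "(0, 1)"] y_closed z_closed by (auto simp: mono_def)
  then show "generate_ring R (K \<union> {y, z}) \<subseteq> B"
    by (intro generate_ring_min_subring1[OF KR subring_B]) (use K_B in auto)
  note g = generate_ringE[OF KR refl]
  show "B \<subseteq> generate_ring R (K \<union> {y, z})"
    unfolding B_def
  proof (rule lincombs_min)
    show "mono r \<in> generate_ring R (K \<union> {y, z})" for r
      unfolding mono_def using g(2) by (intro subringE(6)[OF g(1)] pow_in_subring[OF g(1)]) auto
  qed (use subspace_subring[OF g(1)] g(2) in auto)
qed

lemma y_in_B: "y \<in> B" and z_in_B: "z \<in> B" and y_in_L: "y \<in> L"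
  using mono_in_B[of "(1, 0)"] mono_in_B[of "(0, 1)"] pow_in_L[of 1] y_closed z_closed
  by (auto simp: mono_def)

lemma inv_in_B: "inv y \<in> B" "inv z \<in> B"
  using inv_in_generated[OF subring_B K_B y_in_B y_pow_N N_pos]
    inv_in_generated[OF subring_B K_B z_in_B z_pow_N N_pos] .


lemma inv_mono_in_B: "inv (mono r) \<in> B"
proof -
  have "inv (mono r) = inv z [^] snd r \<otimes> inv y [^] fst r"
  proof (rule inv_unique'[symmetric])
    have inv: "u [^] i \<otimes> inv u [^] i = \<one>" "inv u [^] i \<otimes> u [^] i = \<one>" if u: "u \<in> Units R" for u and i :: nat
    proof -
      show "u [^] i \<otimes> inv u [^] i = \<one>"
      proof (induction i)
        case (Suc i)
        have "u [^] Suc i \<otimes> inv u [^] Suc i = u [^] i \<otimes> (u \<otimes> inv u) \<otimes> inv u [^] i"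
          using u nat_pow_Suc2[of "inv u" i] by (simp add: m_assoc Units_closed del: Units_r_inv)
        then show ?case using u Suc by (simp add: Units_closed)
      qed simp
      show "inv u [^] i \<otimes> u [^] i = \<one>"
      proof (induction i)
        case (Suc i)
        have "inv u [^] Suc i \<otimes> u [^] Suc i = inv u [^] i \<otimes> (inv u \<otimes> u) \<otimes> u [^] i"
          using u nat_pow_Suc2[of u i] by (simp add: m_assoc Units_closed del: Units_l_inv)
        then show ?case using u Suc by (simp add: Units_closed)
      qed simp
    qed
    have c: "inv y \<in> carrier R" "inv z \<in> carrier R" using y_Unit z_Unit by auto
    have "mono r \<otimes> (inv z [^] snd r \<otimes> inv y [^] fst r) =
        y [^] fst r \<otimes> (z [^] snd r \<otimes> inv z [^] snd r) \<otimes> inv y [^] fst r"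
      using c y_closed z_closed by (simp add: mono_def m_assoc)
    then show "mono r \<otimes> (inv z [^] snd r \<otimes> inv y [^] fst r) = \<one>"
      using inv[OF y_Unit] inv[OF z_Unit] y_closed by simp
    have "(inv z [^] snd r \<otimes> inv y [^] fst r) \<otimes> mono r =
        inv z [^] snd r \<otimes> (inv y [^] fst r \<otimes> y [^] fst r) \<otimes> z [^] snd r"
      using c y_closed z_closed by (simp add: mono_def m_assoc)
    then show "(inv z [^] snd r \<otimes> inv y [^] fst r) \<otimes> mono r = \<one>"
      using inv[OF y_Unit] inv[OF z_Unit] c by simp
  qed (use y_Unit z_Unit in auto)
  moreover have "inv z [^] snd r \<otimes> inv y [^] fst r \<in> B"
    by (intro subringE(6)[OF subring_B] pow_in_subring[OF subring_B] inv_in_B)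
  ultimately show ?thesis by simp
qed

section \<open>The span of the monomials is central simple\<close>

lemma B_carrier: "u \<in> B \<Longrightarrow> u \<in> carrier R"
  using subspaceD(1)[OF B_subspace] .

lemma simple_B: "simple_ring (R\<lparr>carrier := B\<rparr>)"
  unfolding simple_ring_def
proof (intro conjI allI impI)
  show "\<one>\<^bsub>R\<lparr>carrier := B\<rparr>\<^esub> \<noteq> \<zero>\<^bsub>R\<lparr>carrier := B\<rparr>\<^esub>" using one_neq_zero by simp
  fix I assume I: "ideal I (R\<lparr>carrier := B\<rparr>)"
  note I' = ideal.I_l_closed[OF I, simplified] ideal.I_r_closed[OF I, simplified]
  have IB: "I \<subseteq> B"
    using additive_subgroup.a_subset[OF ideal.axioms(1)[OF I]] by simp
  have sub: "subspace I"
    unfolding subspace_def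
  proof (intro conjI ballI)
    show "I \<subseteq> carrier R" using IB B_carrier by blast
    show "\<zero> \<in> I" using additive_subgroup.zero_closed[OF ideal.axioms(1)[OF I]] by simp
    show "u \<oplus> v \<in> I" if "u \<in> I" "v \<in> I" for u v
      using additive_subgroup.a_closed[OF ideal.axioms(1)[OF I] that] by simp
    show "k \<otimes> v \<in> I" if "k \<in> K" "v \<in> I" for k v
      using I'(1)[OF that(2) subsetD[OF K_B that(1)]] .
  qed
  \<comment> \<open>\<open>B\<close> contains \<open>y\<close>, \<open>z\<close> and their inverses,
    so its two-sided ideals are stable under both conjugations.\<close>
  have stable: "D b u \<in> I" if "u \<in> I" for b u
  proof -
    have "(if b then z else inv y) \<in> B" using z_in_B inv_in_B by simp
    moreover have "inv (if b then z else inv y) \<in> B" using y_in_B inv_in_B y_Unit by simp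
    ultimately show ?thesis 
      unfolding conj_by_def by (intro I'(2)[OF I'(1)[OF that]])
  qed
  show "I = {\<zero>\<^bsub>R\<lparr>carrier := B\<rparr>\<^esub>} \<or> I = carrier (R\<lparr>carrier := B\<rparr>)"
  proof (rule disjCI)
    assume "I \<noteq> carrier (R\<lparr>carrier := B\<rparr>)"
    then have one: "\<one> \<notin> I" using ideal.one_imp_carrier[OF I] by auto
    have "u = \<zero>" if uI: "u \<in> I" for u
    proof -
      obtain c where c: "c \<in> indices \<rightarrow> K" "u = (\<Oplus>r\<in>indices. c r \<otimes> mono r)"
        using subsetD[OF IB uI] unfolding B_def lincombs_def by auto
      have cI: "\<forall>r\<in>indices. c r \<otimes> mono r \<in> I"
        by (rule mono_separation[OF sub stable c(1) uI[unfolded c(2)]])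
      have "c r = \<zero>" if r: "r \<in> indices" for r
      proof (rule ccontr)
        assume c0: "c r \<noteq> \<zero>"
        have crK: "c r \<in> K" using c(1) r by auto
        have "inv (c r) \<otimes> (c r \<otimes> mono r) \<in> I"
          using subspaceD(4)[OF sub K_inv(1)[OF crK c0] bspec[OF cI r]] .
        moreover have "inv (c r) \<otimes> (c r \<otimes> mono r) = mono r"
          using m_assoc[OF K_carrier[OF K_inv(1)[OF crK c0]] K_carrier[OF crK] mono_closed[of r]]
            K_inv(4)[OF crK c0] by simp
        \<comment> \<open>The inverse of a monomial lies in \<open>B\<close>, so a single monomial
          in \<open>I\<close> brings \<open>\<one>\<close> with it.\<close>
        ultimately have "mono r \<otimes> inv (mono r) \<in> I" using I'(2)[OF _ inv_mono_in_B] by simp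
        then show False using one mono_Unit[of r] by simp
      qed
      then show "u = \<zero>" unfolding c by (intro add.finprod_one_eqI) simp
    qed
    then have "I \<subseteq> {\<zero>}" by blast
    then show "I = {\<zero>\<^bsub>R\<lparr>carrier := B\<rparr>\<^esub>}" using subspaceD(2)[OF sub] by auto
  qed
qed (rule subring_is_ring[OF subring_B])

text \<open>A central element is fixed by both conjugations. The fixed vectors form a stable
  subspace, so each monomial term of the element is fixed by itself; among exponents below
  \<open>N\<close> only \<open>(0, 0)\<close> has trivial character.\<close>

lemma center_B: "ring_center (R\<lparr>carrier := B\<rparr>) = K"
proof (rule subset_antisym; rule subsetI)
  fix u assume "u \<in> K"
  then show "u \<in> ring_center (R\<lparr>carrier := B\<rparr>)"
    using K_B central B_carrier by (auto simp: ring_center_def)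
next
  fix u assume "u \<in> ring_center (R\<lparr>carrier := B\<rparr>)"
  then have uB: "u \<in> B" and comm: "v \<in> B \<Longrightarrow> u \<otimes> v = v \<otimes> u" for v
    by (auto simp: ring_center_def)
  obtain c where c: "c \<in> indices \<rightarrow> K" "u = (\<Oplus>r\<in>indices. c r \<otimes> mono r)"
    using uB unfolding B_def lincombs_def by auto
  have cK: "c r \<in> K" if "r \<in> indices" for r using c(1) that by auto
  have fixed: "D b u = u" for b
    by (rule conj_by_commute)
      (use z_Unit y_Unit B_carrier uB comm z_in_B inv_in_B in auto)
  let ?C = "{v \<in> carrier R. \<forall>b. D b v = v}"
  have sub: "subspace ?C"
    unfolding subspace_def
  proof (intro conjI ballI CollectI allI)
    have gU: "(if b then z else inv y) \<in> Units R" for b using z_Unit y_Unit by simp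
    show "?C \<subseteq> carrier R" "\<zero> \<in> carrier R" by auto
    show "D b \<zero> = \<zero>" for b unfolding conj_by_def using gU[of b] by (simp add: Units_closed)
    fix u v assume uv: "u \<in> ?C" "v \<in> ?C"
    then show "u \<oplus> v \<in> carrier R" by auto
    show "D b (u \<oplus> v) = u \<oplus> v" for b
      using conj_by_add[OF gU, of u v b] uv by simp
  next
    have gU: "(if b then z else inv y) \<in> Units R" for b using z_Unit y_Unit by simp
    fix k v assume kv: "k \<in> K" "v \<in> ?C"
    then show "k \<otimes> v \<in> carrier R" by auto
    show "D b (k \<otimes> v) = k \<otimes> v" for b
      using conj_by_smult[OF gU, of k v b] kv by simp
  qed
  have "\<forall>r\<in>indices. c r \<otimes> mono r \<in> ?C"
    proof (rule mono_separation[OF sub _ c(1)])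
      have "u \<in> ?C" using fixed B_carrier[OF uB] by simp
      then show "(\<Oplus>r\<in>indices. c r \<otimes> mono r) \<in> ?C" unfolding c(2) .
      fix b v assume "v \<in> ?C"
      then show "D b v \<in> ?C" by simp
    qed
  then have Dc: "D b (c r \<otimes> mono r) = c r \<otimes> mono r" if "r \<in> indices" for b r
    using that by blast
  have c0: "c r = \<zero>" if r: "r \<in> indices" "r \<noteq> (0, 0)" for r
  proof (rule ccontr)
    assume "c r \<noteq> \<zero>"
    then have neq: "c r \<otimes> mono r \<noteq> \<zero>"
      using K_cancel[OF cK[OF r(1)] mono_closed] Units_neq_zero[OF mono_Unit] by blast
    obtain b where "\<chi> b r \<noteq> \<chi> b (0, 0)"
      using separated[OF r(1), of "(0, 0)"] r(2) N_pos by auto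
    then have b: "\<chi> b r \<noteq> \<one>" by (simp split: if_splits)
    have \<chi>K: "\<chi> b r \<in> K" using \<omega>_K by simp
    have "\<chi> b r \<otimes> (c r \<otimes> mono r) = c r \<otimes> mono r"
      using Dc[OF r(1), of b] conj_by_smult[OF _ cK[OF r(1)] mono_closed, of "if b then z else inv y" r]
        D_mono[of b r] K_lcomm[OF cK[OF r(1)] K_carrier[OF \<chi>K] mono_closed[of r]] z_Unit y_Unit
      by simp
    then have "(\<chi> b r \<ominus> \<one>) \<otimes> (c r \<otimes> mono r) = \<zero>"
      using K_carrier[OF \<chi>K] cK[OF r(1)] by (simp add: minus_eq l_distr l_minus r_neg)
    then have "\<chi> b r \<ominus> \<one> = \<zero>"
      using K_cancel[of "\<chi> b r \<ominus> \<one>" "c r \<otimes> mono r"] \<chi>K cK[OF r(1)] neq by simp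
    then show False using b K_carrier[OF \<chi>K] by simp
  qed
  have "u = c (0, 0) \<otimes> mono (0, 0)"
    unfolding c(2) by (rule finsum_single) (use N_pos c0 cK in auto)
  then show "u \<in> K" using cK[of "(0, 0)"] N_pos by (simp add: mono_def)
qed

lemma has_Deg_B: "has_Deg K (R\<lparr>carrier := B\<rparr>) N"
  unfolding has_Deg_def central_simple_def
proof (intro conjI exI simple_B center_B subfield_of_subring[OF subring_B K_B])
  have "dimension (card indices) K B"
    unfolding B_def by (rule dimension_lincombs) (use mono_lin_indep in auto)
  then show "ring.dimension (R\<lparr>carrier := B\<rparr>) (N\<^sup>2) K (carrier (R\<lparr>carrier := B\<rparr>))"
    using dimension_subring[OF subring_B _ _ K_B] by (simp add: power2_eq_square)
  then show "ring.dimension (R\<lparr>carrier := B\<rparr>) (N\<^sup>2) K (carrier (R\<lparr>carrier := B\<rparr>))" .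
qed

end


section \<open>The subalgebra generated by a radical\<close>

text \<open>Zorn's lemma for the ideals that avoid \<open>\<one>\<close>, a condition inherited by
  unions of chains.\<close>

lemma (in ring) exists_maximalideal:
  assumes "\<one> \<noteq> \<zero>"
  obtains I where "maximalideal I R"
proof -
  define P where "P = {I. ideal I R \<and> \<one> \<notin> I}"
  have "\<exists>M\<in>P. \<forall>J\<in>P. M \<subseteq> J \<longrightarrow> J = M"
  proof (rule subset_Zorn_nonempty)
    show "P \<noteq> {}" unfolding P_def using zeroideal assms by blast
    fix C assume C: "C \<noteq> {}" "subset.chain P C"
    then have "subset.chain {I. ideal I R} C" by (auto simp: subset_chain_def P_def)
    then have "ideal (\<Union>C) R" using chain_Union_is_ideal[of C] C(1) by simp
    moreover have "\<one> \<notin> \<Union>C" using C(2) by (auto simp: subset_chain_def P_def)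
    ultimately show "\<Union>C \<in> P" by (simp add: P_def)
  qed
  then obtain M where M: "ideal M R" "\<one> \<notin> M" "\<And>J. ideal J R \<Longrightarrow> \<one> \<notin> J \<Longrightarrow> M \<subseteq> J \<Longrightarrow> J = M"
    unfolding P_def by auto
  have "maximalideal M R"
  proof (rule maximalidealI[OF M(1)])
    show "carrier R \<noteq> M" using M(2) by auto
    fix J assume "ideal J R" "M \<subseteq> J"
    then show "J = M \<or> J = carrier R"
      using M(3)[of J] ideal.one_imp_carrier[of J R] by blast
  qed
  then show thesis by (rule that)
qed

text \<open>The induction compares partial sums with the end terms kept, \<open>F 0\<close> on one
  side and \<open>F k\<close> on the other; periodicity then permits cancellation. It serves orbit
  sums of an automorphism and the geometric sum of an element with
  \<open>v [^] p = \<one>\<close>.\<close>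

lemma (in abelian_group) finsum_cyclic_shift:
  fixes t :: nat
  assumes F: "\<And>j. F j \<in> carrier G" and "F t = F 0"
  shows "(\<Oplus>j\<in>{..<t}. F (Suc j)) = (\<Oplus>j\<in>{..<t}. F j)"
proof -
  have "F 0 \<oplus> (\<Oplus>j\<in>{..<k}. F (Suc j)) = F k \<oplus> (\<Oplus>j\<in>{..<k}. F j)" for k :: nat
  proof (induction k)
    case (Suc k)
    have s: "(\<Oplus>j\<in>{..<Suc k}. f j) = f k \<oplus> (\<Oplus>j\<in>{..<k}. f j)" if "\<And>j. f j \<in> carrier G" for f
      using that by (simp add: lessThan_Suc)
    have c: "(\<Oplus>j\<in>{..<k}. F (Suc j)) \<in> carrier G" "(\<Oplus>j\<in>{..<k}. F j) \<in> carrier G"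
      using F by (auto intro!: finsum_closed)
    have "F 0 \<oplus> (\<Oplus>j\<in>{..<Suc k}. F (Suc j)) = F 0 \<oplus> (F (Suc k) \<oplus> (\<Oplus>j\<in>{..<k}. F (Suc j)))"
      by (subst s) (use F in auto)
    also have "\<dots> = F (Suc k) \<oplus> (F 0 \<oplus> (\<Oplus>j\<in>{..<k}. F (Suc j)))"
      using F c by (simp add: a_lcomm)
    also have "\<dots> = F (Suc k) \<oplus> (\<Oplus>j\<in>{..<Suc k}. F j)"
      unfolding Suc by (subst s) (use F in auto)
    finally show ?case .
  qed (use F in simp)
  from this[of t] have "F 0 \<oplus> (\<Oplus>j\<in>{..<t}. F (Suc j)) = F 0 \<oplus> (\<Oplus>j\<in>{..<t}. F j)"
    using assms(2) by simp
  then show ?thesis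
    using F by (subst (asm) add.l_cancel) (auto intro!: finsum_closed)
qed

section \<open>Commutation of generated subalgebras and composition of conjugations\<close>

context central_subfield
begin

lemma centralizer_subring:
  assumes "g \<in> carrier R"
  shows "subring {v \<in> carrier R. g \<otimes> v = v \<otimes> g} R"
proof (rule subringI)
  fix u v assume "u \<in> {v \<in> carrier R. g \<otimes> v = v \<otimes> g}" "v \<in> {v \<in> carrier R. g \<otimes> v = v \<otimes> g}"
  then have uv: "u \<in> carrier R" "g \<otimes> u = u \<otimes> g" "v \<in> carrier R" "g \<otimes> v = v \<otimes> g" by auto
  have "g \<otimes> (u \<otimes> v) = (g \<otimes> u) \<otimes> v" by (rule m_assoc[symmetric]) (use uv assms in auto)
  also have "\<dots> = u \<otimes> (g \<otimes> v)" unfolding uv(2) by (rule m_assoc) (use uv assms in auto)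
  also have "\<dots> = u \<otimes> v \<otimes> g" unfolding uv(4) by (rule m_assoc[symmetric]) (use uv assms in auto)
  finally show "u \<otimes> v \<in> {v \<in> carrier R. g \<otimes> v = v \<otimes> g}" using uv by simp
  show "u \<oplus> v \<in> {v \<in> carrier R. g \<otimes> v = v \<otimes> g}" using uv assms by (simp add: l_distr r_distr)
qed (use assms in \<open>auto simp: l_minus r_minus\<close>)

text \<open>Centralizers are subrings, so commutation passes from generators to generated elements
  on one side at a time: first to \<open>v\<close> against a fixed generator, then to
  \<open>u\<close> against the fixed \<open>v\<close>.\<close>

lemma generated_commute:
  assumes S: "S \<subseteq> carrier R" and T: "T \<subseteq> carrier R"
    and comm: "\<And>u v. u \<in> S \<Longrightarrow> v \<in> T \<Longrightarrow> u \<otimes> v = v \<otimes> u"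
    and u: "u \<in> generate_ring R (K \<union> S)" and v: "v \<in> generate_ring R (K \<union> T)"
  shows "u \<otimes> v = v \<otimes> u"
proof -
  have KS: "K \<union> S \<subseteq> carrier R" "K \<union> T \<subseteq> carrier R" using S T by auto
  have vR: "v \<in> carrier R" using generate_ring_in_carrier[OF KS(2) v] .
  have "u' \<otimes> v = v \<otimes> u'" if u': "u' \<in> K \<union> S" for u'
  proof -
    have u'R: "u' \<in> carrier R" using u' KS by auto
    have "K \<union> T \<subseteq> {v \<in> carrier R. u' \<otimes> v = v \<otimes> u'}"
    proof
      fix w assume w: "w \<in> K \<union> T"
      then have wR: "w \<in> carrier R" using KS by auto
      have "u' \<otimes> w = w \<otimes> u'"
        using w u' central[of u' w] central[of w u'] comm[of u' w] wR u'R by auto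
      then show "w \<in> {v \<in> carrier R. u' \<otimes> v = v \<otimes> u'}" using wR by simp
    qed
    then show ?thesis
      using generate_ring_min_subring1[OF KS(2) centralizer_subring[OF u'R]] v by auto
  qed
  then have "K \<union> S \<subseteq> {w \<in> carrier R. v \<otimes> w = w \<otimes> v}"
    using KS(1) by auto
  then have "u \<in> {w \<in> carrier R. v \<otimes> w = w \<otimes> v}"
    using generate_ring_min_subring1[OF KS(1) centralizer_subring[OF vR]] u by auto
  then show ?thesis by simp
qed

lemma conj_by_conj_by:
  assumes g: "g \<in> Units R" and g': "g' \<in> Units R" and u: "u \<in> carrier R"
  shows "conj_by g (conj_by g' u) = conj_by (g \<otimes> g') u"
proof -
  have c: "g \<in> carrier R" "g' \<in> carrier R" "inv g \<in> carrier R" "inv g' \<in> carrier R"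
    using g g' by auto
  have "inv (g \<otimes> g') = inv g' \<otimes> inv g"
  proof (rule inv_unique'[symmetric])
    have "g \<otimes> g' \<otimes> (inv g' \<otimes> inv g) = g \<otimes> (g' \<otimes> inv g') \<otimes> inv g"
      using c by (simp add: m_assoc del: Units_r_inv)
    then show "g \<otimes> g' \<otimes> (inv g' \<otimes> inv g) = \<one>" using g g' c by simp
    have "inv g' \<otimes> inv g \<otimes> (g \<otimes> g') = inv g' \<otimes> (inv g \<otimes> g) \<otimes> g'"
      using c by (simp add: m_assoc del: Units_l_inv)
    then show "inv g' \<otimes> inv g \<otimes> (g \<otimes> g') = \<one>" using g g' c by simp
  qed (use c in auto)
  then show ?thesis unfolding conj_by_def using c u by (simp add: m_assoc)
qed

end

section \<open>The automorphisms of \<open>K[y]\<close> induced by \<open>z\<close>\<close>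

context quantum_pair
begin

lemma L_carrier: "u \<in> L \<Longrightarrow> u \<in> carrier R"
  using subspaceD(1)[OF L_subspace] .

lemma L_comm: "u \<in> L \<Longrightarrow> v \<in> L \<Longrightarrow> u \<otimes> v = v \<otimes> u"
  by (rule generated_commute[of "{y}" "{y}"]) (use y_closed generate_L in auto)

lemma cring_L: "cring (R\<lparr>carrier := L\<rparr>)"
proof -
  interpret L: ring "R\<lparr>carrier := L\<rparr>" by (rule subring_is_ring[OF subring_L])
  show ?thesis by unfold_locales (use L_comm in simp)
qed

text \<open>Natural exponents are enough to obtain a group on \<open>L\<close>: there
  \<open>T N\<close> is the identity, so \<open>T ((N - 1) * j)\<close> inverts
  \<open>T j\<close>.\<close>

definition T :: "nat \<Rightarrow> 'a \<Rightarrow> 'a" where "T j = conj_by (z [^] j)"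

lemma z_pow_Unit: "z [^] (j::nat) \<in> Units R"
  by (rule Units_pow[OF z_Unit])

lemma T_lin:
  "u \<in> carrier R \<Longrightarrow> T j u \<in> carrier R"
  "u \<in> carrier R \<Longrightarrow> v \<in> carrier R \<Longrightarrow> T j (u \<oplus> v) = T j u \<oplus> T j v"
  "k \<in> K \<Longrightarrow> u \<in> carrier R \<Longrightarrow> T j (k \<otimes> u) = k \<otimes> T j u"
  "u \<in> carrier R \<Longrightarrow> v \<in> carrier R \<Longrightarrow> T j (u \<otimes> v) = T j u \<otimes> T j v"
  unfolding T_def using conj_by_add[OF z_pow_Unit] conj_by_closed[OF z_pow_Unit]
    conj_by_smult[OF z_pow_Unit] conj_by_mult[OF z_pow_Unit] by auto

lemma T_minus:
  assumes "u \<in> carrier R" "v \<in> carrier R"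
  shows "T j (u \<ominus> v) = T j u \<ominus> T j v"
proof -
  have "\<ominus> v = \<ominus> \<one> \<otimes> v" using assms by (simp add: l_minus)
  then have "T j (\<ominus> v) = \<ominus> \<one> \<otimes> T j v" using T_lin(3)[of "\<ominus> \<one>" v j] assms by simp
  also have "\<dots> = \<ominus> T j v" using T_lin(1)[OF assms(2)] by (simp add: l_minus)
  finally show ?thesis unfolding minus_eq using T_lin(2)[OF assms(1)] assms(2) by simp
qed

lemma T_one [simp]: "T j \<one> = \<one>"
  unfolding T_def conj_by_def using z_pow_Unit[of j] by (simp add: Units_closed)

lemma T_K: "k \<in> K \<Longrightarrow> T j k = k"
  using T_lin(3)[of k \<one> j] by simp

lemma T_T: "u \<in> carrier R \<Longrightarrow> T i (T j u) = T (i + j) u"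
  unfolding T_def using conj_by_conj_by[OF z_pow_Unit z_pow_Unit, of u i j] z_closed
  by (simp add: nat_pow_mult)

lemma T_pow: "T j (y [^] i) = \<omega> [^] (j * i) \<otimes> y [^] i" for i :: nat
  unfolding T_def by (rule conj_by_eigen) (use z_pow_Unit y_closed \<omega>_K z_pow_y_pow in auto)

lemma subspace_preimage:
  assumes "subspace W"
  shows "subspace {u \<in> carrier R. T j u \<in> W}"
  unfolding subspace_def
proof (intro conjI ballI CollectI)
  show "T j \<zero> \<in> W" using T_K[of \<zero> j] subspaceD(2)[OF assms] by simp
  fix u v assume "u \<in> {u \<in> carrier R. T j u \<in> W}" "v \<in> {u \<in> carrier R. T j u \<in> W}"
  then show "u \<oplus> v \<in> carrier R" "T j (u \<oplus> v) \<in> W"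
    using subspaceD(3)[OF assms, of "T j u" "T j v"] by (auto simp: T_lin)
next
  fix k v assume "k \<in> K" "v \<in> {u \<in> carrier R. T j u \<in> W}"
  then show "k \<otimes> v \<in> carrier R" "T j (k \<otimes> v) \<in> W"
    using subspaceD(4)[OF assms, of k "T j v"] by (auto simp: T_lin)
qed auto

lemma T_L:
  assumes "u \<in> L"
  shows "T j u \<in> L"
proof -
  have "lincombs {..<N} (\<lambda>i. y [^] i) \<subseteq> {u \<in> carrier R. T j u \<in> L}"
  proof (rule lincombs_min[OF subspace_preimage[OF L_subspace]])
    show "y [^] i \<in> {u \<in> carrier R. T j u \<in> L}" for i :: nat
      using y_closed subspaceD(4)[OF L_subspace, of "\<omega> [^] (j * i)" "y [^] i"] pow_in_L[of i] \<omega>_K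
      by (simp add: T_pow)
  qed
  then show ?thesis using assms by (auto simp: L_def)
qed

lemma T_N:
  assumes "u \<in> L"
  shows "T N u = u"
proof -
  have "subspace {u \<in> carrier R. T N u = u}"
    unfolding subspace_def
  proof (intro conjI ballI CollectI)
    show "T N \<zero> = \<zero>" using T_K[of \<zero> N] by simp
  qed (auto simp: T_lin)
  then have "lincombs {..<N} (\<lambda>i. y [^] i) \<subseteq> {u \<in> carrier R. T N u = u}"
  proof (rule lincombs_min)
    show "y [^] i \<in> {u \<in> carrier R. T N u = u}" for i :: nat
    proof -
      have "\<omega> [^] (N * i) = \<one>" using nat_pow_pow[OF K_carrier[OF \<omega>_K], of N i] \<omega>_pow_N by simp
      then show ?thesis using y_closed by (simp add: T_pow)
    qed
  qed
  then show ?thesis using assms by (auto simp: L_def)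
qed

lemma L_separation:
  assumes W: "subspace W" and stable: "\<And>u. u \<in> W \<Longrightarrow> T 1 u \<in> W"
    and c: "c \<in> {..<N} \<rightarrow> K" and sum: "(\<Oplus>i\<in>{..<N}. c i \<otimes> y [^] i) \<in> W"
  shows "\<forall>i\<in>{..<N}. c i \<otimes> y [^] i \<in> W"
proof (rule eigenvector_separation[where D = "\<lambda>_::unit. T 1" and \<Theta> = UNIV and \<chi> = "\<lambda>_ i. \<omega> [^] i", OF W _ stable _ _ _ _ _ sum])
  show "lin_map (T 1)" using T_lin by (simp add: lin_map_def)
  fix i assume "i \<in> {..<N}"
  then have ci: "c i \<in> K" using c by auto
  show "T 1 (c i \<otimes> y [^] i) = \<omega> [^] i \<otimes> (c i \<otimes> y [^] i)"
    using T_lin(3)[OF ci, of "y [^] i" 1] T_pow[of 1 i] K_lcomm[of "c i" "\<omega> [^] i" "y [^] i"] ci \<omega>_K y_closed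
    by simp
next
  fix i j assume "i \<in> {..<N}" "j \<in> {..<N}" "i \<noteq> j"
  then show "\<exists>u\<in>(UNIV::unit set). \<omega> [^] i \<noteq> \<omega> [^] j"
    using \<omega>_pow_inj[of i j] by auto
qed (use c \<omega>_K y_closed in \<open>auto simp: Pi_iff\<close>)

text \<open>The terms of a fixed element are fixed separately, and \<open>\<omega> [^] i\<close>
  differs from \<open>\<one>\<close> for \<open>0 < i < N\<close>. Besides giving the fixed field,
  this is how scalars are recognized in the field criterion.\<close>

lemma L_fixed:
  assumes u: "u \<in> L" and fixed: "T 1 u = u"
  shows "u \<in> K"
proof -
  obtain c where c: "c \<in> {..<N} \<rightarrow> K" "u = (\<Oplus>i\<in>{..<N}. c i \<otimes> y [^] i)"
    using u unfolding L_def lincombs_def by auto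
  have cK: "c i \<in> K" if "i < N" for i using c(1) that by auto
  let ?C = "{v \<in> carrier R. T 1 v = v}"
  have sub: "subspace ?C"
    unfolding subspace_def
  proof (intro conjI ballI CollectI)
    show "T 1 \<zero> = \<zero>" using T_K[of \<zero> 1] by simp
  qed (auto simp: T_lin)
  have "\<forall>i\<in>{..<N}. c i \<otimes> y [^] i \<in> ?C"
  proof (rule L_separation[OF sub _ c(1)])
    have "u \<in> ?C" using fixed L_carrier[OF u] by simp
    then show "(\<Oplus>i\<in>{..<N}. c i \<otimes> y [^] i) \<in> ?C" unfolding c(2) .
  qed simp
  then have Tc: "T 1 (c i \<otimes> y [^] i) = c i \<otimes> y [^] i" if "i < N" for i
    using that by blast
  have c0: "c i \<otimes> y [^] i = \<zero>" if i: "i \<in> {..<N}" "i \<noteq> 0" for i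
  proof (rule ccontr)
    assume neq: "c i \<otimes> y [^] i \<noteq> \<zero>"
    have ci: "c i \<in> K" using cK i by simp
    have \<omega>K: "\<omega> [^] i \<in> K" using \<omega>_K by simp
    have "\<omega> [^] i \<otimes> (c i \<otimes> y [^] i) = c i \<otimes> y [^] i"
      using Tc[of i] T_lin(3)[OF ci, of "y [^] i" 1] T_pow[of 1 i] i
        K_lcomm[OF ci K_carrier[OF \<omega>K], of "y [^] i"] y_closed
      by simp
    then have "(\<omega> [^] i \<ominus> \<one>) \<otimes> (c i \<otimes> y [^] i) = \<zero>"
      using K_carrier[OF \<omega>K] K_carrier[OF ci] y_closed by (simp add: minus_eq l_distr l_minus r_neg)
    then have "\<omega> [^] i \<ominus> \<one> = \<zero>"
      using K_cancel[of "\<omega> [^] i \<ominus> \<one>" "c i \<otimes> y [^] i"] \<omega>K ci y_closed neq by simp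
    then show False using \<omega>_primitive[of i] i K_carrier[OF \<omega>K] by simp
  qed
  have "u = c 0 \<otimes> y [^] (0::nat)"
    unfolding c(2) by (rule finsum_single) (use N_pos c0 cK y_closed in auto)
  then show "u \<in> K" using cK[of 0] N_pos by simp
qed

end


section \<open>Maximal ideals of \<open>K[y]\<close> and the absence of radicals\<close>

context quantum_pair
begin

lemma subspace_L_ideal:
  assumes I: "ideal I (R\<lparr>carrier := L\<rparr>)"
  shows "subspace I" "I \<subseteq> L" "u \<in> I \<Longrightarrow> v \<in> L \<Longrightarrow> v \<otimes> u \<in> I"
proof -
  note a = ideal.axioms(1)[OF I]
  show IL: "I \<subseteq> L" using additive_subgroup.a_subset[OF a] by simp
  have absorb: "v \<otimes> u \<in> I" if "u \<in> I" "v \<in> L" for u v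
    using ideal.I_l_closed[OF I, of u v] that by simp
  then show "u \<in> I \<Longrightarrow> v \<in> L \<Longrightarrow> v \<otimes> u \<in> I" .
  show "subspace I"
    unfolding subspace_def
  proof (intro conjI ballI)
    show "I \<subseteq> carrier R" using IL L_carrier by blast
    show "\<zero> \<in> I" using additive_subgroup.zero_closed[OF a] by simp
    show "u \<oplus> v \<in> I" if "u \<in> I" "v \<in> I" for u v
      using additive_subgroup.a_closed[OF a that] by simp
    show "k \<otimes> v \<in> I" if "k \<in> K" "v \<in> I" for k v
      by (rule absorb[OF that(2) subsetD[OF K_L that(1)]])
  qed
qed

lemma inv_y_in_L: "inv y \<in> L"
  by (rule inv_in_generated[OF subring_L K_L y_in_L y_pow_N N_pos])

lemma y_pow_inv:
  obtains v where "v \<in> L" "v \<otimes> y [^] (i::nat) = \<one>"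
proof -
  have "\<exists>v\<in>L. v \<otimes> y [^] i = \<one>"
  proof (induction i)
    case 0
    show ?case using subringE(3)[OF subring_L] by (intro bexI[of _ \<one>]) auto
  next
    case (Suc i)
    then obtain v where v: "v \<in> L" "v \<otimes> y [^] i = \<one>" by auto
    have c: "v \<in> carrier R" "inv y \<in> carrier R"
      using L_carrier[OF v(1)] L_carrier[OF inv_y_in_L] by auto
    have "(inv y \<otimes> v) \<otimes> y [^] Suc i = inv y \<otimes> (v \<otimes> y [^] i) \<otimes> y"
      using c y_closed by (simp add: m_assoc)
    then have "(inv y \<otimes> v) \<otimes> y [^] Suc i = \<one>" using v(2) c y_Unit by simp
    then show ?case using subringE(6)[OF subring_L inv_y_in_L v(1)] by blast
  qed
  then show thesis using that by blast
qed

text \<open>A \<open>T\<close>-stable proper ideal vanishes since it is spanned by some of the units \<open>y\<^sup>i\<close>.\<close>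

lemma stable_ideal_trivial:
  assumes sub: "subspace W" and WL: "W \<subseteq> L" and stable: "\<And>u. u \<in> W \<Longrightarrow> T 1 u \<in> W"
    and absorb: "\<And>u v. u \<in> W \<Longrightarrow> v \<in> L \<Longrightarrow> v \<otimes> u \<in> W" and one: "\<one> \<notin> W" and u: "u \<in> W"
  shows "u = \<zero>"
proof -
  obtain c where c: "c \<in> {..<N} \<rightarrow> K" "u = (\<Oplus>i\<in>{..<N}. c i \<otimes> y [^] i)"
    using subsetD[OF WL u] unfolding L_def lincombs_def by auto
  have cW: "\<forall>i\<in>{..<N}. c i \<otimes> y [^] i \<in> W"
    by (rule L_separation[OF sub stable c(1) u[unfolded c(2)]])
  have "c i = \<zero>" if i: "i \<in> {..<N}" for i
  proof (rule ccontr)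
    assume c0: "c i \<noteq> \<zero>"
    have ciK: "c i \<in> K" using c(1) i by auto
    have "inv (c i) \<otimes> (c i \<otimes> y [^] i) \<in> W"
      using subspaceD(4)[OF sub K_inv(1)[OF ciK c0] bspec[OF cW i]] .
    moreover have "inv (c i) \<otimes> (c i \<otimes> y [^] i) = y [^] i"
      using m_assoc[OF K_carrier[OF K_inv(1)[OF ciK c0]] K_carrier[OF ciK] nat_pow_closed[OF y_closed, of i]]
        K_inv(4)[OF ciK c0] y_closed by simp
    ultimately have yW: "y [^] i \<in> W" by simp
    obtain v where "v \<in> L" "v \<otimes> y [^] i = \<one>" using y_pow_inv .
    then show False using absorb[OF yW, of v] one by simp
  qed
  then show "u = \<zero>"
    unfolding c(2) using y_closed by (intro add.finprod_one_eqI) simp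
qed

text \<open>Let \<open>T t\<close> generate the stabilizer of a maximal ideal \<open>I\<close>. An
  element \<open>e\<close> that is 1 modulo \<open>I\<close> and whose conjugates
  \<open>T j e\<close> for \<open>0 < j < t\<close> lie in \<open>I\<close> is fixed by
  \<open>T t\<close>. Put \<open>\<zeta> = \<omega> [^] (N div t)\<close>. The sum \<open>r\<close>
  of the \<open>\<zeta> [^] j \<otimes> T j e\<close> is divided by \<open>\<zeta>\<close> under
  \<open>T 1\<close>, while \<open>b = y [^] (N div t)\<close> is multiplied by it, so
  \<open>b \<otimes> r\<close> is a scalar. It is congruent to \<open>b\<close> modulo
  \<open>I\<close>, hence its \<open>t\<close>-th power is \<open>y [^] N\<close>. In the absence of
  such roots \<open>t = 1\<close>; then \<open>I\<close> is stable and therefore zero.\<close>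

lemma field_L_aux:
  assumes no_root: "\<And>c t. c \<in> K \<Longrightarrow> t dvd N \<Longrightarrow> t > 1 \<Longrightarrow> c [^] t \<noteq> y [^] N"
  shows "field (R\<lparr>carrier := L\<rparr>)"
proof -
  interpret L: cring "R\<lparr>carrier := L\<rparr>" by (rule cring_L)
  obtain I where I: "maximalideal I (R\<lparr>carrier := L\<rparr>)"
    using L.exists_maximalideal one_neq_zero by auto
  note idI = maximalideal.axioms(1)[OF I]
  note subI = subspace_L_ideal(1)[OF idI] and IL = subspace_L_ideal(2)[OF idI]
    and absorb = subspace_L_ideal(3)[OF idI]
  have oneI: "\<one> \<notin> I"
    using maximalideal.I_notcarr[OF I] ideal.one_imp_carrier[OF idI] by auto
  have L_mult: "u \<in> L \<Longrightarrow> v \<in> L \<Longrightarrow> u \<otimes> v \<in> L" for u v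
    by (rule subringE(6)[OF subring_L])
  have L_minus: "u \<in> L \<Longrightarrow> v \<in> L \<Longrightarrow> u \<ominus> v \<in> L" for u v
    by (rule subspaceD(6)[OF L_subspace])
  have primeI: "u \<in> I \<or> v \<in> I" if "u \<in> L" "v \<in> L" "u \<otimes> v \<in> I" for u v
    using primeideal.I_prime[OF L.maximalideal_prime[OF I], of u v] that by simp
  \<comment> \<open>Maximality: \<open>I\<close> together with a multiple of \<open>u\<close> must
    reach \<open>\<one>\<close>.\<close>
  have inv_mod: "\<exists>g\<in>L. \<one> \<ominus> g \<otimes> u \<in> I" if u: "u \<in> L" "u \<notin> I" for u
  proof -
    let ?J = "PIdl\<^bsub>R\<lparr>carrier := L\<rparr>\<^esub> u"
    have J: "ideal ?J (R\<lparr>carrier := L\<rparr>)" using L.cgenideal_ideal u(1) by simp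
    have uJ: "u \<in> ?J" using L.cgenideal_self[of u] u(1) by simp
    note IJ = L.add_ideals[OF idI J]
    have zero: "\<zero> \<in> I" "\<zero> \<in> ?J"
      using additive_subgroup.zero_closed[OF ideal.axioms(1)[OF idI]]
        additive_subgroup.zero_closed[OF ideal.axioms(1)[OF J]] by simp_all
    have uR: "u \<in> carrier R" using L_carrier[OF u(1)] .
    have "I \<subseteq> I <+>\<^bsub>R\<lparr>carrier := L\<rparr>\<^esub> ?J"
    proof
      fix i assume "i \<in> I"
      then show "i \<in> I <+>\<^bsub>R\<lparr>carrier := L\<rparr>\<^esub> ?J"
        using zero(2) subspaceD(1)[OF subI, of i] unfolding set_add_def' by (force intro: bexI[of _ \<zero>])
    qed
    moreover have "u \<in> I <+>\<^bsub>R\<lparr>carrier := L\<rparr>\<^esub> ?J"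
      using zero(1) uJ uR unfolding set_add_def' by (force intro: bexI[of _ \<zero>])
    ultimately have "I <+>\<^bsub>R\<lparr>carrier := L\<rparr>\<^esub> ?J = L"
      using maximalideal.I_maximal[OF I IJ] u(2)
        additive_subgroup.a_subset[OF ideal.axioms(1)[OF IJ]] by auto
    then have "\<one> \<in> I <+>\<^bsub>R\<lparr>carrier := L\<rparr>\<^esub> ?J" using subringE(3)[OF subring_L] by simp
    then obtain i g where ig: "i \<in> I" "g \<in> L" "\<one> = i \<oplus> g \<otimes> u"
      unfolding set_add_def' cgenideal_def by auto
    have "\<one> \<ominus> g \<otimes> u = i"
      using ig subspaceD(1)[OF subI ig(1)] L_carrier[OF ig(2)] uR
      by (simp add: minus_eq a_assoc r_neg)
    then show ?thesis using ig(1,2) by (intro bexI[of _ g]) simp_all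
  qed
  \<comment> \<open>Stabilizing is recorded through preimages of \<open>I\<close>. The opposite
    inclusion is \<open>tI\<close>, which follows because \<open>T N\<close> is the identity on
    \<open>L\<close>.\<close>
  let ?P = "\<lambda>t. t > 0 \<and> (\<forall>u\<in>L. T t u \<in> I \<longrightarrow> u \<in> I)"
  define t where "t = (LEAST t. ?P t)"
  have PN: "?P N" using T_N N_pos by auto
  have t_least: "\<not> ?P j" if "j < t" for j
    using not_less_Least[of j ?P] that unfolding t_def .
  have "?P t" unfolding t_def by (rule LeastI[of ?P, OF PN])
  then have t: "t > 0" "u \<in> L \<Longrightarrow> T t u \<in> I \<Longrightarrow> u \<in> I" for u by auto
  have tk: "u \<in> I" if "u \<in> L" "T (t * k) u \<in> I" for u k
    using that(2)
  proof (induction k)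
    case 0
    then show ?case using T_T[OF L_carrier[OF that(1)]] that(1)
      by (simp add: T_def conj_by_def L_carrier)
  next
    case (Suc k)
    have "T t (T (t * k) u) = T (t * Suc k) u" using T_T[OF L_carrier[OF that(1)]] by simp
    then show ?case using Suc t(2)[OF T_L[OF that(1), of "t * k"]] by simp
  qed
  have tI: "T (t * k) u \<in> I" if "u \<in> I" for u k
  proof -
    have uL: "u \<in> L" using IL that by auto
    have TNk: "T (N * j) u = u" for j
    proof (induction j)
      case 0
      then show ?case by (simp add: T_def conj_by_def L_carrier uL)
    next
      case (Suc j)
      have "T (N * Suc j) u = T N (T (N * j) u)" using T_T[OF L_carrier[OF uL]] by simp
      then show ?case using Suc T_N[OF uL] by simp
    qed
    \<comment> \<open>After \<open>T (t * k)\<close>, another \<open>N - 1\<close> applications of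
      it lead back to \<open>u\<close>; the preimage statement \<open>tk\<close> for these gives the
      claim.\<close>
    have "t * ((N - 1) * k) + t * k = N * (t * k)"
      using N_pos by (cases N) (auto simp: algebra_simps)
    then have "T (t * ((N - 1) * k)) (T (t * k) u) = u"
      using T_T[OF L_carrier[OF uL]] TNk by simp
    then show ?thesis using tk[OF T_L[OF uL], of "(N - 1) * k"] that by simp
  qed
  have tdvd: "t dvd N"
  proof (rule ccontr)
    assume "\<not> t dvd N"
    then have r: "0 < N mod t" "N mod t < t" using t(1) by (simp_all add: dvd_eq_mod_eq_0)
    have "u \<in> I" if u: "u \<in> L" "T (N mod t) u \<in> I" for u
    proof -
      have "T (t * (N div t)) (T (N mod t) u) = u"
        using T_T[OF L_carrier[OF u(1)]] T_N[OF u(1)] by simp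
      then show ?thesis using tI[OF u(2), of "N div t"] by simp
    qed
    then show False using t_least[OF r(2)] r(1) by blast
  qed
  \<comment> \<open>For \<open>0 < j < t\<close>, minimality of \<open>t\<close> supplies an element
    outside \<open>I\<close> that \<open>T j\<close> sends into \<open>I\<close>. The product of
    such elements stays outside because \<open>I\<close> is prime.\<close>
  have partial: "\<exists>f\<in>L. f \<notin> I \<and> (\<forall>j. 0 < j \<and> j \<le> k \<longrightarrow> T j f \<in> I)" if "k < t" for k
    using that
  proof (induction k)
    case 0
    show ?case using oneI subringE(3)[OF subring_L] by (intro bexI[of _ \<one>]) auto
  next
    case (Suc k)
    then obtain f where f: "f \<in> L" "f \<notin> I" "\<And>j. 0 < j \<Longrightarrow> j \<le> k \<Longrightarrow> T j f \<in> I" by auto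
    obtain g where g: "g \<in> L" "T (Suc k) g \<in> I" "g \<notin> I"
      using t_least[OF Suc.prems] by auto
    have "T j (g \<otimes> f) \<in> I" if j: "0 < j" "j \<le> Suc k" for j
    proof (cases "j = Suc k")
      case True
      then have "T j (g \<otimes> f) = T j f \<otimes> T j g"
        using T_lin(4)[OF L_carrier[OF g(1)] L_carrier[OF f(1)]] L_comm[OF T_L[OF g(1)] T_L[OF f(1)]]
        by simp
      then show ?thesis using absorb[OF g(2) T_L[OF f(1)]] True by simp
    next
      case False
      then have "T j f \<in> I" using f(3) j by simp
      then show ?thesis
        using T_lin(4)[OF L_carrier[OF g(1)] L_carrier[OF f(1)]] absorb[OF _ T_L[OF g(1)]] by simp
    qed
    moreover have "g \<otimes> f \<notin> I" using primeI[OF g(1) f(1)] g(3) f(2) by blast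
    ultimately show ?case using L_mult[OF g(1) f(1)] by blast
  qed
  obtain f where f: "f \<in> L" "f \<notin> I" "\<And>j. 0 < j \<Longrightarrow> j < t \<Longrightarrow> T j f \<in> I"
    using partial[of "t - 1"] t(1) by auto
  obtain g where g: "g \<in> L" "\<one> \<ominus> g \<otimes> f \<in> I" using inv_mod[OF f(1,2)] by auto
  define e where "e = g \<otimes> f"
  have eL: "e \<in> L" unfolding e_def by (rule L_mult[OF g(1) f(1)])
  have eR: "e \<in> carrier R" by (rule L_carrier[OF eL])
  have e1: "\<one> \<ominus> e \<in> I" using g(2) by (simp add: e_def)
  have Te: "T j e \<in> I" if "0 < j" "j < t" for j
    unfolding e_def T_lin(4)[OF L_carrier[OF g(1)] L_carrier[OF f(1)]]
    by (rule absorb[OF f(3)[OF that] T_L[OF g(1)]])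
  \<comment> \<open>The intersection of all conjugates of \<open>I\<close> is a stable proper ideal,
    hence zero. Elements that are congruent modulo every conjugate are therefore equal.\<close>
  let ?W = "{d \<in> L. \<forall>j. T j d \<in> I}"
  have W0: "d = \<zero>" if "d \<in> ?W" for d
  proof (rule stable_ideal_trivial[OF _ _ _ _ _ that])
    show "subspace ?W"
      unfolding subspace_def
    proof (intro conjI ballI CollectI allI)
      show "?W \<subseteq> carrier R" using L_carrier by auto
      show "\<zero> \<in> L" by (rule subspaceD(2)[OF L_subspace])
      show "T j \<zero> \<in> I" for j using T_K[of \<zero> j] subspaceD(2)[OF subI] by simp
      fix u v assume uv: "u \<in> ?W" "v \<in> ?W"
      then show "u \<oplus> v \<in> L" using subspaceD(3)[OF L_subspace] by auto
      show "T j (u \<oplus> v) \<in> I" for j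
        using uv subspaceD(3)[OF subI, of "T j u" "T j v"] L_carrier by (auto simp: T_lin)
    next
      fix k v assume kv: "k \<in> K" "v \<in> ?W"
      then show "k \<otimes> v \<in> L" using subspaceD(4)[OF L_subspace] by auto
      show "T j (k \<otimes> v) \<in> I" for j
        using kv subspaceD(4)[OF subI, of k "T j v"] L_carrier by (auto simp: T_lin)
    qed
    show "?W \<subseteq> L" by auto
    show "T 1 u \<in> ?W" if "u \<in> ?W" for u
      using that T_L[of u 1] T_T[of u _ 1] L_carrier[of u] by auto
    show "v \<otimes> u \<in> ?W" if "u \<in> ?W" "v \<in> L" for u v
      using that L_mult[of v u] T_lin(4)[OF L_carrier[of v] L_carrier[of u]] absorb[OF _ T_L[of v]]
      by auto
    show "\<one> \<notin> ?W" using oneI by auto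
  qed
  \<comment> \<open>Since \<open>T t\<close> preserves \<open>I\<close>, only the exponents below
    \<open>t\<close> have to be tested.\<close>
  have all_j: "T j d \<in> I" if d: "d \<in> L" "\<And>i. i < t \<Longrightarrow> T i d \<in> I" for d j
  proof -
    have "T j d = T (t * (j div t)) (T (j mod t) d)"
      using T_T[OF L_carrier[OF d(1)]] by simp
    then show ?thesis using tI[OF d(2)[of "j mod t"], of "j div t"] t(1) by simp
  qed
  \<comment> \<open>\<open>e\<close> and \<open>T t e\<close> are both 1 modulo \<open>I\<close> and
    both 0 modulo the other conjugates.\<close>
  have Tt_e: "T t e = e"
  proof -
    have "T 0 u = u" if "u \<in> L" for u
      using L_carrier[OF that] by (simp add: T_def conj_by_def)
    note T0 = this
    have 1: "T t (\<one> \<ominus> e) \<in> I" using tI[OF e1, of 1] by simp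
    have "T i (e \<ominus> T t e) \<in> I" if i: "i < t" for i
    proof (cases "i = 0")
      case True
      \<comment> \<open>Both elements are compared with \<open>\<one>\<close>, which
        \<open>T t\<close> fixes.\<close>
      have "e \<ominus> T t e = T t (\<one> \<ominus> e) \<ominus> (\<one> \<ominus> e)"
        using T_minus[OF one_closed eR, of t] eR T_lin(1)[OF eR, of t]
        by (simp add: minus_eq minus_add a_ac r_neg r_neg1 r_neg2)
      then have "e \<ominus> T t e \<in> I" using subspaceD(6)[OF subI 1 e1] by simp
      then show ?thesis using True T0[OF L_minus[OF eL T_L[OF eL]]] by simp
    next
      case False
      have "T i (T t e) = T t (T i e)" using T_T[OF eR] by (simp add: add.commute)
      moreover have "T t (T i e) \<in> I" using tI[OF Te[of i], of 1] i False by simp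
      ultimately show ?thesis
        using T_minus[OF eR T_lin(1)[OF eR]] subspaceD(6)[OF subI Te[of i]] i False by simp
    qed
    then have "e \<ominus> T t e \<in> ?W"
      using all_j[OF L_minus[OF eL T_L[OF eL]]] L_minus[OF eL T_L[OF eL]] by simp
    then have "e \<ominus> T t e = \<zero>" by (rule W0)
    then show ?thesis using eR T_lin(1)[OF eR] by simp
  qed
  \<comment> \<open>Chosen so that \<open>T 1\<close> multiplies \<open>y [^] (N div t)\<close> by
    it; its \<open>t\<close>-th power is 1, so the summands \<open>?F j\<close> below are
    periodic.\<close>
  define \<zeta> where "\<zeta> = \<omega> [^] (N div t)"
  have \<zeta>K: "\<zeta> \<in> K" unfolding \<zeta>_def using \<omega>_K by simp
  have \<zeta>t: "\<zeta> [^] t = \<one>"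
    unfolding \<zeta>_def using nat_pow_pow[OF K_carrier[OF \<omega>_K], of "N div t" t] \<omega>_pow_N tdvd by simp
  let ?F = "\<lambda>j. \<zeta> [^] j \<otimes> T j e"
  have FL: "?F j \<in> L" for j
    by (rule subspaceD(4)[OF L_subspace _ T_L[OF eL]]) (use \<zeta>K in simp)
  have FR: "?F j \<in> carrier R" for j using L_carrier[OF FL] .
  have T0e: "T 0 e = e" using eR by (simp add: T_def conj_by_def)
  \<comment> \<open>A Lagrange resolvent of \<open>e\<close>. The term at \<open>j = 0\<close> makes
    it congruent to 1 modulo \<open>I\<close>, as the other terms lie in \<open>I\<close>.\<close>
  define r where "r = (\<Oplus>j\<in>{..<t}. ?F j)"
  define b where "b = y [^] (N div t)"
  have rL: "r \<in> L" unfolding r_def by (rule subspace_finsum[OF L_subspace FL])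
  have rR: "r \<in> carrier R" by (rule L_carrier[OF rL])
  have bL: "b \<in> L" unfolding b_def by (rule pow_in_L)
  have bR: "b \<in> carrier R" by (rule L_carrier[OF bL])
  have Tr: "\<zeta> \<otimes> T 1 r = r"
  proof -
    have "T 1 r = (\<Oplus>j\<in>{..<t}. T 1 (?F j))"
      unfolding r_def
      by (rule finsum_additive) (use abelian_monoid_axioms T_lin T_K[of \<zero>] FR in auto)
    also have "\<zeta> \<otimes> (\<Oplus>j\<in>{..<t}. T 1 (?F j)) = (\<Oplus>j\<in>{..<t}. \<zeta> \<otimes> T 1 (?F j))"
      by (rule finsum_rdistr) (use \<zeta>K T_lin(1)[OF FR] in auto)
    also have "\<dots> = (\<Oplus>j\<in>{..<t}. ?F (Suc j))"
    proof (rule finsum_cong')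
      fix j
      have "T 1 (?F j) = \<zeta> [^] j \<otimes> T (Suc j) e"
        using T_lin(3)[of "\<zeta> [^] j" "T j e" 1] T_T[OF eR, of 1 j] T_lin(1)[OF eR] \<zeta>K by simp
      then show "\<zeta> \<otimes> T 1 (?F j) = ?F (Suc j)"
        using m_assoc[of \<zeta> "\<zeta> [^] j" "T (Suc j) e"] nat_pow_Suc2[of \<zeta> j] \<zeta>K T_lin(1)[OF eR] by simp
    next
      show "(\<lambda>j. ?F (Suc j)) \<in> {..<t} \<rightarrow> carrier R" using FR by blast
    qed simp
    also have "\<dots> = r"
      unfolding r_def by (rule finsum_cyclic_shift[OF FR]) (use \<zeta>t Tt_e T0e eR in simp)
    finally show ?thesis .
  qed
  have Tb: "T 1 b = \<zeta> \<otimes> b" unfolding b_def \<zeta>_def using T_pow[of 1 "N div t"] by simp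
  have cK: "b \<otimes> r \<in> K"
  proof (rule L_fixed[OF L_mult[OF bL rL]])
    have "T 1 (b \<otimes> r) = (\<zeta> \<otimes> b) \<otimes> T 1 r" using T_lin(4)[OF bR rR] Tb by simp
    also have "\<dots> = b \<otimes> (\<zeta> \<otimes> T 1 r)"
      using K_lcomm[OF \<zeta>K bR T_lin(1)[OF rR]] m_assoc[OF K_carrier[OF \<zeta>K] bR T_lin(1)[OF rR]] by simp
    finally show "T 1 (b \<otimes> r) = b \<otimes> r" unfolding Tr .
  qed
  have re: "r \<ominus> \<one> \<in> I"
  proof -
    have split: "r = e \<oplus> (\<Oplus>j\<in>{0<..<t}. ?F j)"
    proof -
      have set: "{..<t} = insert 0 {0<..<t}" using t(1) by auto
      have "r = ?F 0 \<oplus> (\<Oplus>j\<in>{0<..<t}. ?F j)"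
        unfolding r_def set
      proof (rule finsum_insert)
        show "?F 0 \<in> carrier R" by (rule FR)
        show "?F \<in> {0<..<t} \<rightarrow> carrier R" using FR by blast
      qed simp_all
      then show ?thesis using T0e eR by simp
    qed
    have rest: "(\<Oplus>j\<in>{0<..<t}. ?F j) \<in> I"
      by (rule subspace_finsum[OF subI subspaceD(4)[OF subI _ Te]]) (use \<zeta>K in auto)
    note restR = subspaceD(1)[OF subI rest]
    have "r \<ominus> \<one> = (\<Oplus>j\<in>{0<..<t}. ?F j) \<ominus> (\<one> \<ominus> e)"
      unfolding split using restR eR by (simp add: minus_eq minus_add a_ac)
    then show ?thesis using subspaceD(6)[OF subI rest e1] by simp
  qed
  have cb: "(b \<otimes> r) [^] k \<ominus> b [^] k \<in> I" for k :: nat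
  proof (induction k)
    case 0
    show ?case using subspaceD(2)[OF subI] by (simp add: minus_eq r_neg)
  next
    case (Suc k)
    let ?c = "b \<otimes> r"
    have c: "?c \<in> carrier R" "?c [^] k \<in> carrier R" "b [^] k \<in> carrier R" using bR rR by auto
    have "?c [^] Suc k \<ominus> b [^] Suc k =
        ?c [^] k \<otimes> (?c \<ominus> b) \<oplus> (?c [^] k \<ominus> b [^] k) \<otimes> b"
      using c bR by (simp add: minus_eq r_distr l_distr l_minus r_minus)
        (simp add: a_assoc r_neg1 r_neg2)
    moreover have "?c \<ominus> b = b \<otimes> (r \<ominus> \<one>)"
      using bR rR by (simp add: minus_eq r_distr r_minus)
    then have "?c \<ominus> b \<in> I" using absorb[OF re bL] by simp
    then have "?c [^] k \<otimes> (?c \<ominus> b) \<in> I"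
      using absorb pow_in_subring[OF subring_L L_mult[OF bL rL], of k] by blast
    moreover have "(?c [^] k \<ominus> b [^] k) \<otimes> b \<in> I"
      using absorb[OF Suc bL] L_comm[OF _ bL, of "?c [^] k \<ominus> b [^] k"] IL Suc by auto
    ultimately show ?case using subspaceD(3)[OF subI] by simp
  qed
  have "(b \<otimes> r) [^] t = y [^] N"
  proof (rule ccontr)
    assume neq: "(b \<otimes> r) [^] t \<noteq> y [^] N"
    have bt: "b [^] t = y [^] N"
      unfolding b_def using nat_pow_pow[OF y_closed, of "N div t" t] tdvd by simp
    \<comment> \<open>This difference is a scalar in \<open>I\<close>; if it were nonzero, the
      proper ideal \<open>I\<close> would contain a unit.\<close>
    let ?d = "(b \<otimes> r) [^] t \<ominus> y [^] N"
    have dI: "?d \<in> I" using cb[of t] bt by simp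
    have dK: "?d \<in> K" using cK y_pow_N(1) by simp
    have d0: "?d \<noteq> \<zero>" using neq bR rR y_closed by simp
    have "inv ?d \<otimes> ?d \<in> I" using subspaceD(4)[OF subI K_inv(1)[OF dK d0] dI] .
    then show False using K_inv(4)[OF dK d0] oneI by simp
  qed
  then have "t = 1" using no_root[OF cK tdvd] t(1) by (cases "t = 1") auto
  \<comment> \<open>For \<open>t = 1\<close> all conjugates of \<open>I\<close> contain
    \<open>I\<close>, so \<open>I\<close> lies in the vanishing intersection
    \<open>?W\<close>.\<close>
  have "I = {\<zero>}"
  proof -
    have "u = \<zero>" if u: "u \<in> I" for u
    proof (rule W0)
      have "T j u \<in> I" for j using tI[OF u, of j] \<open>t = 1\<close> by simp
      then show "u \<in> ?W" using IL u by auto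
    qed
    then have "I \<subseteq> {\<zero>}" by blast
    then show ?thesis using subspaceD(2)[OF subI] by auto
  qed
  then show ?thesis using L.zeromaximalideal_fieldI I by simp
qed

end


text \<open>The list \<open>f\<close> is \<open>z^N - c\<close> with the leading coefficient first;
  its roots, even with multiplicity, number at most its degree.\<close>

lemma (in field) card_radicals_le:
  fixes N :: nat
  assumes N: "N > 0" and c: "c \<in> carrier R" and S: "finite S" "S \<subseteq> {v \<in> carrier R. v [^] N = c}"
  shows "card S \<le> N"
proof -
  obtain M where M: "N = Suc M" using N by (cases N) auto
  define f where "f = \<one> # replicate M \<zero> @ [\<ominus> c]"
  have f: "f \<in> carrier (poly_ring R)"
    unfolding f_def univ_poly_carrier[symmetric] by (intro polynomialI) (use c in auto)
  have "eval (replicate k \<zero> @ [\<ominus> c]) v = \<ominus> c" if "v \<in> carrier R" for v and k :: nat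
    using that c by (induction k) auto
  then have ev: "eval f v = v [^] N \<ominus> c" if "v \<in> carrier R" for v
    using that unfolding f_def M by (simp add: minus_eq)
  have "S \<subseteq> set_mset (roots f)"
  proof
    fix v assume "v \<in> S"
    then have v: "v \<in> carrier R" "v [^] N = c" using S by auto
    then have "is_root f v"
      using ev[OF v(1)] c by (simp add: is_root_def f_def minus_eq r_neg)
    then show "v \<in> set_mset (roots f)" using roots_mem_iff_is_root[OF f] by simp
  qed
  then have "mset_set S \<subseteq># mset_set (set_mset (roots f))"
    by (intro subset_imp_msubset_mset_set) auto
  also have "\<dots> \<subseteq># roots f" by (rule mset_set_set_mset_msubset)
  finally have "size (mset_set S) \<le> size (roots f)" by (rule size_mset_mono)
  also have "\<dots> \<le> degree f" by (rule size_roots_le_degree[OF f])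
  finally show ?thesis by (simp add: f_def M)
qed

context quantum_pair
begin

text \<open>If \<open>c [^] p = y [^] N\<close>, then \<open>v\<close>, the quotient of
  \<open>y [^] (N div p)\<close> by \<open>c\<close>, satisfies \<open>v [^] p = \<one>\<close>, so
  \<open>v \<ominus> \<one>\<close> times the geometric sum of \<open>v\<close> is zero. Neither
  factor vanishes: the powers of \<open>v\<close> below \<open>p\<close> have distinct characters,
  and that of \<open>v\<close> itself is nontrivial. So \<open>L\<close> has zero divisors.\<close>

lemma field_L_no_root:
  assumes L: "field (R\<lparr>carrier := L\<rparr>)" and p: "Factorial_Ring.prime p" "p dvd N" and c: "c \<in> K"
  shows "c [^] p \<noteq> y [^] N"
proof
  assume cp: "c [^] p = y [^] N"
  interpret L: field "R\<lparr>carrier := L\<rparr>" by (rule L)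
  have p1: "p > 1" using prime_gt_1_nat[OF p(1)] .
  let ?k = "N div p"
  have k3: "?k * p = N" using p(2) by simp
  have k1: "0 < ?k" using k3 N_pos by (cases "?k = 0") auto
  have k2: "?k < N" using p1 N_pos by simp
  note k = k1 k2 k3
  have c0: "c \<noteq> \<zero>"
  proof
    assume "c = \<zero>"
    then have "c [^] p = \<zero>" using p1 by (cases p) auto
    with cp y_pow_N show False by simp
  qed
  note ic = K_inv[OF c c0]
  define v where "v = inv c \<otimes> y [^] ?k"
  have vL: "v \<in> L" unfolding v_def by (rule subspaceD(4)[OF L_subspace ic(1) pow_in_L])
  have vR: "v \<in> carrier R" by (rule L_carrier[OF vL])
  have v_pow: "v [^] j = inv c [^] j \<otimes> y [^] (?k * j)" for j :: nat
  proof (induction j)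
    case (Suc j)
    have icj: "inv c [^] j \<in> K" using ic(1) by (rule K_pow_closed)
    have "v [^] Suc j = inv c [^] j \<otimes> (y [^] (?k * j) \<otimes> (inv c \<otimes> y [^] ?k))"
      using Suc icj ic(1) y_closed by (simp add: v_def m_assoc)
    also have "y [^] (?k * j) \<otimes> (inv c \<otimes> y [^] ?k) = inv c \<otimes> (y [^] (?k * j) \<otimes> y [^] ?k)"
      by (rule K_lcomm) (use ic(1) y_closed in auto)
    also have "y [^] (?k * j) \<otimes> y [^] ?k = y [^] (?k * Suc j)"
      using y_closed by (simp add: nat_pow_mult add.commute)
    finally show ?case using icj ic(1) y_closed by (simp add: m_assoc)
  qed simp
  have "inv c [^] p \<otimes> c [^] p = \<one>"
  proof -
    have "inv c [^] j \<otimes> c [^] j = \<one>" for j :: nat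
    proof (induction j)
      case (Suc j)
      have "inv c [^] Suc j \<otimes> c [^] Suc j = inv c [^] j \<otimes> (inv c \<otimes> c) \<otimes> c [^] j"
        using nat_pow_Suc2[of c j] ic(1) c by (simp add: m_assoc del: nat_pow_Suc)
      then show ?case using Suc ic c by simp
    qed simp
    then show ?thesis .
  qed
  then have vp: "v [^] p = \<one>" using v_pow[of p] k(3) cp by simp
  have T_v: "T 1 (v [^] j) = \<omega> [^] (?k * j) \<otimes> v [^] j" for j :: nat
  proof -
    have icj: "inv c [^] j \<in> K" using ic(1) by (rule K_pow_closed)
    have "T 1 (v [^] j) = inv c [^] j \<otimes> T 1 (y [^] (?k * j))"
      unfolding v_pow by (rule T_lin(3)[OF icj]) (use y_closed in simp)
    also have "\<dots> = inv c [^] j \<otimes> (\<omega> [^] (?k * j) \<otimes> y [^] (?k * j))" using T_pow[of 1 "?k * j"] by simp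
    also have "\<dots> = \<omega> [^] (?k * j) \<otimes> (inv c [^] j \<otimes> y [^] (?k * j))"
      by (rule K_lcomm) (use \<omega>_K icj y_closed in auto)
    finally show ?thesis unfolding v_pow .
  qed
  have v_neq: "v [^] j \<noteq> \<zero>" for j :: nat
  proof -
    have "v \<in> Units R" by (rule Units_of_pow[of v p]) (use vR vp p1 one_neq_zero in auto)
    then show ?thesis by (rule Units_neq_zero[OF Units_pow])
  qed
  define e where "e = (\<Oplus>j\<in>{..<p}. v [^] j)"
  have pow_L: "v [^] j \<in> L" for j :: nat by (rule pow_in_subring[OF subring_L vL])
  have eL: "e \<in> L" unfolding e_def by (rule subspace_finsum[OF L_subspace pow_L])
  have eR: "e \<in> carrier R" by (rule L_carrier[OF eL])
  have "e \<noteq> \<zero>"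
  proof
    assume "e = \<zero>"
    then have sum: "(\<Oplus>j\<in>{..<p}. v [^] j) \<in> {\<zero>}" by (simp add: e_def)
    have "\<forall>j\<in>{..<p}. v [^] j \<in> {\<zero>}"
    proof (rule eigenvector_separation[where D = "\<lambda>_::unit. T 1" and \<Theta> = UNIV
          and \<chi> = "\<lambda>_ j. \<omega> [^] (?k * j)", OF subspace_zero _ _ _ _ _ _ _ sum])
      show "lin_map (T 1)" using T_lin by (simp add: lin_map_def)
      show "\<And>u. u \<in> {\<zero>} \<Longrightarrow> T 1 u \<in> {\<zero>}" using T_K[of \<zero> 1] by simp
      show "T 1 (v [^] j) = \<omega> [^] (?k * j) \<otimes> v [^] j" for j by (rule T_v)
      fix i j assume ij: "i \<in> {..<p}" "j \<in> {..<p}" "i \<noteq> j"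
      have "?k * i < ?k * p" "?k * j < ?k * p" using ij(1,2) k1 by simp_all
      then have "?k * i < N" "?k * j < N" unfolding k3 .
      then show "\<exists>u\<in>(UNIV::unit set). \<omega> [^] (?k * i) \<noteq> \<omega> [^] (?k * j)"
        using \<omega>_pow_inj[of "?k * i" "?k * j"] ij(3) k(1) by auto
    qed (use vR \<omega>_K in auto)
    then have "v [^] (0::nat) \<in> {\<zero>}" by (rule bspec) (use p1 in simp)
    then show False using v_neq[of 0] by simp
  qed
  moreover have "(v \<ominus> \<one>) \<otimes> e = \<zero>"
  proof -
    have "v \<otimes> e = (\<Oplus>j\<in>{..<p}. v \<otimes> v [^] j)"
      unfolding e_def by (rule finsum_rdistr) (use vR in auto)
    also have "\<dots> = (\<Oplus>j\<in>{..<p}. v [^] Suc j)"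
      by (rule finsum_cong') (use vR nat_pow_Suc2[OF vR] in auto)
    also have "\<dots> = e"
      unfolding e_def by (rule finsum_cyclic_shift) (use vR vp in auto)
    finally show ?thesis using vR eR by (simp add: minus_eq l_distr l_minus r_neg)
  qed
  moreover have "v \<ominus> \<one> \<in> L"
    by (rule subspaceD(6)[OF L_subspace vL subringE(3)[OF subring_L]])
  ultimately have "v \<ominus> \<one> = \<zero>" using L.integral[of "v \<ominus> \<one>" e] eL by simp
  then have "v = \<one>" using vR by simp
  then have "\<omega> [^] ?k \<otimes> \<one> = \<one>" using T_v[of 1] by simp
  then show False using \<omega>_primitive[OF k(1,2)] \<omega>_K by simp
qed

theorem field_L_iff:
  "field (R\<lparr>carrier := L\<rparr>) \<longleftrightarrow>
    (\<forall>p. Factorial_Ring.prime p \<and> p dvd N \<longrightarrow> (\<forall>c\<in>K. c [^] p \<noteq> y [^] N))"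
proof
  assume *: "\<forall>p. Factorial_Ring.prime p \<and> p dvd N \<longrightarrow> (\<forall>c\<in>K. c [^] p \<noteq> y [^] N)"
  show "field (R\<lparr>carrier := L\<rparr>)"
  proof (rule field_L_aux)
    fix c and t :: nat assume c: "c \<in> K" and t: "t dvd N" "t > 1"
    \<comment> \<open>For a prime \<open>p\<close> dividing \<open>t\<close>, a \<open>t\<close>-th
      power is the \<open>p\<close>-th power of \<open>c [^] (t div p)\<close>.\<close>
    obtain p where p: "Factorial_Ring.prime p" "p dvd t"
      using t(2) prime_factor_nat[of t] by auto
    have "(c [^] (t div p)) [^] p = c [^] t"
      using p(2) nat_pow_pow[OF K_carrier[OF c], of "t div p" p] by simp
    then show "c [^] t \<noteq> y [^] N"
      using * p dvd_trans[OF p(2) t(1)] K_pow_closed[OF c, of "t div p"] by metis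
  qed
qed (use field_L_no_root in blast)

lemma dimension_L: "ring.dimension (R\<lparr>carrier := L\<rparr>) N K (carrier (R\<lparr>carrier := L\<rparr>))"
proof -
  have "dimension (card {..<N}) K L"
    unfolding L_def by (rule dimension_lincombs) (use pow_lin_indep y_closed in auto)
  then show ?thesis using dimension_subring[OF subring_L _ _ K_L] by simp
qed

section \<open>The automorphism group of \<open>K[y]\<close> over \<open>K\<close>\<close>

abbreviation "Gal \<equiv> aut_group (R\<lparr>carrier := L\<rparr>) K"

lemma Gal_carrier:
  "carrier Gal = {\<tau> \<in> Bij L. \<tau> \<in> ring_hom (R\<lparr>carrier := L\<rparr>) (R\<lparr>carrier := L\<rparr>) \<and> (\<forall>k\<in>K. \<tau> k = k)}"
  and Gal_mult: "\<tau> \<in> carrier Gal \<Longrightarrow> \<tau>' \<in> carrier Gal \<Longrightarrow> \<tau> \<otimes>\<^bsub>Gal\<^esub> \<tau>' = compose L \<tau> \<tau>'"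
  and Gal_one: "\<one>\<^bsub>Gal\<^esub> = (\<lambda>u\<in>L. u)"
  by (auto simp: aut_group_def BijGroup_def)

text \<open>Checked as a subgroup of all bijections of \<open>L\<close>. Inverses there are
  \<open>inv_into\<close> restricted to \<open>L\<close>, which is why the homomorphism laws appear
  below with a case for arguments outside \<open>L\<close>.\<close>

lemma group_Gal: "group Gal"
proof -
  have "subgroup (carrier Gal) (BijGroup L)"
  proof (rule group.subgroupI[OF group_BijGroup])
    show "carrier Gal \<subseteq> carrier (BijGroup L)" by (auto simp: Gal_carrier BijGroup_def)
    have "(\<lambda>u\<in>L. u) \<in> carrier Gal"
      using K_L subringE(3,6,7)[OF subring_L] by (auto simp: Gal_carrier id_Bij ring_hom_def)
    then show "carrier Gal \<noteq> {}" by blast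
  next
    fix \<tau> assume "\<tau> \<in> carrier Gal"
    then have \<tau>: "\<tau> \<in> Bij L" "\<tau> \<in> ring_hom (R\<lparr>carrier := L\<rparr>) (R\<lparr>carrier := L\<rparr>)"
      "\<And>k. k \<in> K \<Longrightarrow> \<tau> k = k"
      by (auto simp: Gal_carrier)
    note hom = ring_hom_memE[OF \<tau>(2), simplified]
    have bij: "bij_betw \<tau> L L" using \<tau>(1) by (simp add: Bij_def)
    let ?i = "inv_into L \<tau>"
    have i: "u \<in> L \<Longrightarrow> ?i u \<in> L" "u \<in> L \<Longrightarrow> \<tau> (?i u) = u" "u \<in> L \<Longrightarrow> ?i (\<tau> u) = u" for u
      using bij by (auto simp: bij_betw_def inv_into_into f_inv_into_f)
    have "(\<lambda>u\<in>L. ?i u) \<in> carrier Gal"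
      unfolding Gal_carrier
    proof (intro CollectI conjI ballI)
      show "(\<lambda>u\<in>L. ?i u) \<in> Bij L" by (rule restrict_inv_into_Bij[OF \<tau>(1)])
      show "(\<lambda>u\<in>L. ?i u) \<in> ring_hom (R\<lparr>carrier := L\<rparr>) (R\<lparr>carrier := L\<rparr>)"
      proof (rule ring_hom_memI; simp)
        show "\<And>u. u \<in> L \<Longrightarrow> ?i u \<in> L" by (rule i)
        fix u v assume uv: "u \<in> L" "v \<in> L"
        have m: "u \<otimes> v \<in> L" "u \<oplus> v \<in> L"
          using subringE(6,7)[OF subring_L uv] .
        have "u \<otimes> v = \<tau> (?i u \<otimes> ?i v)" "u \<oplus> v = \<tau> (?i u \<oplus> ?i v)"
          using hom(2,3)[OF i(1)[OF uv(1)] i(1)[OF uv(2)]] i(2)[OF uv(1)] i(2)[OF uv(2)] by simp_all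
        moreover have "?i u \<otimes> ?i v \<in> L" "?i u \<oplus> ?i v \<in> L"
          using subringE(6,7)[OF subring_L i(1)[OF uv(1)] i(1)[OF uv(2)]] .
        ultimately have "?i (u \<otimes> v) = ?i u \<otimes> ?i v" "?i (u \<oplus> v) = ?i u \<oplus> ?i v"
          using i(3) by simp_all
        then show "(u \<otimes> v \<in> L \<longrightarrow> ?i (u \<otimes> v) = ?i u \<otimes> ?i v) \<and> (u \<otimes> v \<notin> L \<longrightarrow> undefined = ?i u \<otimes> ?i v)"
          "(u \<oplus> v \<in> L \<longrightarrow> ?i (u \<oplus> v) = ?i u \<oplus> ?i v) \<and> (u \<oplus> v \<notin> L \<longrightarrow> undefined = ?i u \<oplus> ?i v)"
          using m by simp_all
      next
        have "\<one> \<in> L" by (rule subringE(3)[OF subring_L])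
        then show "(\<one> \<in> L \<longrightarrow> ?i \<one> = \<one>) \<and> (\<one> \<notin> L \<longrightarrow> undefined = \<one>)"
          using i(3)[of \<one>] hom(4) by simp
      qed
      show "(\<lambda>u\<in>L. ?i u) k = k" if "k \<in> K" for k
        using subsetD[OF K_L that] i(3)[OF subsetD[OF K_L that]] \<tau>(3)[OF that] by simp
    qed
    then show "inv\<^bsub>BijGroup L\<^esub> \<tau> \<in> carrier Gal" by (simp only: inv_BijGroup[OF \<tau>(1)])
    fix \<tau>' assume "\<tau>' \<in> carrier Gal"
    then have \<tau>': "\<tau>' \<in> Bij L" "\<tau>' \<in> ring_hom (R\<lparr>carrier := L\<rparr>) (R\<lparr>carrier := L\<rparr>)"
      "\<And>k. k \<in> K \<Longrightarrow> \<tau>' k = k"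
      by (auto simp: Gal_carrier)
    note hom' = ring_hom_memE[OF \<tau>'(2), simplified]
    have "compose L \<tau> \<tau>' \<in> carrier Gal"
      unfolding Gal_carrier
    proof (intro CollectI conjI ballI)
      show "compose L \<tau> \<tau>' \<in> Bij L" by (rule compose_Bij[OF \<tau>(1) \<tau>'(1)])
      show "compose L \<tau> \<tau>' \<in> ring_hom (R\<lparr>carrier := L\<rparr>) (R\<lparr>carrier := L\<rparr>)"
      proof (rule ring_hom_memI)
        fix u v assume "u \<in> carrier (R\<lparr>carrier := L\<rparr>)" "v \<in> carrier (R\<lparr>carrier := L\<rparr>)"
        then have uv: "u \<in> L" "v \<in> L" by simp_all
        then show "compose L \<tau> \<tau>' u \<in> carrier (R\<lparr>carrier := L\<rparr>)"
          using hom(1) hom'(1) by (simp add: compose_def)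
        show "compose L \<tau> \<tau>' (u \<otimes>\<^bsub>R\<lparr>carrier := L\<rparr>\<^esub> v) =
            compose L \<tau> \<tau>' u \<otimes>\<^bsub>R\<lparr>carrier := L\<rparr>\<^esub> compose L \<tau> \<tau>' v"
          "compose L \<tau> \<tau>' (u \<oplus>\<^bsub>R\<lparr>carrier := L\<rparr>\<^esub> v) =
            compose L \<tau> \<tau>' u \<oplus>\<^bsub>R\<lparr>carrier := L\<rparr>\<^esub> compose L \<tau> \<tau>' v"
          using uv hom hom' subringE(6,7)[OF subring_L uv] by (simp_all add: compose_def)
      qed (use hom hom' subringE(3)[OF subring_L] in \<open>simp add: compose_def\<close>)
      show "compose L \<tau> \<tau>' k = k" if "k \<in> K" for k
        using subsetD[OF K_L that] \<tau>(3)[OF that] \<tau>'(3)[OF that] by (simp add: compose_def)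
    qed
    then show "\<tau> \<otimes>\<^bsub>BijGroup L\<^esub> \<tau>' \<in> carrier Gal"
      using \<tau>(1) \<tau>'(1) by (simp add: BijGroup_def)
  qed
  then have "group (BijGroup L\<lparr>carrier := carrier Gal\<rparr>)"
    by (rule subgroup.subgroup_is_group[OF _ group_BijGroup])
  moreover have "BijGroup L\<lparr>carrier := carrier Gal\<rparr> = Gal"
    by (simp add: aut_group_def BijGroup_def)
  ultimately show ?thesis by simp
qed

lemma Gal_hom:
  assumes "\<tau> \<in> carrier Gal"
  shows "u \<in> L \<Longrightarrow> \<tau> u \<in> L" "u \<in> L \<Longrightarrow> v \<in> L \<Longrightarrow> \<tau> (u \<otimes> v) = \<tau> u \<otimes> \<tau> v"
    "u \<in> L \<Longrightarrow> v \<in> L \<Longrightarrow> \<tau> (u \<oplus> v) = \<tau> u \<oplus> \<tau> v" "k \<in> K \<Longrightarrow> \<tau> k = k"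
  using assms ring_hom_memE[of \<tau> "R\<lparr>carrier := L\<rparr>" "R\<lparr>carrier := L\<rparr>"] by (auto simp: Gal_carrier)

text \<open>The elements on which two automorphisms agree form a subring containing \<open>K\<close>
  and \<open>y\<close>, hence all of \<open>L\<close>; outside \<open>L\<close> extensionality gives
  both the same default value.\<close>

lemma Gal_eqI:
  assumes \<tau>: "\<tau> \<in> carrier Gal" and \<tau>': "\<tau>' \<in> carrier Gal" and eq: "\<tau> y = \<tau>' y"
  shows "\<tau> = \<tau>'"
proof -
  let ?V = "{u \<in> L. \<tau> u = \<tau>' u}"
  have "subring ?V R"
  proof (rule subringI)
    show "?V \<subseteq> carrier R" using L_carrier by auto
    show "\<one> \<in> ?V"
      using Gal_hom(4)[OF \<tau> K_closed(2)] Gal_hom(4)[OF \<tau>' K_closed(2)] subringE(3)[OF subring_L] by simp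
    fix u v assume "u \<in> ?V" "v \<in> ?V"
    then have uv: "u \<in> L" "v \<in> L" "\<tau> u = \<tau>' u" "\<tau> v = \<tau>' v" by auto
    then show "u \<otimes> v \<in> ?V" "u \<oplus> v \<in> ?V"
      using Gal_hom(2,3)[OF \<tau> uv(1,2)] Gal_hom(2,3)[OF \<tau>' uv(1,2)] subringE(6,7)[OF subring_L uv(1,2)]
      by auto
  next
    fix u assume "u \<in> ?V"
    then have u: "u \<in> L" "\<tau> u = \<tau>' u" by auto
    have m: "\<ominus> \<one> \<in> K" "\<ominus> \<one> \<in> L" using K_closed(2,3) K_L by auto
    have "\<ominus> u = \<ominus> \<one> \<otimes> u" using L_carrier[OF u(1)] by (simp add: l_minus)
    then show "\<ominus> u \<in> ?V"
      using Gal_hom(2)[OF \<tau> m(2) u(1)] Gal_hom(2)[OF \<tau>' m(2) u(1)] Gal_hom(4)[OF \<tau> m(1)]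
        Gal_hom(4)[OF \<tau>' m(1)] u(2) subringE(6)[OF subring_L m(2) u(1)] by simp
  qed
  moreover have "K \<union> {y} \<subseteq> ?V"
    using K_L y_in_L eq Gal_hom(4)[OF \<tau>] Gal_hom(4)[OF \<tau>'] by auto
  ultimately have "L \<subseteq> ?V"
    using generate_ring_min_subring1[of "K \<union> {y}" ?V] y_closed generate_L by auto
  then have "\<tau> u = \<tau>' u" if "u \<in> L" for u using that by auto
  then show ?thesis
    using \<tau> \<tau>' by (intro extensionalityI[of \<tau> L \<tau>']) (auto simp: Gal_carrier Bij_def)
qed

lemma T_in_Gal: "(\<lambda>u\<in>L. T j u) \<in> carrier Gal"
  unfolding Gal_carrier
proof (intro CollectI conjI ballI)
  have T0: "T (N * i) u = u" if "u \<in> L" for u i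
  proof (induction i)
    case 0
    then show ?case using L_carrier[OF that] by (simp add: T_def conj_by_def)
  next
    case (Suc i)
    have "T (N * Suc i) u = T N (T (N * i) u)" using T_T[OF L_carrier[OF that]] by simp
    then show ?case using Suc T_N[OF that] by simp
  qed
  have N: "(N - 1) * j + j = N * j" using N_pos by (cases N) auto
  have "bij_betw (T j) L L"
  proof (rule bij_betw_byWitness[where f' = "T ((N - 1) * j)"])
    show "\<forall>u\<in>L. T ((N - 1) * j) (T j u) = u" "\<forall>u\<in>L. T j (T ((N - 1) * j) u) = u"
      using T_T L_carrier T0[of _ j] N by (auto simp: add.commute)
    show "T j ` L \<subseteq> L" "T ((N - 1) * j) ` L \<subseteq> L" using T_L by auto
  qed
  then show "(\<lambda>u\<in>L. T j u) \<in> Bij L" by (simp add: Bij_def)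
  show "(\<lambda>u\<in>L. T j u) \<in> ring_hom (R\<lparr>carrier := L\<rparr>) (R\<lparr>carrier := L\<rparr>)"
    using T_L T_lin(2,4) L_carrier subringE(3,6,7)[OF subring_L] by (intro ring_hom_memI) auto
  show "(\<lambda>u\<in>L. T j u) k = k" if "k \<in> K" for k
    using subsetD[OF K_L that] T_K[OF that] by simp
qed

lemma T_pow_Gal: "(\<lambda>u\<in>L. T 1 u) [^]\<^bsub>Gal\<^esub> j = (\<lambda>u\<in>L. T j u)" for j :: nat
proof (induction j)
  case 0
  have "(\<lambda>u\<in>L. T 1 u) [^]\<^bsub>Gal\<^esub> (0::nat) = (\<lambda>u\<in>L. u)"
    using Gal_one by simp
  also have "\<dots> = (\<lambda>u\<in>L. T 0 u)"
    by (rule restrict_ext) (use L_carrier in \<open>simp add: T_def conj_by_def\<close>)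
  finally show ?case .
next
  case (Suc j)
  have "(\<lambda>u\<in>L. T 1 u) [^]\<^bsub>Gal\<^esub> Suc j = (\<lambda>u\<in>L. T 1 u) [^]\<^bsub>Gal\<^esub> j \<otimes>\<^bsub>Gal\<^esub> (\<lambda>u\<in>L. T 1 u)"
    by (rule Group.nat_pow_Suc)
  also have "\<dots> = (\<lambda>u\<in>L. T j u) \<otimes>\<^bsub>Gal\<^esub> (\<lambda>u\<in>L. T 1 u)"
    unfolding Suc ..
  also have "\<dots> = (\<lambda>u\<in>L. T (Suc j) u)"
    unfolding Gal_mult[OF T_in_Gal T_in_Gal] compose_def
    by (rule restrict_ext) (use T_L T_T L_carrier in auto)
  finally show ?case .
qed

end


text \<open>The image of a field under an isomorphism is first obtained with \<open>i\<close> of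
  zero as its zero element. That \<open>S'\<close> is a ring identifies this with the zero of
  \<open>S'\<close>.\<close>

lemma field_ring_iso:
  assumes S: "field S" and i: "i \<in> ring_iso S S'" and S': "ring S'"
  shows "field S'"
proof -
  have "i \<in> ring_hom S S'" using i by (simp add: ring_iso_def)
  moreover have "ring S" using S by (simp add: field_def domain_def cring_def)
  ultimately have "i \<zero>\<^bsub>S\<^esub> = \<zero>\<^bsub>S'\<^esub>" using ring_hom_zero S' by blast
  then show ?thesis using field.ring_iso_imp_img_field[OF S i] by simp
qed

section \<open>Cyclicity of the Galois group, and irreducibility of the binomial\<close>

context quantum_pair
begin

lemma T_y: "T j y = \<omega> [^] j \<otimes> y"
  using T_pow[of j 1] y_closed by simp

lemma T_y_inj: "inj_on (\<lambda>j. T j y) {..<N}"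
proof (rule inj_onI)
  fix i j assume ij: "i \<in> {..<N}" "j \<in> {..<N}" "T i y = T j y"
  have "\<omega> [^] k = (\<omega> [^] k \<otimes> y) \<otimes> inv y" for k :: nat
    using \<omega>_K y_Unit y_closed by (simp add: m_assoc)
  then have "\<omega> [^] i = \<omega> [^] j" using ij(3) unfolding T_y by metis
  then show "i = j" using \<omega>_pow_inj ij by simp
qed

lemma Gal_pow:
  fixes i :: nat
  assumes "\<tau> \<in> carrier Gal"
  shows "\<tau> (y [^] i) = \<tau> y [^] i"
proof (induction i)
  case 0
  show ?case using Gal_hom(4)[OF assms K_closed(2)] by simp
next
  case (Suc i)
  then show ?case using Gal_hom(2)[OF assms pow_in_L[of i] y_in_L] by simp
qed

text \<open>The image of \<open>y\<close> is again an \<open>N\<close>-th root of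
  \<open>y [^] N\<close>. The elements \<open>T j y\<close> with \<open>j < N\<close> are already
  \<open>N\<close> distinct roots, and a field has no room for another.\<close>

lemma Gal_orbit:
  assumes L: "field (R\<lparr>carrier := L\<rparr>)" and \<tau>: "\<tau> \<in> carrier Gal"
  obtains j where "j < N" "\<tau> y = T j y"
proof -
  have "\<tau> y \<in> (\<lambda>j. T j y) ` {..<N}"
  proof (rule ccontr)
    assume new: "\<tau> y \<notin> (\<lambda>j. T j y) ` {..<N}"
    let ?S = "insert (\<tau> y) ((\<lambda>j. T j y) ` {..<N})"
    have L_pow: "u [^]\<^bsub>R\<lparr>carrier := L\<rparr>\<^esub> (i::nat) = u [^] i" for u i
      by (rule nat_pow_consistent[symmetric])
    have "\<tau> y [^] N = y [^] N"
      using Gal_pow[OF \<tau>, of N] Gal_hom(4)[OF \<tau> y_pow_N(1)] by simp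
    moreover have "T j y [^] N = y [^] N" for j
      using Gal_pow[OF T_in_Gal[of j], of N] Gal_hom(4)[OF T_in_Gal[of j] y_pow_N(1)] y_in_L pow_in_L[of N]
      by simp
    ultimately have "?S \<subseteq> {v \<in> carrier (R\<lparr>carrier := L\<rparr>). v [^]\<^bsub>R\<lparr>carrier := L\<rparr>\<^esub> N = y [^] N}"
      using Gal_hom(1)[OF \<tau> y_in_L] T_L[OF y_in_L] by (auto simp: L_pow)
    then have "card ?S \<le> N"
      by (intro field.card_radicals_le[OF L N_pos]) (use pow_in_L[of N] in auto)
    moreover have "card ?S = Suc N"
      using new card_image[OF T_y_inj] by simp
    ultimately show False by simp
  qed
  then show thesis using that by auto
qed

lemma galois_L:
  assumes L: "field (R\<lparr>carrier := L\<rparr>)"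
  shows "finite_galois_extension (R\<lparr>carrier := L\<rparr>) K"
    and "\<exists>!\<tau>. \<tau> \<in> carrier Gal \<and> \<tau> y = \<omega> \<otimes> y"
    and "\<forall>\<tau>\<in>carrier Gal. \<tau> y = \<omega> \<otimes> y \<longrightarrow> generate Gal {\<tau>} = carrier Gal \<and> group.ord Gal \<tau> = N"
    and "group Gal" and "cyclic_group Gal" and "order Gal = N"
proof -
  interpret G: group Gal by (rule group_Gal)
  let ?\<tau> = "\<lambda>j. \<lambda>u\<in>L. T j u"
  have \<omega>_y: "T 1 y = \<omega> \<otimes> y" using T_y[of 1] \<omega>_K by simp
  have \<tau>1: "?\<tau> 1 y = \<omega> \<otimes> y" using \<omega>_y y_in_L by simp
  have all: "carrier Gal = ?\<tau> ` {..<N}"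
  proof (rule subset_antisym; rule subsetI)
    fix \<tau> assume \<tau>: "\<tau> \<in> carrier Gal"
    obtain j where j: "j < N" "\<tau> y = T j y" using Gal_orbit[OF L \<tau>] .
    then have "\<tau> = ?\<tau> j" using y_in_L by (intro Gal_eqI[OF \<tau> T_in_Gal]) simp
    then show "\<tau> \<in> ?\<tau> ` {..<N}" using j(1) by blast
  next
    fix \<tau> assume "\<tau> \<in> ?\<tau> ` {..<N}"
    then show "\<tau> \<in> carrier Gal" using T_in_Gal by blast
  qed
  have inj: "inj_on ?\<tau> {..<N}"
  proof (rule inj_onI)
    fix i j assume "i \<in> {..<N}" "j \<in> {..<N}" "?\<tau> i = ?\<tau> j"
    moreover from this(3) have "?\<tau> i y = ?\<tau> j y" by (rule fun_cong)
    then have "T i y = T j y" using y_in_L by simp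
    ultimately show "i = j" using T_y_inj by (simp add: inj_on_def)
  qed
  have card: "card (carrier Gal) = N"
    unfolding all using card_image[OF inj] by simp
  have fin: "finite (carrier Gal)" unfolding all by simp
  have uniq: "\<tau> = ?\<tau> 1" if "\<tau> \<in> carrier Gal" "\<tau> y = \<omega> \<otimes> y" for \<tau>
    using that \<tau>1 by (intro Gal_eqI[OF _ T_in_Gal]) auto
  show "\<exists>!\<tau>. \<tau> \<in> carrier Gal \<and> \<tau> y = \<omega> \<otimes> y"
    using T_in_Gal[of 1] \<tau>1 uniq by blast
  have gen: "generate Gal {?\<tau> 1} = carrier Gal"
  proof -
    have "generate Gal {?\<tau> 1} = {?\<tau> 1 [^]\<^bsub>Gal\<^esub> k | k. k \<in> (UNIV :: nat set)}"
      by (rule G.generate_pow_on_finite_carrier[OF fin T_in_Gal])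
    also have "\<dots> = range ?\<tau>" unfolding T_pow_Gal by auto
    finally show ?thesis using all T_in_Gal by auto
  qed
  have ord: "G.ord (?\<tau> 1) = N"
    using G.generate_pow_card[OF T_in_Gal, of 1] card unfolding gen by simp
  show "\<forall>\<tau>\<in>carrier Gal. \<tau> y = \<omega> \<otimes> y \<longrightarrow> generate Gal {\<tau>} = carrier Gal \<and> group.ord Gal \<tau> = N"
    using uniq gen ord by auto
  show "group Gal" by (rule group_Gal)
  show "order Gal = N" using card by (simp add: order_def)
  have "carrier Gal = range (\<lambda>k::int. ?\<tau> 1 [^]\<^bsub>Gal\<^esub> k)"
  proof (rule subset_antisym; rule subsetI)
    fix \<tau> assume "\<tau> \<in> carrier Gal"
    then obtain j where "\<tau> = ?\<tau> j" using all by blast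
    then have "\<tau> = ?\<tau> 1 [^]\<^bsub>Gal\<^esub> int j" using T_pow_Gal[of j] by (simp add: int_pow_int)
    then show "\<tau> \<in> range (\<lambda>k::int. ?\<tau> 1 [^]\<^bsub>Gal\<^esub> k)" by blast
  next
    fix \<tau> assume "\<tau> \<in> range (\<lambda>k::int. ?\<tau> 1 [^]\<^bsub>Gal\<^esub> k)"
    then show "\<tau> \<in> carrier Gal" using G.int_pow_closed[OF T_in_Gal[of 1]] by blast
  qed
  then show "cyclic_group Gal"
    unfolding G.cyclic_group using T_in_Gal[of 1] by blast
  show "finite_galois_extension (R\<lparr>carrier := L\<rparr>) K"
    unfolding finite_galois_extension_def
  proof (intro conjI exI)
    show "field (R\<lparr>carrier := L\<rparr>)" by (rule L)
    show "subfield K (R\<lparr>carrier := L\<rparr>)" by (rule subfield_of_subring[OF subring_L K_L])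
    show "ring.dimension (R\<lparr>carrier := L\<rparr>) N K (carrier (R\<lparr>carrier := L\<rparr>))" by (rule dimension_L)
    show "{u \<in> carrier (R\<lparr>carrier := L\<rparr>). \<forall>\<tau>\<in>carrier Gal. \<tau> u = u} = K"
    proof (rule subset_antisym; rule subsetI)
      fix u assume "u \<in> {u \<in> carrier (R\<lparr>carrier := L\<rparr>). \<forall>\<tau>\<in>carrier Gal. \<tau> u = u}"
      then have u: "u \<in> L" "?\<tau> 1 u = u" using T_in_Gal[of 1] by auto
      then show "u \<in> K" using L_fixed[OF u(1)] by simp
    next
      fix u assume "u \<in> K"
      then show "u \<in> {u \<in> carrier (R\<lparr>carrier := L\<rparr>). \<forall>\<tau>\<in>carrier Gal. \<tau> u = u}"
        using K_L Gal_hom(4) by auto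
    qed
  qed
qed

text \<open>Independence of the powers of \<open>y\<close> in the language of coefficient lists: no
  nonzero polynomial of degree below \<open>N\<close> over \<open>K\<close> vanishes at
  \<open>y\<close>.\<close>

lemma eval_zero_imp_zero:
  assumes "set l \<subseteq> K" "length l \<le> N" "eval l y = \<zero>"
  shows "set l \<subseteq> {\<zero>}"
proof -
  \<comment> \<open>Lists start with the leading coefficient, so the coefficient of
    \<open>y [^] i\<close> sits at position \<open>length l - 1 - i\<close>.\<close>
  have sum: "eval l y = (\<Oplus>i\<in>{..<length l}. l ! (length l - 1 - i) \<otimes> y [^] i)" if "set l \<subseteq> K" for l
    using that
  proof (induction l)
    case (Cons b l)
    let ?f = "\<lambda>i. (b # l) ! (length l - i) \<otimes> y [^] i"
    have mem: "(b # l) ! (length l - i) \<in> K" for i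
    proof -
      have "(b # l) ! (length l - i) \<in> set (b # l)" by (rule nth_mem) simp
      then show ?thesis using Cons.prems by blast
    qed
    have "(\<Oplus>i\<in>{..<Suc (length l)}. ?f i) = ?f (length l) \<oplus> (\<Oplus>i\<in>{..<length l}. ?f i)"
      unfolding lessThan_Suc by (rule finsum_insert) (use mem Cons.prems y_closed in auto)
    also have "(\<Oplus>i\<in>{..<length l}. ?f i) = (\<Oplus>i\<in>{..<length l}. l ! (length l - 1 - i) \<otimes> y [^] i)"
    proof (rule finsum_cong')
      fix i assume "i \<in> {..<length l}"
      then have "length l - i = Suc (length l - 1 - i)" by auto
      then show "?f i = l ! (length l - 1 - i) \<otimes> y [^] i" by simp
    next
      have "l ! (length l - 1 - i) \<in> K" if "i < length l" for i
        using nth_mem[of "length l - 1 - i" l] Cons.prems that by auto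
      then show "(\<lambda>i. l ! (length l - 1 - i) \<otimes> y [^] i) \<in> {..<length l} \<rightarrow> carrier R"
        using y_closed by auto
    qed simp
    finally show ?case using Cons by simp
  qed simp
  \<comment> \<open>The coefficients are padded with zeros up to \<open>N\<close>, the index set of
    \<open>pow_lin_indep\<close>.\<close>
  let ?c = "\<lambda>i. if i < length l then l ! (length l - 1 - i) else \<zero>"
  have nth: "l ! (length l - 1 - i) \<in> K" if "i < length l" for i
    using nth_mem[of "length l - 1 - i" l] assms(1) that by auto
  have "(\<Oplus>i\<in>{..<N}. ?c i \<otimes> y [^] i) = (\<Oplus>i\<in>{..<length l}. l ! (length l - 1 - i) \<otimes> y [^] i)"
    by (rule add.finprod_mono_neutral_cong_right) (use assms(2) nth y_closed in auto)
  then have "(\<Oplus>i\<in>{..<N}. ?c i \<otimes> y [^] i) = \<zero>" using sum[OF assms(1)] assms(3) by simp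
  moreover have "?c \<in> {..<N} \<rightarrow> K" using nth by auto
  ultimately have "\<forall>i\<in>{..<N}. ?c i = \<zero>"
    by (intro mp[OF bspec[OF pow_lin_indep[unfolded lin_indep_def], of ?c]])
  then have c0: "?c i = \<zero>" if "i < N" for i
    using that by blast
  show ?thesis
  proof
    fix b assume "b \<in> set l"
    then obtain j where j: "j < length l" "b = l ! j" by (auto simp: in_set_conv_nth)
    then have "?c (length l - 1 - j) = b" by auto
    then show "b \<in> {\<zero>}" using c0[of "length l - 1 - j"] j assms(2) by auto
  qed
qed

text \<open>Evaluation at \<open>y\<close> maps \<open>F[z]\<close> onto \<open>L\<close>. Its
  kernel is generated by the binomial: division leaves a remainder of degree below \<open>N\<close>
  that vanishes at \<open>y\<close>, hence is zero. So \<open>L\<close> is the quotient by the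
  binomial, a field exactly when the binomial is irreducible. The polynomials live over
  \<open>F\<close> and the scalars in \<open>R\<close>, hence the detour through
  \<open>\<iota>\<close>.\<close>

lemma pirreducible_iff_field_L:
  fixes F :: "('c, 'd) ring_scheme"
  assumes F: "field F" and \<iota>: "\<iota> \<in> ring_hom F R" "\<iota> ` carrier F = K"
    and s: "s \<in> carrier F" "\<iota> s = y [^] N"
  shows "pirreducible\<^bsub>F\<^esub> (carrier F) (binomial_poly F N s) \<longleftrightarrow> field (R\<lparr>carrier := L\<rparr>)"
proof -
  interpret F: field F by (rule F)
  interpret L: cring "R\<lparr>carrier := L\<rparr>" by (rule cring_L)
  interpret P: cring "poly_ring F" by (rule F.univ_poly_is_cring[OF F.carrier_is_subring])
  let ?Lr = "R\<lparr>carrier := L\<rparr>" and ?f = "binomial_poly F N s"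
  note hom = ring_hom_memE[OF \<iota>(1)]
  have \<iota>K: "\<iota> c \<in> K" if "c \<in> carrier F" for c using \<iota>(2) that by blast
  have \<iota>_hom: "\<iota> \<in> ring_hom F ?Lr"
    using hom \<iota>K K_L by (intro ring_hom_memI) auto
  interpret \<iota>: ring_hom_ring F ?Lr \<iota>
    by (rule ring_hom_ringI2[OF F.ring_axioms L.ring_axioms \<iota>_hom])
  have \<iota>0: "c = \<zero>\<^bsub>F\<^esub>" if "c \<in> carrier F" "\<iota> c = \<zero>" for c
  proof (rule ccontr)
    assume "c \<noteq> \<zero>\<^bsub>F\<^esub>"
    then have "c \<otimes>\<^bsub>F\<^esub> inv\<^bsub>F\<^esub> c = \<one>\<^bsub>F\<^esub>" "inv\<^bsub>F\<^esub> c \<in> carrier F"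
      using that(1) F.field_Units by auto
    then have "\<iota> c \<otimes> \<iota> (inv\<^bsub>F\<^esub> c) = \<one>" using hom(2)[OF that(1)] hom(4) by metis
    then show False
      using that(2) hom(1)[OF \<open>inv\<^bsub>F\<^esub> c \<in> carrier F\<close>] one_neq_zero by simp
  qed
  define \<Phi> where "\<Phi> = (\<lambda>p. eval (map \<iota> p) y)"
  have poly: "set p \<subseteq> carrier F" if "p \<in> carrier (poly_ring F)" for p
    using that F.polynomial_incl unfolding univ_poly_carrier[symmetric] by blast
  have mapL: "set (map \<iota> p) \<subseteq> L" "set (map \<iota> p) \<subseteq> K" if "p \<in> carrier (poly_ring F)" for p
    using poly[OF that] \<iota>K K_L by auto
  have eval_L: "L.eval = eval" by (rule eval_consistent[OF subring_L])
  have add': "set (F.poly_add p q) \<subseteq> carrier F" "set (F.poly_mult p q) \<subseteq> carrier F"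
    if "p \<in> carrier (poly_ring F)" "q \<in> carrier (poly_ring F)" for p q
    using F.poly_add_in_carrier[OF poly[OF that(1)] poly[OF that(2)]]
      F.poly_mult_in_carrier[OF poly[OF that(1)] poly[OF that(2)]] .
  have \<Phi>_hom: "\<Phi> \<in> ring_hom (poly_ring F) ?Lr"
  proof (rule ring_hom_memI)
    fix p q assume pq: "p \<in> carrier (poly_ring F)" "q \<in> carrier (poly_ring F)"
    show "\<Phi> p \<in> carrier ?Lr"
      unfolding \<Phi>_def eval_L[symmetric] by (rule L.eval_in_carrier) (use mapL(1)[OF pq(1)] y_in_L in auto)
    note norm = L.eval_normalize[of "map \<iota> r" y for r, simplified]
    \<comment> \<open>The operations on coefficient lists commute with \<open>map \<iota>\<close>
      only up to stripping leading zeros, which evaluation does not notice.\<close>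
    have "L.eval (map \<iota> (F.poly_mult p q)) y = L.eval (L.normalize (map \<iota> (F.poly_mult p q))) y"
      by (rule L.eval_normalize[symmetric]) (use add'(2)[OF pq] \<iota>.hom_closed y_in_L in auto)
    also have "\<dots> = L.eval (map \<iota> p) y \<otimes> L.eval (map \<iota> q) y"
      unfolding \<iota>.poly_mult_hom'[OF poly[OF pq(1)] poly[OF pq(2)]]
      using L.eval_poly_mult[of "map \<iota> p" "map \<iota> q" y] mapL(1)[OF pq(1)] mapL(1)[OF pq(2)] y_in_L by simp
    finally show "\<Phi> (p \<otimes>\<^bsub>poly_ring F\<^esub> q) = \<Phi> p \<otimes>\<^bsub>?Lr\<^esub> \<Phi> q"
      unfolding \<Phi>_def univ_poly_mult eval_L by simp
    have "L.eval (map \<iota> (F.poly_add p q)) y = L.eval (L.normalize (map \<iota> (F.poly_add p q))) y"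
      by (rule L.eval_normalize[symmetric]) (use add'(1)[OF pq] \<iota>.hom_closed y_in_L in auto)
    also have "\<dots> = L.eval (map \<iota> p) y \<oplus> L.eval (map \<iota> q) y"
      unfolding \<iota>.poly_add_hom'[OF poly[OF pq(1)] poly[OF pq(2)]]
      using L.eval_poly_add[of "map \<iota> p" "map \<iota> q" y] mapL(1)[OF pq(1)] mapL(1)[OF pq(2)] y_in_L by simp
    finally show "\<Phi> (p \<oplus>\<^bsub>poly_ring F\<^esub> q) = \<Phi> p \<oplus>\<^bsub>?Lr\<^esub> \<Phi> q"
      unfolding \<Phi>_def univ_poly_add eval_L by simp
  next
    show "\<Phi> \<one>\<^bsub>poly_ring F\<^esub> = \<one>\<^bsub>?Lr\<^esub>"
      using hom(4) y_closed by (simp add: \<Phi>_def univ_poly_one)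
  qed
  interpret \<Phi>: ring_hom_ring "poly_ring F" ?Lr \<Phi>
    by (rule ring_hom_ringI2[OF P.ring_axioms L.ring_axioms \<Phi>_hom])
  have X: "X\<^bsub>F\<^esub> \<in> carrier (poly_ring F)"
    by (rule F.var_closed(1)[OF F.carrier_is_subring])
  have Xn: "X\<^bsub>F\<^esub> [^]\<^bsub>poly_ring F\<^esub> N \<in> carrier (poly_ring F)" using X by simp
  have sP: "F.poly_of_const s \<in> carrier (poly_ring F)"
    using ring_hom_memE(1)[OF F.canonical_embedding_is_hom[OF F.carrier_is_subring]] s(1) by simp
  have fP: "?f \<in> carrier (poly_ring F)"
    unfolding binomial_poly_def using Xn sP by simp
  have \<Phi>X: "\<Phi> X\<^bsub>F\<^esub> = y"
    using hom(4) \<iota>.hom_zero y_closed by (simp add: \<Phi>_def var_def)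
  have \<Phi>c: "\<Phi> (F.poly_of_const c) = \<iota> c" if "c \<in> carrier F" for c
    using that \<iota>.hom_zero hom(1)[OF that] y_closed
    by (auto simp: \<Phi>_def F.poly_of_const_def)
  have \<Phi>f: "\<Phi> ?f = \<zero>"
  proof -
    have "\<Phi> (X\<^bsub>F\<^esub> [^]\<^bsub>poly_ring F\<^esub> N) = y [^] N"
      using \<Phi>.hom_nat_pow[OF X, of N] \<Phi>X nat_pow_consistent[of y N L] by simp
    then have "\<Phi> ?f = y [^] N \<ominus>\<^bsub>?Lr\<^esub> y [^] N"
      unfolding binomial_poly_def P.minus_eq L.minus_eq
      using Xn sP \<Phi>c[OF s(1)] s(2) by simp
    then show ?thesis using L.r_neg[of "y [^] N"] pow_in_L[of N] by (simp add: L.minus_eq)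
  qed
  have deg: "degree ?f = N"
  proof -
    have mono: "X\<^bsub>F\<^esub> [^]\<^bsub>poly_ring F\<^esub> N = \<one>\<^bsub>F\<^esub> # replicate N \<zero>\<^bsub>F\<^esub>"
      using F.unitary_monom_eq_var_pow[OF F.carrier_is_subring, of N] by (simp add: F.monom_def)
    have "degree (\<ominus>\<^bsub>poly_ring F\<^esub> F.poly_of_const s) = 0"
      using F.univ_poly_a_inv_degree[OF F.carrier_is_subring sP] by (simp add: F.poly_of_const_def)
    moreover have "\<ominus>\<^bsub>poly_ring F\<^esub> F.poly_of_const s \<in> carrier (poly_ring F)" using sP by simp
    ultimately have "degree (F.poly_add (X\<^bsub>F\<^esub> [^]\<^bsub>poly_ring F\<^esub> N) (\<ominus>\<^bsub>poly_ring F\<^esub> F.poly_of_const s)) = N"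
      using F.poly_add_degree_eq[OF F.carrier_is_subring, of "X\<^bsub>F\<^esub> [^]\<^bsub>poly_ring F\<^esub> N" "\<ominus>\<^bsub>poly_ring F\<^esub> F.poly_of_const s"]
        Xn N_pos unfolding univ_poly_carrier mono by simp
    then show ?thesis unfolding binomial_poly_def a_minus_def univ_poly_add .
  qed
  have f0: "?f \<noteq> \<zero>\<^bsub>poly_ring F\<^esub>" using deg N_pos by (auto simp: univ_poly_zero)
  have ker: "a_kernel (poly_ring F) ?Lr \<Phi> = PIdl\<^bsub>poly_ring F\<^esub> ?f"
  proof (rule subset_antisym)
    have "\<Phi> ?f = \<zero>\<^bsub>?Lr\<^esub>" using \<Phi>f by simp
    then have "?f \<in> a_kernel (poly_ring F) ?Lr \<Phi>"
      unfolding a_kernel_def' using fP by (intro CollectI conjI)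
    then show "PIdl\<^bsub>poly_ring F\<^esub> ?f \<subseteq> a_kernel (poly_ring F) ?Lr \<Phi>"
      by (rule P.cgenideal_minimal[OF \<Phi>.kernel_is_ideal])
    show "a_kernel (poly_ring F) ?Lr \<Phi> \<subseteq> PIdl\<^bsub>poly_ring F\<^esub> ?f"
    proof
      fix g assume "g \<in> a_kernel (poly_ring F) ?Lr \<Phi>"
      then have g': "g \<in> carrier (poly_ring F) \<and> \<Phi> g = \<zero>\<^bsub>?Lr\<^esub>"
        unfolding a_kernel_def' by (rule CollectD)
      then have g: "g \<in> carrier (poly_ring F)" "\<Phi> g = \<zero>" by simp_all
      obtain u r where ur: "u \<in> carrier (poly_ring F)" "r \<in> carrier (poly_ring F)"
        "g = ?f \<otimes>\<^bsub>poly_ring F\<^esub> u \<oplus>\<^bsub>poly_ring F\<^esub> r" "r = \<zero>\<^bsub>poly_ring F\<^esub> \<or> degree r < degree ?f"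
        using F.subfield_long_division_theorem_shell[OF F.carrier_is_subfield g(1) fP f0]
        by (elim exE conjE)
      have c: "\<Phi> u \<in> carrier R" "\<Phi> r \<in> carrier R"
        using L_carrier \<Phi>.hom_closed[OF ur(1)] \<Phi>.hom_closed[OF ur(2)] by simp_all
      have "\<Phi> g = \<Phi> ?f \<otimes> \<Phi> u \<oplus> \<Phi> r"
        unfolding ur(3) \<Phi>.hom_add[OF P.m_closed[OF fP ur(1)] ur(2)] \<Phi>.hom_mult[OF fP ur(1)] by simp
      then have \<Phi>r: "\<Phi> r = \<zero>" using g(2) \<Phi>f c by simp
      have "r = []"
      proof (rule ccontr)
        assume r: "r \<noteq> []"
        then have "length (map \<iota> r) \<le> N" using ur(4) deg by (auto simp: univ_poly_zero)
        then have "set (map \<iota> r) \<subseteq> {\<zero>}"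
          using eval_zero_imp_zero[OF mapL(2)[OF ur(2)]] \<Phi>r by (simp add: \<Phi>_def)
        \<comment> \<open>A nonempty list in the polynomial ring has a nonzero leading coefficient,
          so it is enough to show that this coefficient vanishes.\<close>
        then have "\<iota> (hd r) = \<zero>" using hd_in_set[OF r] by auto
        then have "hd r = \<zero>\<^bsub>F\<^esub>" using \<iota>0[OF subsetD[OF poly[OF ur(2)] hd_in_set[OF r]]] by simp
        then show False using ur(2) r unfolding univ_poly_carrier[symmetric] polynomial_def by simp
      qed
      then have "g = ?f \<otimes>\<^bsub>poly_ring F\<^esub> u"
        using ur(3) P.r_zero[OF P.m_closed[OF fP ur(1)]] unfolding univ_poly_zero by simp
      then have "g = u \<otimes>\<^bsub>poly_ring F\<^esub> ?f" using P.m_comm[OF fP ur(1)] by simp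
      then show "g \<in> PIdl\<^bsub>poly_ring F\<^esub> ?f" using ur(1) unfolding cgenideal_def by blast
    qed
  qed
  have "subring (\<Phi> ` carrier (poly_ring F)) R"
  proof (rule ring_incl_imp_subring)
    show "\<Phi> ` carrier (poly_ring F) \<subseteq> carrier R" using \<Phi>.hom_closed L_carrier by auto
    show "ring (R\<lparr>carrier := \<Phi> ` carrier (poly_ring F)\<rparr>)" using \<Phi>.img_is_ring by simp
  qed
  moreover have "K \<union> {y} \<subseteq> \<Phi> ` carrier (poly_ring F)"
  proof
    fix u assume "u \<in> K \<union> {y}"
    then show "u \<in> \<Phi> ` carrier (poly_ring F)"
    proof
      assume "u \<in> K"
      then obtain c where c: "c \<in> carrier F" "u = \<iota> c" using \<iota>(2) by blast
      then have "F.poly_of_const c \<in> carrier (poly_ring F)"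
        using ring_hom_memE(1)[OF F.canonical_embedding_is_hom[OF F.carrier_is_subring]] by simp
      then show ?thesis using \<Phi>c[OF c(1)] c(2) by (metis imageI)
    next
      assume "u \<in> {y}"
      then show ?thesis using \<Phi>X X by (metis imageI singletonD)
    qed
  qed
  ultimately have "L \<subseteq> \<Phi> ` carrier (poly_ring F)"
    using generate_ring_min_subring1[of "K \<union> {y}"] y_closed generate_L by auto
  then have "\<Phi> ` carrier (poly_ring F) = carrier ?Lr"
    using \<Phi>.hom_closed by auto
  then have iso: "(\<lambda>V. the_elem (\<Phi> ` V)) \<in> ring_iso (Rupt\<^bsub>F\<^esub> (carrier F) ?f) ?Lr"
    using \<Phi>.FactRing_iso_set unfolding ker rupture_def by blast
  have RR: "ring (Rupt\<^bsub>F\<^esub> (carrier F) ?f)"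
    unfolding rupture_def by (rule ideal.quotient_is_ring[OF P.cgenideal_ideal[OF fP]])
  have "field (Rupt\<^bsub>F\<^esub> (carrier F) ?f) \<longleftrightarrow> field ?Lr"
    using field_ring_iso[OF _ iso L.ring_axioms] field_ring_iso[OF _ ring_iso_set_sym[OF RR iso] RR] by blast
  then show ?thesis
    using F.rupture_is_field_iff_pirreducible[OF F.carrier_is_subfield fP] by simp
qed

end


section \<open>Internal tensor products\<close>

text \<open>The ring need not be commutative, so the order of the factors is fixed by the recursion.
  The index starts at 1, matching \<open>{1..d}\<close>.\<close>

primrec (in ring) iprod :: "nat \<Rightarrow> (nat \<Rightarrow> 'a) \<Rightarrow> 'a" where
  "iprod 0 u = \<one>"
| "iprod (Suc k) u = iprod k u \<otimes> u (Suc k)"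

lemma (in ring) iprod_closed: "(\<And>i. i \<in> {1..k} \<Longrightarrow> u i \<in> carrier R) \<Longrightarrow> iprod k u \<in> carrier R"
  by (induction k) auto

lemma (in ring) iprod_cong: "(\<And>i. i \<in> {1..k} \<Longrightarrow> u i = v i) \<Longrightarrow> iprod k u = iprod k v"
  by (induction k) auto

lemma (in ring) iprod_one: "iprod k (\<lambda>i. \<one>) = \<one>"
  by (induction k) auto

text \<open>The factors before and after position \<open>i\<close> are collected in \<open>l\<close>
  and \<open>r\<close>, the same for all \<open>y\<close>. This makes the product linear in each
  entry, as the relations of the tensor product demand.\<close>

lemma (in ring) iprod_split:
  assumes "i \<in> {1..k}" "\<And>j. j \<in> {1..k} \<Longrightarrow> u j \<in> carrier R"
  shows "\<exists>l\<in>carrier R. \<exists>r\<in>carrier R. \<forall>y\<in>carrier R. iprod k (u(i := y)) = l \<otimes> y \<otimes> r"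
  using assms
proof (induction k)
  case (Suc k)
  show ?case
  proof (cases "i = Suc k")
    case True
    have c: "iprod k u \<in> carrier R" by (rule iprod_closed) (use Suc.prems(2) in simp)
    have "iprod k (u(i := y)) = iprod k u" for y
      using True by (intro iprod_cong) auto
    then have "\<forall>y\<in>carrier R. iprod (Suc k) (u(i := y)) = iprod k u \<otimes> y \<otimes> \<one>"
      using True c by simp
    then show ?thesis by (rule bexI[OF bexI[OF _ one_closed] c])
  next
    case False
    then have "\<exists>l\<in>carrier R. \<exists>r\<in>carrier R. \<forall>y\<in>carrier R. iprod k (u(i := y)) = l \<otimes> y \<otimes> r"
      using Suc.prems by (intro Suc.IH) auto
    then obtain l r where lr: "l \<in> carrier R" "r \<in> carrier R"
      "\<forall>y\<in>carrier R. iprod k (u(i := y)) = l \<otimes> y \<otimes> r"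
      by blast
    have s: "u (Suc k) \<in> carrier R" using Suc.prems(2) by auto
    have "\<forall>y\<in>carrier R. iprod (Suc k) (u(i := y)) = l \<otimes> y \<otimes> (r \<otimes> u (Suc k))"
      using lr s False by (auto simp: m_assoc)
    then show ?thesis by (rule bexI[OF bexI[OF _ m_closed[OF lr(2) s]] lr(1)])
  qed
qed simp

lemma (in ring) iprod_single:
  assumes "i \<in> {1..k}" "v \<in> carrier R"
  shows "iprod k ((\<lambda>i. \<one>)(i := v)) = v"
  using assms
proof (induction k)
  case (Suc k)
  show ?case
  proof (cases "i = Suc k")
    case True
    have "iprod k ((\<lambda>i. \<one>)(i := v)) = iprod k (\<lambda>i. \<one>)"
      using True by (intro iprod_cong) auto
    then have "iprod (Suc k) ((\<lambda>i. \<one>)(i := v)) = \<one> \<otimes> v"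
      unfolding iprod.simps iprod_one using True by (simp only: fun_upd_same)
    also have "\<dots> = v" using Suc.prems(2) by simp
    finally show ?thesis .
  next
    case False
    then have "i \<in> {1..k}" using Suc.prems(1) by simp
    then have "iprod (Suc k) ((\<lambda>i. \<one>)(i := v)) = v \<otimes> \<one>"
      unfolding iprod.simps using Suc.IH[OF _ Suc.prems(2)] False by (simp only: fun_upd_other)
    also have "\<dots> = v" using Suc.prems(2) by simp
    finally show ?thesis .
  qed
qed simp

locale commuting_subalgebras = central_subfield R K for R (structure) and K +
  fixes d :: nat and V :: "nat \<Rightarrow> 'a set"
  assumes V_subring: "i \<in> {1..d} \<Longrightarrow> subring (V i) R"
    and K_V: "i \<in> {1..d} \<Longrightarrow> K \<subseteq> V i"
    and V_commute: "\<lbrakk>i \<in> {1..d}; j \<in> {1..d}; i \<noteq> j; u \<in> V i; v \<in> V j\<rbrakk> \<Longrightarrow> u \<otimes> v = v \<otimes> u"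
begin

declare One_nat_def [simp del]

abbreviation "k \<equiv> R\<lparr>carrier := K\<rparr>"
abbreviation "M \<equiv> product_group {1..d} (\<lambda>i. R\<lparr>carrier := V i\<rparr>)"
abbreviation "P \<equiv> monoid_algebra k M"

lemma V_closed: "i \<in> {1..d} \<Longrightarrow> u \<in> V i \<Longrightarrow> u \<in> carrier R"
  using subringE(1)[OF V_subring] by blast

lemma M_carrier: "u \<in> carrier M \<Longrightarrow> i \<in> {1..d} \<Longrightarrow> u i \<in> V i"
  unfolding carrier_product_group by (drule PiE_mem) auto

lemma M_closed: "u \<in> carrier M \<Longrightarrow> i \<in> {1..d} \<Longrightarrow> u i \<in> carrier R"
  using V_closed M_carrier by blast

lemma M_upd: "u \<in> carrier M \<Longrightarrow> i \<in> {1..d} \<Longrightarrow> v \<in> V i \<Longrightarrow> u(i := v) \<in> carrier M"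
  by (auto simp: PiE_iff extensional_def)

lemma M_one: "\<one>\<^bsub>M\<^esub> \<in> carrier M"
  using subringE(3)[OF V_subring] by auto

lemma monoid_M: "monoid M"
proof (rule monoidI)
  show "u \<otimes>\<^bsub>M\<^esub> v \<in> carrier M" if "u \<in> carrier M" "v \<in> carrier M" for u v
    using M_carrier[OF that(1)] M_carrier[OF that(2)] subringE(6)[OF V_subring] by auto
  show "\<one>\<^bsub>M\<^esub> \<otimes>\<^bsub>M\<^esub> u = u" "u \<otimes>\<^bsub>M\<^esub> \<one>\<^bsub>M\<^esub> = u" if "u \<in> carrier M" for u
    using M_closed[OF that] that by (auto simp: PiE_iff extensional_def fun_eq_iff)
  show "u \<otimes>\<^bsub>M\<^esub> v \<otimes>\<^bsub>M\<^esub> w = u \<otimes>\<^bsub>M\<^esub> (v \<otimes>\<^bsub>M\<^esub> w)"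
    if "u \<in> carrier M" "v \<in> carrier M" "w \<in> carrier M" for u v w
    using M_closed[OF that(1)] M_closed[OF that(2)] M_closed[OF that(3)]
    by (auto simp: fun_eq_iff m_assoc)
qed (rule M_one)

lemma cring_k: "cring k"
  using subfield_iff(2)[OF subfield_K] by (simp add: field_def domain_def)

sublocale MA: skew_monoid_ring k M P "\<lambda>_ r. r"
  by (rule skew_monoid_ring_monoid_algebra[OF cring_k monoid_M])

sublocale P: ring P
  by (rule MA.ring_S)

lemma iprod_M_closed: "u \<in> carrier M \<Longrightarrow> iprod d u \<in> carrier R"
  by (rule iprod_closed) (rule M_closed)

lemma iprod_commute:
  assumes u: "\<And>i. i \<in> {1..l} \<Longrightarrow> u i \<in> V i" and l: "l < j" and j: "j \<in> {1..d}" "v \<in> V j"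
  shows "v \<otimes> iprod l u = iprod l u \<otimes> v"
  using u l
proof (induction l)
  case 0
  then show ?case using V_closed[OF j] by simp
next
  case (Suc l)
  have i: "Suc l \<in> {1..d}" "Suc l \<noteq> j" using Suc.prems(2) j by auto
  have us: "u (Suc l) \<in> V (Suc l)" using Suc.prems(1) by simp
  have "u i \<in> carrier R" if "i \<in> {1..l}" for i
    using V_closed[of i "u i"] Suc.prems that j(1) by auto
  then have c: "v \<in> carrier R" "u (Suc l) \<in> carrier R" "iprod l u \<in> carrier R"
    using V_closed[OF j] V_closed[OF i(1) us] by (auto intro: iprod_closed)
  have "v \<otimes> iprod (Suc l) u = (v \<otimes> iprod l u) \<otimes> u (Suc l)" using c by (simp add: m_assoc)
  also have "v \<otimes> iprod l u = iprod l u \<otimes> v" using Suc by simp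
  also have "iprod l u \<otimes> v \<otimes> u (Suc l) = iprod l u \<otimes> (v \<otimes> u (Suc l))" using c by (simp add: m_assoc)
  also have "v \<otimes> u (Suc l) = u (Suc l) \<otimes> v"
    using V_commute[OF j(1) i(1) _ j(2) us] i(2) by simp
  also have "iprod l u \<otimes> (u (Suc l) \<otimes> v) = iprod (Suc l) u \<otimes> v" using c by (simp add: m_assoc)
  finally show ?case .
qed

text \<open>The commutation hypothesis enters here: the next factor of \<open>u\<close> has to pass
  the product of the earlier factors of \<open>v\<close>, which belong to other subalgebras.\<close>

lemma iprod_mult:
  assumes u: "u \<in> carrier M" and v: "v \<in> carrier M"
  shows "iprod d (u \<otimes>\<^bsub>M\<^esub> v) = iprod d u \<otimes> iprod d v"
proof -
  have "iprod l (\<lambda>i. u i \<otimes> v i) = iprod l u \<otimes> iprod l v" if "l \<le> d" for l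
    using that
  proof (induction l)
    case (Suc l)
    have i: "Suc l \<in> {1..d}" using Suc.prems by simp
    have c: "iprod l u \<in> carrier R" "iprod l v \<in> carrier R" "u (Suc l) \<in> carrier R" "v (Suc l) \<in> carrier R"
      using M_closed[OF u] M_closed[OF v] Suc.prems by (auto intro!: iprod_closed)
    have "iprod (Suc l) (\<lambda>i. u i \<otimes> v i) = (iprod l u \<otimes> iprod l v) \<otimes> (u (Suc l) \<otimes> v (Suc l))"
      using Suc by simp
    also have "\<dots> = iprod l u \<otimes> (iprod l v \<otimes> u (Suc l)) \<otimes> v (Suc l)"
      using c by (simp add: m_assoc)
    also have "iprod l v \<otimes> u (Suc l) = u (Suc l) \<otimes> iprod l v"
      by (rule iprod_commute[symmetric]) (use M_carrier[OF v] M_carrier[OF u i] Suc.prems i in auto)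
    also have "iprod l u \<otimes> (u (Suc l) \<otimes> iprod l v) \<otimes> v (Suc l) = iprod (Suc l) u \<otimes> iprod (Suc l) v"
      using c by (simp add: m_assoc)
    finally show ?case .
  qed simp
  then have "iprod d (\<lambda>i. u i \<otimes> v i) = iprod d u \<otimes> iprod d v" by simp
  moreover have "iprod d (u \<otimes>\<^bsub>M\<^esub> v) = iprod d (\<lambda>i. u i \<otimes> v i)"
    by (rule iprod_cong) simp
  ultimately show ?thesis by simp
qed

section \<open>The multiplication map on formal sums of tuples\<close>

definition ev :: "((nat \<Rightarrow> 'a) \<Rightarrow> 'a) \<Rightarrow> 'a" where
  "ev \<phi> = (\<Oplus>u\<in>{u. \<phi> u \<noteq> \<zero>}. \<phi> u \<otimes> iprod d u)"

lemma P_val: "\<phi> \<in> carrier P \<Longrightarrow> \<phi> u \<in> K"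
  using MA.val by simp

lemma P_supp: "\<phi> \<in> carrier P \<Longrightarrow> finite {u. \<phi> u \<noteq> \<zero>}" "\<phi> \<in> carrier P \<Longrightarrow> {u. \<phi> u \<noteq> \<zero>} \<subseteq> carrier M"
  using MA.supp by simp_all

lemma P_memI: "(\<And>u. \<phi> u \<in> K) \<Longrightarrow> finite U \<Longrightarrow> U \<subseteq> carrier M \<Longrightarrow> {u. \<phi> u \<noteq> \<zero>} \<subseteq> U \<Longrightarrow> \<phi> \<in> carrier P"
  using MA.memI[of \<phi> U] by simp

lemma ev_eq:
  assumes \<phi>: "\<phi> \<in> carrier P" and U: "finite U" "U \<subseteq> carrier M" "{u. \<phi> u \<noteq> \<zero>} \<subseteq> U"
  shows "ev \<phi> = (\<Oplus>u\<in>U. \<phi> u \<otimes> iprod d u)"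
  unfolding ev_def
proof (rule add.finprod_mono_neutral_cong_left[OF U(1,3)])
  show "\<phi> u \<otimes> iprod d u = \<zero>" if "u \<in> U - {u. \<phi> u \<noteq> \<zero>}" for u
    using that iprod_M_closed[of u] U(2) by auto
  show "(\<lambda>u. \<phi> u \<otimes> iprod d u) \<in> U \<rightarrow> carrier R"
    using iprod_M_closed U(2) P_val[OF \<phi>] by auto
qed simp

text \<open>A product of formal sums is expanded over pairs of tuples and \<open>iprod_mult\<close>
  splits the value of each pair; the coefficients move past these values because \<open>K\<close> is
  central.\<close>

lemma ev_hom: "ev \<in> ring_hom P R"
proof (rule ring_hom_memI)
  fix \<phi> assume \<phi>: "\<phi> \<in> carrier P"
  show "ev \<phi> \<in> carrier R"
    unfolding ev_def
    by (intro finsum_closed Pi_I m_closed K_carrier P_val[OF \<phi>] iprod_M_closed subsetD[OF P_supp(2)[OF \<phi>]])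
  fix \<psi> assume \<psi>: "\<psi> \<in> carrier P"
  let ?U = "{u. \<phi> u \<noteq> \<zero>}" and ?W = "{u. \<psi> u \<noteq> \<zero>}"
  note U = P_supp[OF \<phi>] and W = P_supp[OF \<psi>]
  have iU: "iprod d u \<in> carrier R" if "u \<in> ?U \<union> ?W" for u
    using that U(2) W(2) iprod_M_closed by blast
  have v: "\<phi> u \<in> carrier R" "\<psi> u \<in> carrier R" for u using P_val[OF \<phi>] P_val[OF \<psi>] by auto
  have add: "(\<phi> \<oplus>\<^bsub>P\<^esub> \<psi>) u = \<phi> u \<oplus> \<psi> u" for u using MA.add_S by simp
  have "ev (\<phi> \<oplus>\<^bsub>P\<^esub> \<psi>) = (\<Oplus>u\<in>?U \<union> ?W. (\<phi> \<oplus>\<^bsub>P\<^esub> \<psi>) u \<otimes> iprod d u)"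
  proof (rule ev_eq[OF P.a_closed[OF \<phi> \<psi>]])
    show "finite (?U \<union> ?W)" "?U \<union> ?W \<subseteq> carrier M" using U W by blast+
    show "{u. (\<phi> \<oplus>\<^bsub>P\<^esub> \<psi>) u \<noteq> \<zero>} \<subseteq> ?U \<union> ?W" unfolding add by auto
  qed
  also have "\<dots> = (\<Oplus>u\<in>?U \<union> ?W. \<phi> u \<otimes> iprod d u \<oplus> \<psi> u \<otimes> iprod d u)"
  proof (rule finsum_cong'[OF refl])
    show "(\<lambda>u. \<phi> u \<otimes> iprod d u \<oplus> \<psi> u \<otimes> iprod d u) \<in> ?U \<union> ?W \<rightarrow> carrier R"
      by (intro Pi_I a_closed m_closed v iU)
    show "(\<phi> \<oplus>\<^bsub>P\<^esub> \<psi>) u \<otimes> iprod d u = \<phi> u \<otimes> iprod d u \<oplus> \<psi> u \<otimes> iprod d u" if "u \<in> ?U \<union> ?W" for u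
      unfolding add by (rule l_distr[OF v iU[OF that]])
  qed
  also have "\<dots> = (\<Oplus>u\<in>?U \<union> ?W. \<phi> u \<otimes> iprod d u) \<oplus> (\<Oplus>u\<in>?U \<union> ?W. \<psi> u \<otimes> iprod d u)"
    by (rule finsum_addf; intro Pi_I m_closed v iU)
  also have "(\<Oplus>u\<in>?U \<union> ?W. \<phi> u \<otimes> iprod d u) = ev \<phi>"
    by (rule ev_eq[OF \<phi>, symmetric]) (use U W in blast)+
  also have "(\<Oplus>u\<in>?U \<union> ?W. \<psi> u \<otimes> iprod d u) = ev \<psi>"
    by (rule ev_eq[OF \<psi>, symmetric]) (use U W in blast)+
  finally show "ev (\<phi> \<oplus>\<^bsub>P\<^esub> \<psi>) = ev \<phi> \<oplus> ev \<psi>" .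
  let ?C = "(\<lambda>(u, v). u \<otimes>\<^bsub>M\<^esub> v) ` (?U \<times> ?W)"
  have C: "finite ?C" using U W by blast
  have CM: "?C \<subseteq> carrier M"
  proof (rule image_subsetI)
    fix r assume "r \<in> ?U \<times> ?W"
    then have r: "fst r \<in> ?U" "snd r \<in> ?W" by auto
    have "fst r \<in> carrier M" "snd r \<in> carrier M"
      by (rule subsetD[OF U(2) r(1)], rule subsetD[OF W(2) r(2)])
    then show "(case r of (u, v) \<Rightarrow> u \<otimes>\<^bsub>M\<^esub> v) \<in> carrier M"
      using monoid.m_closed[OF monoid_M] by (simp only: split_beta)
  qed
  have "ev (\<phi> \<otimes>\<^bsub>P\<^esub> \<psi>) = (\<Oplus>w\<in>?C. (\<phi> \<otimes>\<^bsub>P\<^esub> \<psi>) w \<otimes> iprod d w)"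
    by (rule ev_eq[OF P.m_closed[OF \<phi> \<psi>] C CM]) (use MA.supp_mult[OF \<phi> \<psi>] in simp)
  also have "\<dots> = (\<Oplus>u\<in>?U. \<Oplus>v\<in>?W. (\<phi> u \<otimes>\<^bsub>k\<^esub> \<psi> v) \<otimes> iprod d (u \<otimes>\<^bsub>M\<^esub> v))"
  proof (rule MA.finsum_mult[where g = "\<lambda>w r. r \<otimes> iprod d w", OF \<phi> \<psi> U _ W _ C _ abelian_monoid_axioms])
    fix w assume "w \<in> ?C"
    then have w: "iprod d w \<in> carrier R" using CM iprod_M_closed by blast
    show "\<zero>\<^bsub>k\<^esub> \<otimes> iprod d w = \<zero>" using w by simp
    fix r assume "r \<in> carrier k"
    then have r: "r \<in> K" by simp
    show "r \<otimes> iprod d w \<in> carrier R" using w r by simp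
    fix r' assume "r' \<in> carrier k"
    then show "(r \<oplus>\<^bsub>k\<^esub> r') \<otimes> iprod d w = r \<otimes> iprod d w \<oplus> r' \<otimes> iprod d w" using w r by (simp add: l_distr)
  qed (simp_all add: image_iff, blast)
  also have "\<dots> = (\<Oplus>u\<in>?U. \<Oplus>v\<in>?W. (\<phi> u \<otimes> \<psi> v) \<otimes> iprod d (u \<otimes>\<^bsub>M\<^esub> v))" by simp
  also have "\<dots> = (\<Oplus>u\<in>?U. \<phi> u \<otimes> iprod d u \<otimes> ev \<psi>)"
  proof (rule finsum_cong')
    fix u assume u: "u \<in> ?U"
    then have uM: "u \<in> carrier M" using U(2) by blast
    have "(\<Oplus>v\<in>?W. (\<phi> u \<otimes> \<psi> v) \<otimes> iprod d (u \<otimes>\<^bsub>M\<^esub> v)) =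
        (\<Oplus>v\<in>?W. (\<phi> u \<otimes> iprod d u) \<otimes> (\<psi> v \<otimes> iprod d v))"
    proof (rule finsum_cong')
      fix w assume w: "w \<in> ?W"
      then have wM: "w \<in> carrier M" using W(2) by blast
      have c: "iprod d u \<in> carrier R" "iprod d w \<in> carrier R" using iprod_M_closed uM wM by auto
      have "iprod d u \<otimes> (\<psi> w \<otimes> iprod d w) = \<psi> w \<otimes> (iprod d u \<otimes> iprod d w)"
        by (rule K_lcomm[OF P_val[OF \<psi>] c])
      then show "(\<phi> u \<otimes> \<psi> w) \<otimes> iprod d (u \<otimes>\<^bsub>M\<^esub> w) = (\<phi> u \<otimes> iprod d u) \<otimes> (\<psi> w \<otimes> iprod d w)"
        unfolding iprod_mult[OF uM wM] using c v by (simp add: m_assoc)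
    qed (use iU v uM iprod_M_closed in auto)
    also have "\<dots> = \<phi> u \<otimes> iprod d u \<otimes> ev \<psi>"
      unfolding ev_def by (rule finsum_rdistr[symmetric]) (use W iU v u in auto)
    finally show "(\<Oplus>v\<in>?W. (\<phi> u \<otimes> \<psi> v) \<otimes> iprod d (u \<otimes>\<^bsub>M\<^esub> v)) = \<phi> u \<otimes> iprod d u \<otimes> ev \<psi>" .
  next
    have "ev \<psi> \<in> carrier R"
      unfolding ev_def by (intro finsum_closed Pi_I m_closed v iU UnI2)
    then show "(\<lambda>u. \<phi> u \<otimes> iprod d u \<otimes> ev \<psi>) \<in> ?U \<rightarrow> carrier R"
      by (intro Pi_I m_closed v iU UnI1)
  qed simp
  also have "\<dots> = ev \<phi> \<otimes> ev \<psi>"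
  proof -
    have "ev \<psi> \<in> carrier R"
      unfolding ev_def by (intro finsum_closed Pi_I m_closed v iU UnI2)
    then show ?thesis
      unfolding ev_def[of \<phi>] by (intro finsum_ldistr[symmetric]) (use U iU v in auto)
  qed
  finally show "ev (\<phi> \<otimes>\<^bsub>P\<^esub> \<psi>) = ev \<phi> \<otimes> ev \<psi>" .
next
  have "ev \<one>\<^bsub>P\<^esub> = (\<Oplus>u\<in>{\<one>\<^bsub>M\<^esub>}. \<one>\<^bsub>P\<^esub> u \<otimes> iprod d u)"
  proof (rule ev_eq[OF P.one_closed])
    show "{\<one>\<^bsub>M\<^esub>} \<subseteq> carrier M" using M_one by blast
    show "{u. \<one>\<^bsub>P\<^esub> u \<noteq> \<zero>} \<subseteq> {\<one>\<^bsub>M\<^esub>}" by (auto simp: MA.one_S)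
  qed simp
  also have "\<dots> = iprod d \<one>\<^bsub>M\<^esub>"
    using iprod_M_closed[OF M_one] by (simp add: MA.one_S)
  also have "\<dots> = \<one>"
    using iprod_cong[of d "\<one>\<^bsub>M\<^esub>" "\<lambda>i. \<one>"] iprod_one by simp
  finally show "ev \<one>\<^bsub>P\<^esub> = \<one>" .
qed

abbreviation "single \<equiv> ma_single k"

lemma single_closed:
  assumes "c \<in> K" "u \<in> carrier M"
  shows "single c u \<in> carrier P"
proof (rule P_memI)
  show "single c u v \<in> K" for v using assms(1) K_closed(1) by (simp add: ma_single_def)
  show "{u} \<subseteq> carrier M" using assms(2) by blast
  show "{v. single c u v \<noteq> \<zero>} \<subseteq> {u}" by (auto simp: ma_single_def)
qed simp

lemma ev_single:
  assumes "c \<in> K" "u \<in> carrier M"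
  shows "ev (single c u) = c \<otimes> iprod d u"
proof -
  have "ev (single c u) = (\<Oplus>v\<in>{u}. single c u v \<otimes> iprod d v)"
  proof (rule ev_eq[OF single_closed[OF assms]])
    show "{u} \<subseteq> carrier M" using assms(2) by blast
    show "{v. single c u v \<noteq> \<zero>} \<subseteq> {u}" by (auto simp: ma_single_def)
  qed simp
  then show ?thesis using assms(1) iprod_M_closed[OF assms(2)] by (simp add: ma_single_def)
qed

end


section \<open>Congruence modulo the relations of the tensor product\<close>

context commuting_subalgebras
begin

abbreviation "T \<equiv> tensor_ideal k {1..d} (\<lambda>i. R\<lparr>carrier := V i\<rparr>)"

lemma tensor_relations_eq:
  "tensor_relations k {1..d} (\<lambda>i. R\<lparr>carrier := V i\<rparr>) =
    {single \<one> (f(i := y \<oplus> z)) \<ominus>\<^bsub>P\<^esub> (single \<one> (f(i := y)) \<oplus>\<^bsub>P\<^esub> single \<one> (f(i := z)))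
      | f i y z. f \<in> carrier M \<and> i \<in> {1..d} \<and> y \<in> V i \<and> z \<in> V i} \<union>
    {single \<one> (f(i := c \<otimes> y)) \<ominus>\<^bsub>P\<^esub> single c (f(i := y))
      | f i c y. f \<in> carrier M \<and> i \<in> {1..d} \<and> c \<in> K \<and> y \<in> V i}"
  unfolding tensor_relations_def Let_def by simp

lemma relations_carrier: "tensor_relations k {1..d} (\<lambda>i. R\<lparr>carrier := V i\<rparr>) \<subseteq> carrier P"
proof
  fix \<rho> assume "\<rho> \<in> tensor_relations k {1..d} (\<lambda>i. R\<lparr>carrier := V i\<rparr>)"
  then consider (add) f i y z where "f \<in> carrier M" "i \<in> {1..d}" "y \<in> V i" "z \<in> V i"
      "\<rho> = single \<one> (f(i := y \<oplus> z)) \<ominus>\<^bsub>P\<^esub> (single \<one> (f(i := y)) \<oplus>\<^bsub>P\<^esub> single \<one> (f(i := z)))"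
    | (smult) f i c y where "f \<in> carrier M" "i \<in> {1..d}" "c \<in> K" "y \<in> V i"
      "\<rho> = single \<one> (f(i := c \<otimes> y)) \<ominus>\<^bsub>P\<^esub> single c (f(i := y))"
    unfolding tensor_relations_eq by (elim UnE CollectE exE conjE)
  then show "\<rho> \<in> carrier P"
  proof cases
    case add
    have "y \<oplus> z \<in> V i" using subringE(7)[OF V_subring[OF add(2)] add(3,4)] .
    then show ?thesis
      unfolding add(5)
      by (intro P.minus_closed P.a_closed single_closed K_closed M_upd add)
  next
    case smult
    have "c \<otimes> y \<in> V i"
      using subringE(6)[OF V_subring[OF smult(2)] subsetD[OF K_V[OF smult(2)] smult(3)] smult(4)] .
    then show ?thesis
      unfolding smult(5)
      by (intro P.minus_closed single_closed K_closed M_upd smult)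
  qed
qed

lemma ideal_T: "ideal T P"
  unfolding tensor_ideal_def by (rule P.genideal_ideal[OF relations_carrier])

text \<open>Membership of both sides in the carrier is part of the relation, so chains of
  congruences carry their own side conditions.\<close>

definition tcong (infix "\<asymp>" 50) where "\<phi> \<asymp> \<psi> \<longleftrightarrow> \<phi> \<in> carrier P \<and> \<psi> \<in> carrier P \<and> \<phi> \<ominus>\<^bsub>P\<^esub> \<psi> \<in> T"

lemma T_closed: "\<phi> \<in> T \<Longrightarrow> \<phi> \<in> carrier P"
  using additive_subgroup.a_subset[OF ideal.axioms(1)[OF ideal_T]] by blast

lemma T_add: "\<phi> \<in> T \<Longrightarrow> \<psi> \<in> T \<Longrightarrow> \<phi> \<oplus>\<^bsub>P\<^esub> \<psi> \<in> T"
  by (rule additive_subgroup.a_closed[OF ideal.axioms(1)[OF ideal_T]])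

lemma T_neg: "\<phi> \<in> T \<Longrightarrow> \<ominus>\<^bsub>P\<^esub> \<phi> \<in> T"
  by (rule additive_subgroup.a_inv_closed[OF ideal.axioms(1)[OF ideal_T]])

lemma tcong_refl: "\<phi> \<in> carrier P \<Longrightarrow> \<phi> \<asymp> \<phi>"
  unfolding tcong_def using additive_subgroup.zero_closed[OF ideal.axioms(1)[OF ideal_T]]
  by (simp add: P.minus_eq P.r_neg)

lemma tcong_sym:
  assumes "\<phi> \<asymp> \<psi>"
  shows "\<psi> \<asymp> \<phi>"
proof -
  have c: "\<phi> \<in> carrier P" "\<psi> \<in> carrier P" "\<phi> \<ominus>\<^bsub>P\<^esub> \<psi> \<in> T" using assms by (simp_all only: tcong_def)
  have "\<ominus>\<^bsub>P\<^esub> (\<phi> \<ominus>\<^bsub>P\<^esub> \<psi>) = \<psi> \<ominus>\<^bsub>P\<^esub> \<phi>"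
    using c(1,2) by (simp add: P.minus_eq P.minus_add P.a_comm)
  then show ?thesis using T_neg[OF c(3)] c(1,2) by (simp only: tcong_def)
qed

lemma tcong_trans:
  assumes "\<phi> \<asymp> \<psi>" "\<psi> \<asymp> \<chi>"
  shows "\<phi> \<asymp> \<chi>"
proof -
  have c: "\<phi> \<in> carrier P" "\<psi> \<in> carrier P" "\<chi> \<in> carrier P" "\<phi> \<ominus>\<^bsub>P\<^esub> \<psi> \<in> T" "\<psi> \<ominus>\<^bsub>P\<^esub> \<chi> \<in> T"
    using assms by (simp_all only: tcong_def)
  have "(\<phi> \<ominus>\<^bsub>P\<^esub> \<psi>) \<oplus>\<^bsub>P\<^esub> (\<psi> \<ominus>\<^bsub>P\<^esub> \<chi>) = \<phi> \<ominus>\<^bsub>P\<^esub> \<chi>"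
    using c(1-3) by (simp add: P.minus_eq P.a_assoc P.r_neg1)
  then show ?thesis using T_add[OF c(4,5)] c(1,3) by (simp only: tcong_def)
qed

lemma tcong_add:
  assumes "\<phi> \<asymp> \<psi>" "\<phi>' \<asymp> \<psi>'"
  shows "\<phi> \<oplus>\<^bsub>P\<^esub> \<phi>' \<asymp> \<psi> \<oplus>\<^bsub>P\<^esub> \<psi>'"
proof -
  have c: "\<phi> \<in> carrier P" "\<psi> \<in> carrier P" "\<phi>' \<in> carrier P" "\<psi>' \<in> carrier P"
      "\<phi> \<ominus>\<^bsub>P\<^esub> \<psi> \<in> T" "\<phi>' \<ominus>\<^bsub>P\<^esub> \<psi>' \<in> T"
    using assms by (simp_all only: tcong_def)
  have "(\<phi> \<ominus>\<^bsub>P\<^esub> \<psi>) \<oplus>\<^bsub>P\<^esub> (\<phi>' \<ominus>\<^bsub>P\<^esub> \<psi>') = (\<phi> \<oplus>\<^bsub>P\<^esub> \<phi>') \<ominus>\<^bsub>P\<^esub> (\<psi> \<oplus>\<^bsub>P\<^esub> \<psi>')"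
    using c(1-4) by (simp add: P.minus_eq P.minus_add P.a_ac)
  then show ?thesis
    using T_add[OF c(5,6)] P.a_closed[OF c(1,3)] P.a_closed[OF c(2,4)] by (simp only: tcong_def)
qed

lemma single_cong_add:
  assumes "f \<in> carrier M" "i \<in> {1..d}" "y \<in> V i" "z \<in> V i"
  shows "single \<one> (f(i := y \<oplus> z)) \<asymp> single \<one> (f(i := y)) \<oplus>\<^bsub>P\<^esub> single \<one> (f(i := z))"
  unfolding tcong_def
proof (intro conjI)
  have "y \<oplus> z \<in> V i" using subringE(7)[OF V_subring[OF assms(2)] assms(3,4)] .
  then show "single \<one> (f(i := y \<oplus> z)) \<in> carrier P"
    by (intro single_closed K_closed M_upd assms)
  show "single \<one> (f(i := y)) \<oplus>\<^bsub>P\<^esub> single \<one> (f(i := z)) \<in> carrier P"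
    by (intro P.a_closed single_closed K_closed M_upd assms)
  have "single \<one> (f(i := y \<oplus> z)) \<ominus>\<^bsub>P\<^esub> (single \<one> (f(i := y)) \<oplus>\<^bsub>P\<^esub> single \<one> (f(i := z)))
      \<in> tensor_relations k {1..d} (\<lambda>i. R\<lparr>carrier := V i\<rparr>)"
    unfolding tensor_relations_eq
    by (rule UnI1, rule CollectI, rule exI[of _ f], rule exI[of _ i], rule exI[of _ y], rule exI[of _ z])
      (intro conjI refl assms)
  then show "single \<one> (f(i := y \<oplus> z)) \<ominus>\<^bsub>P\<^esub> (single \<one> (f(i := y)) \<oplus>\<^bsub>P\<^esub> single \<one> (f(i := z))) \<in> T"
    unfolding tensor_ideal_def by (rule subsetD[OF P.genideal_self[OF relations_carrier]])
qed

lemma single_cong_smult: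
  assumes "f \<in> carrier M" "i \<in> {1..d}" "c \<in> K" "y \<in> V i"
  shows "single \<one> (f(i := c \<otimes> y)) \<asymp> single c (f(i := y))"
  unfolding tcong_def
proof (intro conjI)
  have "c \<otimes> y \<in> V i"
    using subringE(6)[OF V_subring[OF assms(2)] subsetD[OF K_V[OF assms(2)] assms(3)] assms(4)] .
  then show "single \<one> (f(i := c \<otimes> y)) \<in> carrier P"
    by (intro single_closed K_closed M_upd assms)
  show "single c (f(i := y)) \<in> carrier P"
    by (intro single_closed K_closed M_upd assms)
  have "single \<one> (f(i := c \<otimes> y)) \<ominus>\<^bsub>P\<^esub> single c (f(i := y))
      \<in> tensor_relations k {1..d} (\<lambda>i. R\<lparr>carrier := V i\<rparr>)"
    unfolding tensor_relations_eq
    by (rule UnI2, rule CollectI, rule exI[of _ f], rule exI[of _ i], rule exI[of _ c], rule exI[of _ y])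
      (intro conjI refl assms)
  then show "single \<one> (f(i := c \<otimes> y)) \<ominus>\<^bsub>P\<^esub> single c (f(i := y)) \<in> T"
    unfolding tensor_ideal_def by (rule subsetD[OF P.genideal_self[OF relations_carrier]])
qed

text \<open>By \<open>iprod_split\<close> the product depends on entry \<open>i\<close> through
  \<open>l \<otimes> y \<otimes> r\<close>, which is additive and, \<open>K\<close> being central,
  linear in \<open>y\<close>. So every generating relation is sent to zero, and the kernel is an
  ideal.\<close>

lemma ev_T: "\<phi> \<in> T \<Longrightarrow> ev \<phi> = \<zero>"
proof -
  interpret ev: ring_hom_ring P R ev
    by (rule ring_hom_ringI2[OF P.ring_axioms ring_axioms ev_hom])
  have "T \<subseteq> a_kernel P R ev"
    unfolding tensor_ideal_def
  proof (rule P.genideal_minimal[OF ev.kernel_is_ideal], rule subsetI)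
    fix \<rho> assume \<rho>: "\<rho> \<in> tensor_relations k {1..d} (\<lambda>i. R\<lparr>carrier := V i\<rparr>)"
    then consider (add) f i y z where "f \<in> carrier M" "i \<in> {1..d}" "y \<in> V i" "z \<in> V i"
        "\<rho> = single \<one> (f(i := y \<oplus> z)) \<ominus>\<^bsub>P\<^esub> (single \<one> (f(i := y)) \<oplus>\<^bsub>P\<^esub> single \<one> (f(i := z)))"
      | (smult) f i c y where "f \<in> carrier M" "i \<in> {1..d}" "c \<in> K" "y \<in> V i"
        "\<rho> = single \<one> (f(i := c \<otimes> y)) \<ominus>\<^bsub>P\<^esub> single c (f(i := y))"
      unfolding tensor_relations_eq by (elim UnE CollectE exE conjE)
    then have "ev \<rho> = \<zero>"
    proof cases
      case add
      have m: "y \<oplus> z \<in> V i" using subringE(7)[OF V_subring[OF add(2)] add(3,4)] .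
      note s = single_closed[OF K_closed(2) M_upd[OF add(1,2)]]
      obtain l r where lr: "l \<in> carrier R" "r \<in> carrier R"
        "\<And>y. y \<in> carrier R \<Longrightarrow> iprod d (f(i := y)) = l \<otimes> y \<otimes> r"
        using iprod_split[OF add(2), of f] M_closed[OF add(1)] by blast
      note c = V_closed[OF add(2) add(3)] V_closed[OF add(2) add(4)]
      have e: "ev (single \<one> (f(i := w))) = l \<otimes> w \<otimes> r" if "w \<in> V i" for w
        using ev_single[OF K_closed(2) M_upd[OF add(1,2) that]] lr V_closed[OF add(2) that] by simp
      have "ev \<rho> = l \<otimes> (y \<oplus> z) \<otimes> r \<ominus> (l \<otimes> y \<otimes> r \<oplus> l \<otimes> z \<otimes> r)"
        unfolding add(5) P.minus_eq minus_eq
        using s[OF m] s[OF add(3)] s[OF add(4)] by (simp only: ev.hom_add ev.hom_a_inv P.a_closed P.a_inv_closed e[OF m] e[OF add(3)] e[OF add(4)])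
      also have "\<dots> = \<zero>" using lr(1,2) c by (simp add: r_distr l_distr minus_eq r_neg)
      finally show ?thesis .
    next
      case smult
      have m: "c \<otimes> y \<in> V i"
        using subringE(6)[OF V_subring[OF smult(2)] subsetD[OF K_V[OF smult(2)] smult(3)] smult(4)] .
      note s = single_closed[OF _ M_upd[OF smult(1,2)]]
      obtain l r where lr: "l \<in> carrier R" "r \<in> carrier R"
        "\<And>y. y \<in> carrier R \<Longrightarrow> iprod d (f(i := y)) = l \<otimes> y \<otimes> r"
        using iprod_split[OF smult(2), of f] M_closed[OF smult(1)] by blast
      note y = V_closed[OF smult(2) smult(4)]
      have e1: "ev (single \<one> (f(i := c \<otimes> y))) = l \<otimes> (c \<otimes> y) \<otimes> r"
        using ev_single[OF K_closed(2) M_upd[OF smult(1,2) m]] lr y smult(3) by simp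
      have e2: "ev (single c (f(i := y))) = c \<otimes> (l \<otimes> y \<otimes> r)"
        using ev_single[OF smult(3) M_upd[OF smult(1,2,4)]] lr(3)[OF y] by simp
      have "ev \<rho> = l \<otimes> (c \<otimes> y) \<otimes> r \<ominus> c \<otimes> (l \<otimes> y \<otimes> r)"
        unfolding smult(5) P.minus_eq minus_eq
        using s[OF K_closed(2) m] s[OF smult(3,4)] by (simp only: ev.hom_add ev.hom_a_inv P.a_inv_closed e1 e2)
      also have "l \<otimes> (c \<otimes> y) \<otimes> r = c \<otimes> (l \<otimes> y \<otimes> r)"
        using K_lcomm[OF smult(3) lr(1) y] lr(1,2) y smult(3) by (simp add: m_assoc)
      also have "c \<otimes> (l \<otimes> y \<otimes> r) \<ominus> c \<otimes> (l \<otimes> y \<otimes> r) = \<zero>"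
        using lr(1,2) y smult(3) by (simp add: minus_eq r_neg)
      finally show ?thesis .
    qed
    then show "\<rho> \<in> a_kernel P R ev"
      unfolding a_kernel_def' using subsetD[OF relations_carrier \<rho>] by (intro CollectI conjI)
  qed
  then show "\<phi> \<in> T \<Longrightarrow> ev \<phi> = \<zero>" using subsetD[of T "a_kernel P R ev" "\<phi>"] ev.kernel_zero[of "\<phi>"] by simp
qed

end


section \<open>Reduction to tuples of basis vectors\<close>

context commuting_subalgebras
begin

lemma zero_single: "single \<zero> u = \<zero>\<^bsub>P\<^esub>"
  unfolding MA.zero_S by (rule ext) (simp add: ma_single_def)

text \<open>Scalar relations start from the coefficient \<open>\<one>\<close>. A general coefficient
  \<open>c\<close> is first moved into the entry and then taken out again together with
  \<open>c'\<close>.\<close>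

lemma single_cong_scale:
  assumes f: "f \<in> carrier M" "i \<in> {1..d}" and c: "c \<in> K" "c' \<in> K" and y: "y \<in> V i"
  shows "single c (f(i := c' \<otimes> y)) \<asymp> single (c \<otimes> c') (f(i := y))"
proof -
  have c'y: "c' \<otimes> y \<in> V i"
    using subringE(6)[OF V_subring[OF f(2)] subsetD[OF K_V[OF f(2)] c(2)] y] .
  have eq: "c \<otimes> (c' \<otimes> y) = (c \<otimes> c') \<otimes> y"
    using V_closed[OF f(2) y] c by (simp add: m_assoc)
  have "single \<one> (f(i := c \<otimes> (c' \<otimes> y))) \<asymp> single c (f(i := c' \<otimes> y))"
    by (rule single_cong_smult[OF f c(1) c'y])
  then have "single c (f(i := c' \<otimes> y)) \<asymp> single \<one> (f(i := (c \<otimes> c') \<otimes> y))"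
    unfolding eq by (rule tcong_sym)
  then show ?thesis
    by (rule tcong_trans) (rule single_cong_smult[OF f K_closed(5)[OF c] y])
qed

lemma single_cong_scaled_add:
  assumes f: "f \<in> carrier M" "i \<in> {1..d}" and c: "c \<in> K" and y: "y \<in> V i" and z: "z \<in> V i"
  shows "single c (f(i := y \<oplus> z)) \<asymp> single c (f(i := y)) \<oplus>\<^bsub>P\<^esub> single c (f(i := z))"
proof -
  note sub = V_subring[OF f(2)]
  have yz: "y \<oplus> z \<in> V i" using subringE(7)[OF sub y z] .
  have cV: "c \<in> V i" by (rule subsetD[OF K_V[OF f(2)] c])
  have cyz: "c \<otimes> y \<in> V i" "c \<otimes> z \<in> V i" using subringE(6)[OF sub cV y] subringE(6)[OF sub cV z] .
  have eq: "c \<otimes> (y \<oplus> z) = c \<otimes> y \<oplus> c \<otimes> z"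
    using V_closed[OF f(2) y] V_closed[OF f(2) z] c by (simp add: r_distr)
  have "single \<one> (f(i := c \<otimes> (y \<oplus> z))) \<asymp> single c (f(i := y \<oplus> z))"
    by (rule single_cong_smult[OF f c yz])
  then have "single c (f(i := y \<oplus> z)) \<asymp> single \<one> (f(i := c \<otimes> y \<oplus> c \<otimes> z))"
    unfolding eq by (rule tcong_sym)
  then have "single c (f(i := y \<oplus> z)) \<asymp> single \<one> (f(i := c \<otimes> y)) \<oplus>\<^bsub>P\<^esub> single \<one> (f(i := c \<otimes> z))"
    by (rule tcong_trans) (rule single_cong_add[OF f cyz])
  then show ?thesis
    by (rule tcong_trans) (intro tcong_add single_cong_smult f c y z)
qed

text \<open>Modulo the relations every formal sum is supported on tuples of basis vectors, and there
  the multiplication map is injective because the products are independent. So its kernel is exactly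
  \<open>T\<close>, while \<open>gen\<close> makes it surjective. Independence is stated for tuples
  of vectors, not of indices, because those are the elements of the monoid \<open>M\<close>.\<close>

theorem tensor_product_internal:
  assumes J: "\<And>i. i \<in> {1..d} \<Longrightarrow> finite (J i)"
    and w: "\<And>i. i \<in> {1..d} \<Longrightarrow> w i \<in> J i \<rightarrow> carrier R"
    and V_eq: "\<And>i. i \<in> {1..d} \<Longrightarrow> V i = lincombs (J i) (w i)"
    and indep: "lin_indep (\<Pi>\<^sub>E i\<in>{1..d}. w i ` J i) (iprod d)"
    and gen: "\<And>W. subring W R \<Longrightarrow> K \<subseteq> W \<Longrightarrow> (\<And>i. i \<in> {1..d} \<Longrightarrow> V i \<subseteq> W) \<Longrightarrow> carrier R \<subseteq> W"
  shows "tensor_product_of_subalgebras K R {1..d} V"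
proof -
  interpret ev: ring_hom_ring P R ev
    by (rule ring_hom_ringI2[OF P.ring_axioms ring_axioms ev_hom])
  define W where "W = (\<Pi>\<^sub>E i\<in>{1..d}. w i ` J i)"
  have wV: "w i j \<in> V i" if "i \<in> {1..d}" "j \<in> J i" for i j
    unfolding V_eq[OF that(1)] by (rule lincombs_incl[OF J[OF that(1)] w[OF that(1)] that(2)])
  have W_fin: "finite W" unfolding W_def by (intro finite_PiE finite_imageI J) simp_all
  have WM: "W \<subseteq> carrier M"
    unfolding W_def carrier_product_group by (rule PiE_mono) (use wV in auto)
  define Q where "Q = {\<phi>. \<exists>\<delta>. \<phi> \<asymp> \<delta> \<and> {u. \<delta> u \<noteq> \<zero>} \<subseteq> W}"
  have Q_cong: "\<phi> \<in> Q" if "\<phi> \<asymp> \<psi>" "\<psi> \<in> Q" for \<phi> \<psi>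
    using that tcong_trans[OF that(1)] unfolding Q_def by auto
  have Q_add: "\<phi> \<oplus>\<^bsub>P\<^esub> \<psi> \<in> Q" if "\<phi> \<in> Q" "\<psi> \<in> Q" for \<phi> \<psi>
  proof -
    obtain \<delta> \<epsilon> where *: "\<phi> \<asymp> \<delta>" "{u. \<delta> u \<noteq> \<zero>} \<subseteq> W" "\<psi> \<asymp> \<epsilon>" "{u. \<epsilon> u \<noteq> \<zero>} \<subseteq> W"
      using \<open>\<phi> \<in> Q\<close> \<open>\<psi> \<in> Q\<close> unfolding Q_def by auto
    have "{u. (\<delta> \<oplus>\<^bsub>P\<^esub> \<epsilon>) u \<noteq> \<zero>} \<subseteq> W"
    proof (rule subsetI, rule ccontr)
      fix u assume u: "u \<in> {u. (\<delta> \<oplus>\<^bsub>P\<^esub> \<epsilon>) u \<noteq> \<zero>}" "u \<notin> W"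
      then have "\<delta> u = \<zero>" "\<epsilon> u = \<zero>" using *(2,4) by blast+
      then show False using u(1) by (simp add: MA.add_S)
    qed
    then show ?thesis using tcong_add[OF *(1,3)] unfolding Q_def by blast
  qed
  have Q_base: "\<phi> \<in> Q" if "\<phi> \<in> carrier P" "{u. \<phi> u \<noteq> \<zero>} \<subseteq> W" for \<phi>
    unfolding Q_def using tcong_refl[OF that(1)] that(2) by blast
  have Q_zero: "\<zero>\<^bsub>P\<^esub> \<in> Q" by (rule Q_base[OF P.zero_closed]) (simp add: MA.zero_S)
  \<comment> \<open>\<open>l\<close> bounds the positions whose entries may still be arbitrary. The
    induction treats position \<open>Suc l\<close>, where the admissible entries form a subspace
    containing the basis vectors.\<close>
  have Q_single: "single c u \<in> Q"
    if "l \<le> d" "u \<in> carrier M" "\<And>i. i \<in> {1..d} \<Longrightarrow> l < i \<Longrightarrow> u i \<in> w i ` J i" "c \<in> K" for l u c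
    using that
  proof (induction l arbitrary: u c)
    case 0
    have "u \<in> W"
      unfolding W_def using 0 by (auto simp: PiE_iff)
    then show ?case
      by (intro Q_base single_closed 0) (auto simp: ma_single_def)
  next
    case (Suc l)
    let ?i = "Suc l"
    have i: "?i \<in> {1..d}" using Suc.prems(1) by simp
    note u = Suc.prems(2)
    let ?Y = "{y \<in> V ?i. \<forall>c\<in>K. single c (u(?i := y)) \<in> Q}"
    have "lincombs (J ?i) (w ?i) \<subseteq> ?Y"
    proof (rule lincombs_min)
      show "subspace ?Y"
        unfolding subspace_def
      proof (intro conjI ballI CollectI)
        show "?Y \<subseteq> carrier R" using V_closed[OF i] by auto
        show z: "\<zero> \<in> V ?i" by (rule subringE(2)[OF V_subring[OF i]])
        fix c assume c: "c \<in> K"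
        \<comment> \<open>The zero entry is written as \<open>\<zero> \<otimes> \<zero>\<close> so
          that a scalar zero can be moved out of it, which leaves the zero sum.\<close>
        have "single c (u(?i := \<zero> \<otimes> \<zero>)) \<asymp> single (c \<otimes> \<zero>) (u(?i := \<zero>))"
          by (rule single_cong_scale[OF u i c K_closed(1) z])
        moreover have "single (c \<otimes> \<zero>) (u(?i := \<zero>)) = \<zero>\<^bsub>P\<^esub>"
          unfolding r_null[OF K_carrier[OF c]] by (rule zero_single)
        ultimately have "single c (u(?i := \<zero> \<otimes> \<zero>)) \<in> Q" using Q_cong Q_zero by metis
        then show "single c (u(?i := \<zero>)) \<in> Q" unfolding r_null[OF zero_closed] .
      next
        fix y z assume yz: "y \<in> ?Y" "z \<in> ?Y"
        then have V: "y \<in> V ?i" "z \<in> V ?i" by auto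
        show "y \<oplus> z \<in> V ?i" by (rule subringE(7)[OF V_subring[OF i] V])
        fix c assume c: "c \<in> K"
        show "single c (u(?i := y \<oplus> z)) \<in> Q"
          by (rule Q_cong[OF single_cong_scaled_add[OF u i c V] Q_add]) (use yz c in auto)
      next
        fix c' y assume c': "c' \<in> K" and y: "y \<in> ?Y"
        then have V: "y \<in> V ?i" by auto
        show "c' \<otimes> y \<in> V ?i"
          by (rule subringE(6)[OF V_subring[OF i] subsetD[OF K_V[OF i] c'] V])
        fix c assume c: "c \<in> K"
        have "single (c \<otimes> c') (u(?i := y)) \<in> Q" using y K_closed(5)[OF c c'] by blast
        then show "single c (u(?i := c' \<otimes> y)) \<in> Q"
          by (rule Q_cong[OF single_cong_scale[OF u i c c' V]])
      qed
      fix j assume j: "j \<in> J ?i"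
      have "single c (u(?i := w ?i j)) \<in> Q" if c: "c \<in> K" for c
      proof (rule Suc.IH[OF _ M_upd[OF u i wV[OF i j]] _ c])
        show "l \<le> d" using Suc.prems(1) by simp
        fix i' assume "i' \<in> {1..d}" "l < i'"
        then show "(u(?i := w ?i j)) i' \<in> w i' ` J i'"
          using Suc.prems(3)[of i'] j by (cases "i' = ?i") auto
      qed
      then show "w ?i j \<in> ?Y" using wV[OF i j] by blast
    qed
    moreover have "u ?i \<in> lincombs (J ?i) (w ?i)"
      using M_carrier[OF u i] V_eq[OF i] by simp
    ultimately have "single c (u(?i := u ?i)) \<in> Q" using Suc.prems(4) by blast
    then show ?case by simp
  qed
  have Q_all: "\<phi> \<in> Q" if "finite U" "\<phi> \<in> carrier P" "{u. \<phi> u \<noteq> \<zero>} \<subseteq> U" for U \<phi>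
    using that
  proof (induction U arbitrary: \<phi> rule: finite_induct)
    case empty
    then show ?case by (intro Q_base) auto
  next
    case (insert u U)
    show ?case
    proof (cases "\<phi> u = \<zero>")
      case True
      then have "{u. \<phi> u \<noteq> \<zero>} \<subseteq> U" using insert.prems(2) by auto
      then show ?thesis by (rule insert.IH[OF insert.prems(1)])
    next
      case False
      then have uM: "u \<in> carrier M" using P_supp(2)[OF insert.prems(1)] by blast
      let ?\<phi> = "\<phi>(u := \<zero>)"
      have \<phi>P: "?\<phi> \<in> carrier P"
      proof (rule P_memI[OF _ P_supp[OF insert.prems(1)]])
        show "?\<phi> v \<in> K" for v using P_val[OF insert.prems(1)] K_closed(1) by simp
      qed auto
      have "?\<phi> \<in> Q" by (rule insert.IH[OF \<phi>P]) (use insert.prems(2) in auto)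
      moreover have "single (\<phi> u) u \<in> Q"
        by (rule Q_single[of d]) (use uM P_val[OF insert.prems(1)] in auto)
      moreover have "\<phi> = single (\<phi> u) u \<oplus>\<^bsub>P\<^esub> ?\<phi>"
      proof (rule ext)
        show "\<phi> v = (single (\<phi> u) u \<oplus>\<^bsub>P\<^esub> ?\<phi>) v" for v
          using K_carrier[OF P_val[OF insert.prems(1)]] by (simp add: MA.add_S ma_single_def)
      qed
      ultimately show ?thesis using Q_add by metis
    qed
  qed
  have ker: "a_kernel P R ev = T"
  proof (rule subset_antisym; rule subsetI)
    fix \<phi> assume "\<phi> \<in> a_kernel P R ev"
    then have \<phi>: "\<phi> \<in> carrier P \<and> ev \<phi> = \<zero>" unfolding a_kernel_def' by (rule CollectD)
    then have "\<phi> \<in> Q" using Q_all P_supp(1) by blast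
    then obtain \<delta> where \<delta>: "\<phi> \<asymp> \<delta>" "{u. \<delta> u \<noteq> \<zero>} \<subseteq> W" unfolding Q_def by auto
    then have d: "\<delta> \<in> carrier P" "\<phi> \<ominus>\<^bsub>P\<^esub> \<delta> \<in> T" by (simp_all only: tcong_def)
    have "ev (\<phi> \<ominus>\<^bsub>P\<^esub> \<delta>) = \<zero>" by (rule ev_T[OF d(2)])
    then have "ev \<phi> \<ominus> ev \<delta> = \<zero>"
      unfolding P.minus_eq minus_eq using \<phi> d(1) by (simp only: ev.hom_add ev.hom_a_inv P.a_inv_closed)
    then have "ev \<delta> = \<zero>" using \<phi> ev.hom_closed[OF d(1)] by (simp add: minus_eq)
    then have sum: "(\<Oplus>u\<in>W. \<delta> u \<otimes> iprod d u) = \<zero>"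
      using ev_eq[OF d(1) W_fin WM \<delta>(2)] by simp
    have "\<forall>u\<in>W. \<delta> u = \<zero>"
      by (rule mp[OF bspec[OF indep[folded W_def, unfolded lin_indep_def], of \<delta>] sum])
        (use P_val[OF d(1)] in blast)
    then have "\<delta> = \<zero>\<^bsub>P\<^esub>" using \<delta>(2) by (auto simp: MA.zero_S fun_eq_iff)
    then show "\<phi> \<in> T" using d(2) \<phi> by (simp add: P.minus_eq)
  next
    fix \<phi> assume "\<phi> \<in> T"
    then show "\<phi> \<in> a_kernel P R ev"
      unfolding a_kernel_def' using ev_T T_closed by (intro CollectI conjI)
  qed
  have ev_one: "ev (single c \<one>\<^bsub>M\<^esub>) = c" if "c \<in> K" for c
    using ev_single[OF that M_one] iprod_cong[of d "\<one>\<^bsub>M\<^esub>" "\<lambda>i. \<one>"] iprod_one that by simp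
  have ev_V: "ev (single \<one> (\<one>\<^bsub>M\<^esub>(i := v))) = v" if i: "i \<in> {1..d}" and v: "v \<in> V i" for i v
  proof -
    have "iprod d (\<one>\<^bsub>M\<^esub>(i := v)) = iprod d ((\<lambda>i. \<one>)(i := v))"
      by (rule iprod_cong) simp
    also have "\<dots> = v" by (rule iprod_single[OF i V_closed[OF i v]])
    finally show ?thesis
      using ev_single[OF K_closed(2) M_upd[OF M_one i v]] V_closed[OF i v] by simp
  qed
  have surj: "ev ` carrier P = carrier R"
  proof (rule subset_antisym)
    show "ev ` carrier P \<subseteq> carrier R" using ev.hom_closed by blast
    show "carrier R \<subseteq> ev ` carrier P"
    proof (rule gen)
      show "subring (ev ` carrier P) R"
        by (rule ring_incl_imp_subring[OF \<open>ev ` carrier P \<subseteq> carrier R\<close> ev.img_is_ring])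
      show "K \<subseteq> ev ` carrier P"
      proof
        fix c assume "c \<in> K"
        then show "c \<in> ev ` carrier P"
          using ev_one[of c] single_closed[OF _ M_one, of c] by (intro image_eqI) simp_all
      qed
      show "V i \<subseteq> ev ` carrier P" if i: "i \<in> {1..d}" for i
      proof
        fix v assume v: "v \<in> V i"
        show "v \<in> ev ` carrier P"
          using imageI[OF single_closed[OF K_closed(2) M_upd[OF M_one i v]], of ev]
          unfolding ev_V[OF i v] .
      qed
    qed
  qed
  let ?\<mu> = "\<lambda>Y. the_elem (ev ` Y)"
  have iso: "?\<mu> \<in> ring_iso (P Quot T) R"
    using ev.FactRing_iso_set[OF surj] unfolding ker .
  have \<mu>: "?\<mu> (T +>\<^bsub>P\<^esub> \<phi>) = ev \<phi>" if "\<phi> \<in> carrier P" for \<phi>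
    using ev.the_elem_simp[OF that] unfolding ker .
  show ?thesis
    unfolding tensor_product_of_subalgebras_def Let_def tensor_algebra_def pure_tensor_def
  proof (intro conjI ballI bexI[OF _ iso])
    show "unital_subalgebra K (V i) R" if "i \<in> {1..d}" for i
      unfolding unital_subalgebra_def by (intro conjI V_subring[OF that] K_V[OF that])
    show "?\<mu> (T +>\<^bsub>P\<^esub> single c \<one>\<^bsub>M\<^esub>) = c" if "c \<in> K" for c
      unfolding \<mu>[OF single_closed[OF that M_one]] by (rule ev_one[OF that])
    show "?\<mu> (T +>\<^bsub>P\<^esub> single \<one>\<^bsub>k\<^esub> (\<one>\<^bsub>M\<^esub>(i := v))) = v" if "i \<in> {1..d}" "v \<in> V i" for i v
    proof -
      have one: "\<one>\<^bsub>k\<^esub> = \<one>" by simp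
      show ?thesis
        unfolding one \<mu>[OF single_closed[OF K_closed(2) M_upd[OF M_one that]]] by (rule ev_V[OF that])
    qed
  qed
qed

end


section \<open>Generators and relations of the cyclic algebra\<close>

lemma ideal_coset_zero:
  assumes "ideal I R" "b \<in> I"
  shows "I +>\<^bsub>R\<^esub> b = \<zero>\<^bsub>R Quot I\<^esub>"
proof -
  interpret ideal I R by fact
  show ?thesis using a_rcos_const[OF assms(2)] by (simp add: FactRing_def)
qed

locale skew_polynomials = E?: ring E for E :: "('c, 'd) ring_scheme" (structure) +
  fixes \<sigma> :: "'c \<Rightarrow> 'c"
  assumes \<sigma>_hom: "\<sigma> \<in> ring_hom E E"
begin

abbreviation "S \<equiv> skew_poly_ring E \<sigma>"

sublocale S: ring S
  by (rule ring_skew_poly_ring[OF ring_axioms \<sigma>_hom])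

lemma S_carrier: "f \<in> carrier S \<longleftrightarrow> (\<forall>i. f i \<in> carrier E) \<and> finite {i. f i \<noteq> \<zero>}"
  by (auto simp: skew_poly_ring_def)

lemma S_mult: "(f \<otimes>\<^bsub>S\<^esub> g) k = (\<Oplus>i\<in>{..k}. f i \<otimes> (\<sigma> ^^ i) (g (k - i)))"
  by (simp add: skew_poly_ring_def)

lemma S_add: "(f \<oplus>\<^bsub>S\<^esub> g) k = f k \<oplus> g k"
  by (simp add: skew_poly_ring_def)

lemma S_one: "\<one>\<^bsub>S\<^esub> = skew_const E \<one>"
  by (simp add: skew_poly_ring_def skew_const_def)

lemma \<sigma>_pow:
  shows "r \<in> carrier E \<Longrightarrow> (\<sigma> ^^ i) r \<in> carrier E" and "(\<sigma> ^^ i) \<zero> = \<zero>"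
proof -
  have "(\<sigma> ^^ i) \<in> ring_hom E E"
  proof (induction i)
    case (Suc i)
    then show ?case using ring_hom_trans[OF Suc \<sigma>_hom] by (simp add: comp_def)
  qed (simp add: ring_hom_def)
  then show "r \<in> carrier E \<Longrightarrow> (\<sigma> ^^ i) r \<in> carrier E" "(\<sigma> ^^ i) \<zero> = \<zero>"
    using ring_hom_closed ring_hom_zero[OF _ ring_axioms ring_axioms] by metis+
qed

lemma const_closed:
  assumes "e \<in> carrier E"
  shows "skew_const E e \<in> carrier S"
proof -
  have "finite {i::nat. skew_const E e i \<noteq> \<zero>}"
    by (rule finite_subset[of _ "{0}"]) (auto simp: skew_const_def)
  then show ?thesis using assms by (simp add: S_carrier) (simp add: skew_const_def)
qed

lemma var_closed_S: "skew_var E \<in> carrier S"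
proof -
  have "finite {i::nat. skew_var E i \<noteq> \<zero>}"
    by (rule finite_subset[of _ "{1}"]) (auto simp: skew_var_def)
  then show ?thesis by (simp add: S_carrier) (simp add: skew_var_def)
qed

lemma const_mult:
  assumes "e \<in> carrier E" "g \<in> carrier S"
  shows "(skew_const E e \<otimes>\<^bsub>S\<^esub> g) k = e \<otimes> g k"
proof -
  have g: "g i \<in> carrier E" for i using assms(2) by (simp add: S_carrier)
  have "(skew_const E e \<otimes>\<^bsub>S\<^esub> g) k = skew_const E e 0 \<otimes> (\<sigma> ^^ 0) (g (k - 0))"
    unfolding S_mult by (rule finsum_single) (use assms(1) g \<sigma>_pow in \<open>auto simp: skew_const_def\<close>)
  then show ?thesis by (simp add: skew_const_def)
qed

lemma var_mult:
  assumes "g \<in> carrier S"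
  shows "(skew_var E \<otimes>\<^bsub>S\<^esub> g) k = (if k = 0 then \<zero> else \<sigma> (g (k - 1)))"
proof -
  have g: "g i \<in> carrier E" for i using assms by (simp add: S_carrier)
  show ?thesis
  proof (cases "k = 0")
    case True
    then show ?thesis unfolding S_mult using g by (simp add: skew_var_def)
  next
    case False
    have "(skew_var E \<otimes>\<^bsub>S\<^esub> g) k = skew_var E 1 \<otimes> (\<sigma> ^^ 1) (g (k - 1))"
      unfolding S_mult by (rule finsum_single) (use False g \<sigma>_pow ring_hom_closed[OF \<sigma>_hom] in \<open>auto simp: skew_var_def\<close>)
    then show ?thesis using False g ring_hom_closed[OF \<sigma>_hom] by (simp add: skew_var_def)
  qed
qed

lemma const_hom: "skew_const E \<in> ring_hom E S"
proof (rule ring_hom_memI)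
  fix u v assume uv: "u \<in> carrier E" "v \<in> carrier E"
  show "skew_const E u \<in> carrier S" by (rule const_closed[OF uv(1)])
  show "skew_const E (u \<otimes> v) = skew_const E u \<otimes>\<^bsub>S\<^esub> skew_const E v"
    using uv const_mult[OF uv(1) const_closed[OF uv(2)]] by (auto simp: fun_eq_iff skew_const_def)
  show "skew_const E (u \<oplus> v) = skew_const E u \<oplus>\<^bsub>S\<^esub> skew_const E v"
    by (auto simp: fun_eq_iff S_add skew_const_def)
qed (simp add: S_one)

lemma var_const:
  assumes "e \<in> carrier E"
  shows "skew_var E \<otimes>\<^bsub>S\<^esub> skew_const E e = skew_const E (\<sigma> e) \<otimes>\<^bsub>S\<^esub> skew_var E"
proof
  fix k
  have "\<sigma> e \<in> carrier E" "\<sigma> \<zero> = \<zero>" using ring_hom_closed[OF \<sigma>_hom assms] ring_hom_zero[OF \<sigma>_hom ring_axioms ring_axioms] .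
  then show "(skew_var E \<otimes>\<^bsub>S\<^esub> skew_const E e) k = (skew_const E (\<sigma> e) \<otimes>\<^bsub>S\<^esub> skew_var E) k"
    unfolding var_mult[OF const_closed[OF assms]] const_mult[OF \<open>\<sigma> e \<in> carrier E\<close> var_closed_S]
    by (auto simp: skew_const_def skew_var_def)
qed

lemma var_pow: "(skew_var E [^]\<^bsub>S\<^esub> N) k = (if k = N then \<one> else \<zero>)" for N :: nat
proof (induction N arbitrary: k)
  case 0
  then show ?case by (simp add: S_one skew_const_def)
next
  case (Suc N)
  have "\<sigma> \<one> = \<one>" "\<sigma> \<zero> = \<zero>" using ring_hom_one[OF \<sigma>_hom] ring_hom_zero[OF \<sigma>_hom ring_axioms ring_axioms] .
  then show ?case
    using S.nat_pow_Suc2[OF var_closed_S, of N] var_mult[OF S.nat_pow_closed[OF var_closed_S, of N]] Suc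
    by (cases k) simp_all
qed

text \<open>Every skew polynomial is a finite sum of terms \<open>e x^N\<close>; the induction
  strips the coefficient at the highest index still allowed.\<close>

lemma S_induct:
  assumes W: "\<And>f g. f \<in> W \<Longrightarrow> g \<in> W \<Longrightarrow> f \<oplus>\<^bsub>S\<^esub> g \<in> W" "\<zero>\<^bsub>S\<^esub> \<in> W"
    and mono: "\<And>e N. e \<in> carrier E \<Longrightarrow> skew_const E e \<otimes>\<^bsub>S\<^esub> skew_var E [^]\<^bsub>S\<^esub> (N::nat) \<in> W"
    and f: "f \<in> carrier S"
  shows "f \<in> W"
proof -
  have "f \<in> W" if "f \<in> carrier S" "\<And>i. i \<ge> N \<Longrightarrow> f i = \<zero>" for f and N :: nat
    using that
  proof (induction N arbitrary: f)
    case 0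
    then have "f = \<zero>\<^bsub>S\<^esub>" by (simp add: skew_poly_ring_def fun_eq_iff)
    then show ?case using W(2) by simp
  next
    case (Suc N)
    have fE: "f i \<in> carrier E" for i using Suc.prems(1) by (simp add: S_carrier)
    let ?f = "f(N := \<zero>)"
    have "finite {i. ?f i \<noteq> \<zero>}"
      by (rule finite_subset[of _ "{i. f i \<noteq> \<zero>}"]) (use Suc.prems(1) in \<open>auto simp: S_carrier\<close>)
    then have "?f \<in> carrier S" using fE unfolding S_carrier by simp
    moreover have "?f i = \<zero>" if "i \<ge> N" for i using Suc.prems(2)[of i] that by (cases "i = N") auto
    ultimately have "?f \<in> W" by (rule Suc.IH)
    moreover have "f = ?f \<oplus>\<^bsub>S\<^esub> (skew_const E (f N) \<otimes>\<^bsub>S\<^esub> skew_var E [^]\<^bsub>S\<^esub> N)"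
      using fE by (auto simp: fun_eq_iff S_add var_pow const_mult[OF fE S.nat_pow_closed[OF var_closed_S]])
    ultimately show ?case using W(1) mono[OF fE] by metis
  qed
  moreover obtain N where "\<And>i. i \<ge> N \<Longrightarrow> f i = \<zero>"
  proof -
    have "finite {i. f i \<noteq> \<zero>}" using f by (simp add: S_carrier)
    then obtain N where "{i. f i \<noteq> \<zero>} \<subseteq> {..<N}" using finite_nat_iff_bounded by blast
    then have "\<And>i. i \<ge> N \<Longrightarrow> f i = \<zero>" by (meson lessThan_iff mem_Collect_eq not_le subsetD)
    then show thesis by (rule that)
  qed
  ultimately show ?thesis using f by blast
qed

end

text \<open>The construction in the theorem before the factorization of \<open>n\<close>. Its
  purpose is to deliver the relations \<open>h_pow\<close>, \<open>x_pow\<close> and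
  \<open>x_h\<close> and the generation statement \<open>generated_by\<close>.\<close>

locale cyclic_algebra_setup =
  fixes F :: "('a, 'b) ring_scheme" and n :: nat and q s a :: 'a
    and E \<sigma> A \<iota> h x
  assumes F: "field F" and q: "q \<in> carrier F" and s: "s \<in> carrier F" and a: "a \<in> carrier F"
    and E_def: "E = radical_algebra F n s"
    and \<sigma>_aut: "\<sigma> \<in> carrier (aut_group E (radical_const F n s ` carrier F))"
    and \<sigma>_h: "\<sigma> (radical_gen F n s) = radical_const F n s q \<otimes>\<^bsub>E\<^esub> radical_gen F n s"
    and A_def: "A = cyclic_algebra E \<sigma> n (radical_const F n s a)"
    and \<iota>_def: "\<And>c. \<iota> c = cyclic_class E \<sigma> n (radical_const F n s a)
                                 (skew_const E (radical_const F n s c))"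
    and h_def: "h = cyclic_class E \<sigma> n (radical_const F n s a) (skew_const E (radical_gen F n s))"
    and x_def: "x = cyclic_class E \<sigma> n (radical_const F n s a) (skew_var E)"
begin

abbreviation "rc \<equiv> radical_const F n s"
abbreviation "\<pi> \<equiv> radical_class F n s"
abbreviation "cls \<equiv> cyclic_class E \<sigma> n (rc a)"

sublocale F: field F by (rule F)

sublocale P: cring "poly_ring F"
  by (rule F.univ_poly_is_cring[OF F.carrier_is_subring])

lemma X_closed: "X\<^bsub>F\<^esub> \<in> carrier (poly_ring F)"
  by (rule F.var_closed(1)[OF F.carrier_is_subring])

lemma const_hom_P: "F.poly_of_const \<in> ring_hom F (poly_ring F)"
  using F.canonical_embedding_is_hom[OF F.carrier_is_subring] by (simp add: ring_hom_def)

lemma binomial_closed: "binomial_poly F n s \<in> carrier (poly_ring F)"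
  unfolding binomial_poly_def
  using X_closed ring_hom_closed[OF const_hom_P s] by simp

lemma ideal_J: "ideal (PIdl\<^bsub>poly_ring F\<^esub> binomial_poly F n s) (poly_ring F)"
  by (rule P.cgenideal_ideal[OF binomial_closed])

lemma E_eq: "E = poly_ring F Quot (PIdl\<^bsub>poly_ring F\<^esub> binomial_poly F n s)"
  unfolding E_def radical_algebra_def rupture_def ..

lemma \<pi>_hom: "\<pi> \<in> ring_hom (poly_ring F) E"
  using ideal.rcos_ring_hom[OF ideal_J] unfolding E_eq radical_class_def[abs_def] .

lemma ring_E: "ring E"
  unfolding E_eq by (rule ideal.quotient_is_ring[OF ideal_J])

lemma \<pi>_surj: "carrier E = \<pi> ` carrier (poly_ring F)"
  unfolding E_eq radical_class_def[abs_def] by (auto simp: FactRing_def A_RCOSETS_def')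

lemma \<pi>_gen: "radical_gen F n s [^]\<^bsub>E\<^esub> n = rc s"
proof -
  let ?P = "poly_ring F"
  interpret \<pi>: ring_hom_ring ?P E \<pi>
    by (rule ring_hom_ringI2[OF P.ring_axioms ring_E \<pi>_hom])
  have c: "X\<^bsub>F\<^esub> [^]\<^bsub>?P\<^esub> n \<in> carrier ?P" "F.poly_of_const s \<in> carrier ?P"
    using X_closed ring_hom_closed[OF const_hom_P s] by simp_all
  have "\<pi> (binomial_poly F n s) = \<zero>\<^bsub>E\<^esub>"
    unfolding radical_class_def E_eq
    by (rule ideal_coset_zero[OF ideal_J P.cgenideal_self[OF binomial_closed]])
  then have "\<pi> (X\<^bsub>F\<^esub> [^]\<^bsub>?P\<^esub> n) \<ominus>\<^bsub>E\<^esub> \<pi> (F.poly_of_const s) = \<zero>\<^bsub>E\<^esub>"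
    unfolding binomial_poly_def P.minus_eq \<pi>.S.minus_eq using c by simp
  then have "\<pi> (X\<^bsub>F\<^esub> [^]\<^bsub>?P\<^esub> n) = \<pi> (F.poly_of_const s)"
    using \<pi>.hom_closed[OF c(1)] \<pi>.hom_closed[OF c(2)] by simp
  then show ?thesis
    unfolding radical_gen_def radical_const_def using \<pi>.hom_nat_pow[OF X_closed] by simp
qed

lemma \<sigma>_hom: "\<sigma> \<in> ring_hom E E"
  using \<sigma>_aut by (simp add: aut_group_def)

sublocale sp: skew_polynomials E \<sigma>
  by (intro skew_polynomials.intro skew_polynomials_axioms.intro ring_E \<sigma>_hom)

lemma rc_hom: "rc \<in> ring_hom F E"
  using ring_hom_trans[OF const_hom_P \<pi>_hom] unfolding radical_const_def[abs_def] comp_def .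

lemma gen_closed: "radical_gen F n s \<in> carrier E"
  unfolding radical_gen_def by (rule ring_hom_closed[OF \<pi>_hom X_closed])

lemma generator_closed:
  "skew_var E [^]\<^bsub>sp.S\<^esub> n \<ominus>\<^bsub>sp.S\<^esub> skew_const E (rc a) \<in> carrier sp.S"
  by (intro sp.S.minus_closed sp.S.nat_pow_closed sp.var_closed_S sp.const_closed ring_hom_closed[OF rc_hom a])

lemma ideal_C: "ideal (cyclic_ideal E \<sigma> n (rc a)) sp.S"
  unfolding cyclic_ideal_def by (rule sp.S.genideal_ideal) (use generator_closed in blast)

lemma A_eq: "A = sp.S Quot cyclic_ideal E \<sigma> n (rc a)"
  unfolding A_def cyclic_algebra_def ..

lemma ring_A: "ring A"
  unfolding A_eq by (rule ideal.quotient_is_ring[OF ideal_C])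

lemma cls_hom: "cls \<in> ring_hom sp.S A"
  using ideal.rcos_ring_hom[OF ideal_C] unfolding A_eq cyclic_class_def[abs_def] .

lemma cls_surj: "carrier A = cls ` carrier sp.S"
  unfolding A_eq cyclic_class_def[abs_def] by (auto simp: FactRing_def A_RCOSETS_def')

sublocale cls: ring_hom_ring sp.S A cls
  by (rule ring_hom_ringI2[OF sp.S.ring_axioms ring_A cls_hom])

lemma E_A_hom: "(\<lambda>e. cls (skew_const E e)) \<in> ring_hom E A"
  using ring_hom_trans[OF sp.const_hom cls_hom] unfolding comp_def .

lemma \<iota>_hom: "\<iota> \<in> ring_hom F A"
proof -
  have "\<iota> = (\<lambda>c. cls (skew_const E (rc c)))" using \<iota>_def by (simp add: fun_eq_iff)
  then show ?thesis using ring_hom_trans[OF rc_hom E_A_hom] by (simp add: comp_def)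
qed

lemma h_closed: "h \<in> carrier A"
  unfolding h_def by (rule ring_hom_closed[OF E_A_hom gen_closed])

lemma x_closed: "x \<in> carrier A"
  unfolding x_def by (rule cls.hom_closed[OF sp.var_closed_S])

lemma h_pow: "h [^]\<^bsub>A\<^esub> n = \<iota> s"
proof -
  interpret EA: ring_hom_ring E A "\<lambda>e. cls (skew_const E e)"
    by (rule ring_hom_ringI2[OF ring_E ring_A E_A_hom])
  show ?thesis unfolding h_def \<iota>_def using EA.hom_nat_pow[OF gen_closed, of n] \<pi>_gen by simp
qed

lemma x_pow: "x [^]\<^bsub>A\<^esub> n = \<iota> a"
proof -
  let ?g = "skew_var E [^]\<^bsub>sp.S\<^esub> n \<ominus>\<^bsub>sp.S\<^esub> skew_const E (rc a)"
  have c: "skew_var E [^]\<^bsub>sp.S\<^esub> n \<in> carrier sp.S" "skew_const E (rc a) \<in> carrier sp.S"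
    by (intro sp.S.nat_pow_closed sp.var_closed_S, intro sp.const_closed ring_hom_closed[OF rc_hom a])
  have g: "?g \<in> cyclic_ideal E \<sigma> n (rc a)"
    unfolding cyclic_ideal_def by (rule sp.S.genideal_self'[OF generator_closed])
  have "cls ?g = \<zero>\<^bsub>A\<^esub>"
    unfolding cyclic_class_def A_eq by (rule ideal_coset_zero[OF ideal_C g])
  then have "cls (skew_var E [^]\<^bsub>sp.S\<^esub> n) \<ominus>\<^bsub>A\<^esub> cls (skew_const E (rc a)) = \<zero>\<^bsub>A\<^esub>"
    unfolding sp.S.minus_eq cls.S.minus_eq using c by simp
  then have "cls (skew_var E [^]\<^bsub>sp.S\<^esub> n) = cls (skew_const E (rc a))"
    using cls.hom_closed[OF c(1)] cls.hom_closed[OF c(2)] by simp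
  then show ?thesis
    unfolding x_def \<iota>_def using cls.hom_nat_pow[OF sp.var_closed_S, of n] by simp
qed

lemma x_h: "x \<otimes>\<^bsub>A\<^esub> h = \<iota> q \<otimes>\<^bsub>A\<^esub> (h \<otimes>\<^bsub>A\<^esub> x)"
proof -
  have rq: "rc q \<in> carrier E" by (rule ring_hom_closed[OF rc_hom q])
  have "x \<otimes>\<^bsub>A\<^esub> h = cls (skew_var E \<otimes>\<^bsub>sp.S\<^esub> skew_const E (radical_gen F n s))"
    unfolding x_def h_def by (rule cls.hom_mult[OF sp.var_closed_S sp.const_closed[OF gen_closed], symmetric])
  also have "\<dots> = cls (skew_const E (rc q \<otimes>\<^bsub>E\<^esub> radical_gen F n s) \<otimes>\<^bsub>sp.S\<^esub> skew_var E)"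
    unfolding sp.var_const[OF gen_closed] \<sigma>_h ..
  also have "\<dots> = cls (skew_const E (rc q \<otimes>\<^bsub>E\<^esub> radical_gen F n s)) \<otimes>\<^bsub>A\<^esub> x"
    unfolding x_def
    by (rule cls.hom_mult[OF sp.const_closed[OF sp.E.m_closed[OF rq gen_closed]] sp.var_closed_S])
  also have "cls (skew_const E (rc q \<otimes>\<^bsub>E\<^esub> radical_gen F n s)) = \<iota> q \<otimes>\<^bsub>A\<^esub> h"
    unfolding \<iota>_def h_def by (rule ring_hom_mult[OF E_A_hom rq gen_closed])
  also have "\<iota> q \<otimes>\<^bsub>A\<^esub> h \<otimes>\<^bsub>A\<^esub> x = \<iota> q \<otimes>\<^bsub>A\<^esub> (h \<otimes>\<^bsub>A\<^esub> x)"
    by (rule cls.S.m_assoc[OF ring_hom_closed[OF \<iota>_hom q] h_closed x_closed])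
  finally show ?thesis .
qed

text \<open>Two layers of quotients have to be reached. Classes of polynomials over \<open>F\<close>
  become polynomials in \<open>h\<close>, which gives the image of \<open>E\<close>; sums of their
  products with powers of \<open>x\<close> then give all of \<open>A\<close>.\<close>

lemma generated_by:
  assumes W: "subring W A" and "\<iota> ` carrier F \<subseteq> W" "h \<in> W" "x \<in> W"
  shows "carrier A \<subseteq> W"
proof -
  note Wm = subringE(6)[OF W] and Wa = subringE(7)[OF W]
  have Wp: "u [^]\<^bsub>A\<^esub> (i::nat) \<in> W" if "u \<in> W" for u i
  proof (induction i)
    case 0
    show ?case using subringE(3)[OF W] by simp
  next
    case (Suc i)
    then show ?case using Wm[OF Suc that] by simp
  qed
  let ?\<Psi> = "\<lambda>p. cls (skew_const E (\<pi> p))"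
  have \<Psi>: "?\<Psi> \<in> ring_hom (poly_ring F) A"
    using ring_hom_trans[OF \<pi>_hom E_A_hom] unfolding comp_def .
  interpret \<Psi>: ring_hom_ring "poly_ring F" A ?\<Psi>
    by (rule ring_hom_ringI2[OF P.ring_axioms ring_A \<Psi>])
  have X: "?\<Psi> X\<^bsub>F\<^esub> \<in> W" using assms(3) unfolding h_def radical_gen_def .
  have ev: "?\<Psi> (P.eval l X\<^bsub>F\<^esub>) \<in> W"
    if "set l \<subseteq> carrier (poly_ring F)" "\<And>b. b \<in> set l \<Longrightarrow> ?\<Psi> b \<in> W" for l
    using that
  proof (induction l)
    case Nil
    show ?case using \<Psi>.hom_zero subringE(2)[OF W] by simp
  next
    case (Cons b l)
    have c: "b \<in> carrier (poly_ring F)" "X\<^bsub>F\<^esub> [^]\<^bsub>poly_ring F\<^esub> length l \<in> carrier (poly_ring F)"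
      "P.eval l X\<^bsub>F\<^esub> \<in> carrier (poly_ring F)"
      using Cons.prems(1) X_closed P.eval_in_carrier[of l] by auto
    have "?\<Psi> (P.eval (b # l) X\<^bsub>F\<^esub>) = ?\<Psi> b \<otimes>\<^bsub>A\<^esub> ?\<Psi> X\<^bsub>F\<^esub> [^]\<^bsub>A\<^esub> length l \<oplus>\<^bsub>A\<^esub> ?\<Psi> (P.eval l X\<^bsub>F\<^esub>)"
      using \<Psi>.hom_add[OF P.m_closed[OF c(1,2)] c(3)] \<Psi>.hom_mult[OF c(1,2)]
        \<Psi>.hom_nat_pow[OF X_closed, of "length l"] by simp
    moreover have "?\<Psi> b \<in> W" "?\<Psi> (P.eval l X\<^bsub>F\<^esub>) \<in> W"
      using Cons by auto
    ultimately show ?case using Wa[OF Wm[OF _ Wp[OF X]]] by simp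
  qed
  have \<Psi>W: "?\<Psi> p \<in> W" if p: "p \<in> carrier (poly_ring F)" for p
  proof -
    have set_p: "set p \<subseteq> carrier F"
      using p F.polynomial_incl unfolding univ_poly_carrier[symmetric] by blast
    \<comment> \<open>A polynomial is its own value at the variable once its coefficients are read
      as constants, so its class is a polynomial in \<open>h\<close> with coefficients from
      \<open>\<iota>\<close>.\<close>
    have "?\<Psi> (P.eval (map F.poly_of_const p) X\<^bsub>F\<^esub>) \<in> W"
    proof (rule ev)
      show "set (map F.poly_of_const p) \<subseteq> carrier (poly_ring F)"
        using set_p ring_hom_closed[OF const_hom_P] by auto
      fix b assume "b \<in> set (map F.poly_of_const p)"
      then obtain c where c: "c \<in> carrier F" "b = F.poly_of_const c" using set_p by auto
      have "?\<Psi> b = \<iota> c" unfolding c(2) \<iota>_def radical_const_def ..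
      then show "?\<Psi> b \<in> W" using assms(2) c(1) by auto
    qed
    then show ?thesis using F.eval_rewrite[OF F.carrier_is_subring p] by simp
  qed
  have "f \<in> {f \<in> carrier sp.S. cls f \<in> W}" if "f \<in> carrier sp.S" for f
  proof (rule sp.S_induct[OF _ _ _ that])
    fix f g assume fg: "f \<in> {f \<in> carrier sp.S. cls f \<in> W}" "g \<in> {f \<in> carrier sp.S. cls f \<in> W}"
    then show "f \<oplus>\<^bsub>sp.S\<^esub> g \<in> {f \<in> carrier sp.S. cls f \<in> W}" using Wa[of "cls f" "cls g"] by simp
  next
    show "\<zero>\<^bsub>sp.S\<^esub> \<in> {f \<in> carrier sp.S. cls f \<in> W}"
      using cls.hom_zero subringE(2)[OF W] by simp
  next
    fix e and N :: nat assume e: "e \<in> carrier E"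
    then obtain p where p: "p \<in> carrier (poly_ring F)" "e = \<pi> p" unfolding \<pi>_surj by blast
    have c: "skew_const E e \<in> carrier sp.S" "skew_var E [^]\<^bsub>sp.S\<^esub> N \<in> carrier sp.S"
      by (rule sp.const_closed[OF e], rule sp.S.nat_pow_closed[OF sp.var_closed_S])
    have "cls (skew_const E e \<otimes>\<^bsub>sp.S\<^esub> skew_var E [^]\<^bsub>sp.S\<^esub> N) = ?\<Psi> p \<otimes>\<^bsub>A\<^esub> x [^]\<^bsub>A\<^esub> N"
      unfolding x_def p(2)[symmetric]
      using cls.hom_mult[OF c] cls.hom_nat_pow[OF sp.var_closed_S, of N] by simp
    then show "skew_const E e \<otimes>\<^bsub>sp.S\<^esub> skew_var E [^]\<^bsub>sp.S\<^esub> N \<in> {f \<in> carrier sp.S. cls f \<in> W}"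
      using Wm[OF \<Psi>W[OF p(1)] Wp[OF assms(4)]] sp.S.m_closed[OF c] by simp
  qed
  then show ?thesis unfolding cls_surj by blast
qed

end


text \<open>All exponents \<open>k\<close> with \<open>y [^] k \<in> W\<close> are multiples of the
  least positive one, \<open>k0\<close>. A prime factor of \<open>k0\<close> would divide
  \<open>n\<close> and each of these exponents, against \<open>coprime\<close>; so \<open>k0\<close>
  is 1.\<close>

lemma (in central_subfield) root_in_subring:
  fixes n :: nat
  assumes W: "subring W R" "K \<subseteq> W" and y: "y \<in> carrier R" "y [^] n \<in> K" "y [^] n \<noteq> \<zero>" and n: "n > 0"
    and coprime: "\<And>r. Factorial_Ring.prime r \<Longrightarrow> r dvd n \<Longrightarrow> \<exists>k. y [^] (k::nat) \<in> W \<and> \<not> r dvd k"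
  shows "y \<in> W"
proof -
  let ?P = "\<lambda>k. k > 0 \<and> y [^] (k::nat) \<in> W"
  define k0 where "k0 = (LEAST k. ?P k)"
  have Pn: "?P n" using y(2) W(2) n by auto
  have Pk0: "?P k0" unfolding k0_def by (rule LeastI[of ?P, OF Pn])
  have least: "\<not> ?P k" if "k < k0" for k
    using not_less_Least[of k ?P] that unfolding k0_def .
  have Wm: "u \<otimes> v \<in> W" if "u \<in> W" "v \<in> W" for u v by (rule subringE(6)[OF W(1) that])
  have Wp: "u [^] (i::nat) \<in> W" if "u \<in> W" for u i
  proof (induction i)
    case 0
    show ?case using subringE(3)[OF W(1)] by simp
  next
    case (Suc i)
    then show ?case using Wm[OF Suc that] by simp
  qed
  have dvd: "k0 dvd k" if k: "y [^] k \<in> W" for k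
  proof (rule ccontr)
    assume "\<not> k0 dvd k"
    then have r: "0 < k mod k0" "k mod k0 < k0" using Pk0 by (simp_all add: dvd_eq_mod_eq_0)
    let ?q = "k div k0" and ?c = "(y [^] n) [^] (k0 * (k div k0))"
    have cK: "?c \<in> K" by (rule K_pow_closed[OF y(2)])
    have c0: "?c \<noteq> \<zero>" by (rule Units_neq_zero[OF Units_pow[OF K_Units[OF y(2,3)]]])
    \<comment> \<open>Instead of lowering the exponent by \<open>k0 * ?q\<close> it is raised by
      \<open>n - 1\<close> times that amount; the result differs by a power of the invertible scalar
      \<open>y [^] n\<close>, which is then cancelled.\<close>
    have e: "k + k0 * ?q * (n - 1) = n * (k0 * ?q) + k mod k0"
    proof -
      obtain l where l: "n = Suc l" using n by (cases n) auto
      have "k = k0 * ?q + k mod k0" by simp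
      then show ?thesis unfolding l by (simp add: algebra_simps)
    qed
    have "y [^] k \<otimes> (y [^] k0) [^] (?q * (n - 1)) \<in> W"
      by (rule Wm[OF k Wp[OF conjunct2[OF Pk0]]])
    also have "y [^] k \<otimes> (y [^] k0) [^] (?q * (n - 1)) = ?c \<otimes> y [^] (k mod k0)"
      using e y(1) by (simp add: nat_pow_pow nat_pow_mult mult.assoc)
    finally have "?c \<otimes> y [^] (k mod k0) \<in> W" .
    then have "inv ?c \<otimes> (?c \<otimes> y [^] (k mod k0)) \<in> W"
      using Wm[OF subsetD[OF W(2) K_inv(1)[OF cK c0]]] by blast
    also have "inv ?c \<otimes> (?c \<otimes> y [^] (k mod k0)) = y [^] (k mod k0)"
      using m_assoc[OF K_carrier[OF K_inv(1)[OF cK c0]] K_carrier[OF cK] nat_pow_closed[OF y(1)], of "k mod k0"]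
        K_inv(4)[OF cK c0] y(1) by simp
    finally show False using least[OF r(2)] r(1) by blast
  qed
  have "k0 = 1"
  proof (rule ccontr)
    assume "k0 \<noteq> 1"
    then obtain r where r: "Factorial_Ring.prime r" "r dvd k0" using prime_factor_nat by blast
    then obtain k where k: "y [^] k \<in> W" "\<not> r dvd k"
      using coprime[OF r(1) dvd_trans[OF r(2)]] dvd[OF conjunct2[OF Pn]] by blast
    then show False using dvd_trans[OF r(2) dvd[OF k(1)]] by blast
  qed
  then show ?thesis using Pk0 y(1) by simp
qed

lemma (in central_subfield) iprod_Unit:
  "(\<And>i. i \<in> {1..l} \<Longrightarrow> u i \<in> Units R) \<Longrightarrow> iprod l u \<in> Units R"
  by (induction l) auto

text \<open>Conjugation is multiplicative and fixes every factor except possibly the one at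
  \<open>i\<close>, whose eigenvalue moves to the front because it is central.\<close>

lemma (in central_subfield) conj_by_iprod:
  assumes g: "g \<in> Units R" and u: "\<And>j. j \<in> {1..l} \<Longrightarrow> u j \<in> carrier R"
    and comm: "\<And>j. j \<in> {1..l} \<Longrightarrow> j \<noteq> i \<Longrightarrow> g \<otimes> u j = u j \<otimes> g"
    and c: "c \<in> K" and eigen: "i \<in> {1..l} \<Longrightarrow> conj_by g (u i) = c \<otimes> u i"
  shows "conj_by g (iprod l u) = (if i \<in> {1..l} then c \<otimes> iprod l u else iprod l u)"
  using u comm eigen
proof (induction l)
  case 0
  have "conj_by g \<one> = \<one>" using g by (simp add: conj_by_def Units_closed)
  then show ?case by simp
next
  case (Suc l)
  have cl: "iprod l u \<in> carrier R" by (rule iprod_closed) (use Suc.prems(1) in simp)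
  have us: "u (Suc l) \<in> carrier R" using Suc.prems(1) by simp
  have IH: "conj_by g (iprod l u) = (if i \<in> {1..l} then c \<otimes> iprod l u else iprod l u)"
    by (rule Suc.IH) (use Suc.prems in auto)
  have split: "conj_by g (iprod (Suc l) u) = conj_by g (iprod l u) \<otimes> conj_by g (u (Suc l))"
    using conj_by_mult[OF g cl us] by simp
  show ?case
  proof (cases "i = Suc l")
    case True
    then have "conj_by g (u (Suc l)) = c \<otimes> u (Suc l)" using Suc.prems(3) by simp
    moreover have "conj_by g (iprod l u) = iprod l u" using IH True by simp
    moreover have "iprod l u \<otimes> (c \<otimes> u (Suc l)) = c \<otimes> (iprod l u \<otimes> u (Suc l))"
      by (rule K_lcomm[OF c cl us])
    ultimately show ?thesis using True split by simp
  next
    case False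
    then have "conj_by g (u (Suc l)) = u (Suc l)"
      using conj_by_commute[OF g us] Suc.prems(2)[of "Suc l"] by simp
    moreover have "i \<in> {1..Suc l} \<longleftrightarrow> i \<in> {1..l}" using False by auto
    ultimately show ?thesis
      using split IH m_assoc[OF K_carrier[OF c] cl us] by simp
  qed
qed

section \<open>Coprime powers of a pair and the tensor decomposition\<close>

context quantum_pair
begin

lemma \<omega>_pow_eq_one_iff: "\<omega> [^] j = \<one> \<longleftrightarrow> N dvd j" for j :: nat
proof
  assume "N dvd j"
  then obtain l where "j = N * l" by (elim dvdE)
  then show "\<omega> [^] j = \<one>" using nat_pow_pow[OF K_carrier[OF \<omega>_K], of N l] \<omega>_pow_N by simp
next
  assume 1: "\<omega> [^] j = \<one>"
  have "\<omega> [^] (N * (j div N)) = \<one>"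
    using nat_pow_pow[OF K_carrier[OF \<omega>_K], of N "j div N"] \<omega>_pow_N by simp
  moreover have "\<omega> [^] (N * (j div N)) \<otimes> \<omega> [^] (j mod N) = \<omega> [^] j"
    using nat_pow_mult[OF K_carrier[OF \<omega>_K], of "N * (j div N)" "j mod N"] by simp
  ultimately have "\<omega> [^] (j mod N) = \<one>" using 1 \<omega>_K by simp
  then have "j mod N = 0" using \<omega>_primitive[of "j mod N"] N_pos by auto
  then show "N dvd j" by (simp add: dvd_eq_mod_eq_0)
qed

text \<open>Interchanging \<open>z [^] k\<close> and \<open>y [^] k\<close> costs a factor
  \<open>\<omega>\<close> for each of the \<open>k^2\<close> crossings. This factor has order
  exactly \<open>N'\<close>: if \<open>k * N'\<close> divides \<open>k * k * i\<close>, then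
  \<open>N'\<close> divides \<open>k * i\<close> and, by coprimality, \<open>i\<close>.\<close>

lemma quantum_pair_power:
  assumes N: "N = k * N'" and coprime: "coprime k N'"
  shows "quantum_pair R K (\<omega> [^] (k\<^sup>2)) (y [^] k) (z [^] k) N'"
proof (intro quantum_pair.intro central_subfield_axioms quantum_pair_axioms.intro)
  have y: "(y [^] k) [^] N' = y [^] N" and z: "(z [^] k) [^] N' = z [^] N"
    using y_closed z_closed by (simp_all add: N nat_pow_pow)
  show "N' > 0" using N N_pos by (cases N') auto
  show "\<omega> [^] (k\<^sup>2) \<in> K" using \<omega>_K by (rule K_pow_closed)
  have pow: "(\<omega> [^] (k\<^sup>2)) [^] i = \<omega> [^] (k\<^sup>2 * i)" for i :: nat
    using \<omega>_K by (simp add: nat_pow_pow)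
  show "(\<omega> [^] (k\<^sup>2)) [^] N' = \<one>"
    unfolding pow \<omega>_pow_eq_one_iff N by (simp add: power2_eq_square)
  show "(\<omega> [^] (k\<^sup>2)) [^] i \<noteq> \<one>" if i: "0 < i" "i < N'" for i
  proof
    assume "(\<omega> [^] (k\<^sup>2)) [^] i = \<one>"
    then have "k * N' dvd k * (k * i)"
      unfolding pow \<omega>_pow_eq_one_iff N by (simp add: power2_eq_square mult.assoc)
    then have "N' dvd k * i" using N N_pos by simp
    then have "N' dvd i" using coprime by (metis coprime_commute coprime_dvd_mult_right_iff)
    then show False using i by (auto dest: dvd_imp_le)
  qed
  show "y [^] k \<in> carrier R" "z [^] k \<in> carrier R" using y_closed z_closed by simp_all
  show "(y [^] k) [^] N' \<in> K" "(y [^] k) [^] N' \<noteq> \<zero>" unfolding y by (fact y_pow_N)+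
  show "(z [^] k) [^] N' \<in> K" "(z [^] k) [^] N' \<noteq> \<zero>" unfolding z by (fact z_pow_N)+
  show "z [^] k \<otimes> y [^] k = \<omega> [^] (k\<^sup>2) \<otimes> (y [^] k \<otimes> z [^] k)"
    using z_pow_y_pow[of k k] by (simp add: power2_eq_square)
qed

lemma powers_commute:
  assumes "N dvd j * k"
  shows "z [^] j \<otimes> y [^] k = y [^] k \<otimes> z [^] j"
proof -
  have "\<omega> [^] (j * k) = \<one>" using assms by (simp only: \<omega>_pow_eq_one_iff)
  then show ?thesis unfolding z_pow_y_pow using y_closed z_closed by simp
qed

end

text \<open>For the last claim, \<open>p i ^ m i\<close> survives in \<open>n div p j ^ m j\<close>
  and so supplies the part of \<open>n\<close> that is missing from
  \<open>n div p i ^ m i\<close>.\<close>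

lemma prime_power_factors:
  fixes p m :: "nat \<Rightarrow> nat" and n d :: nat
  assumes n: "n = (\<Prod>i=1..d. p i ^ m i)" and prime: "\<And>i. i \<in> {1..d} \<Longrightarrow> Factorial_Ring.prime (p i)"
    and inj: "inj_on p {1..d}" and i: "i \<in> {1..d}"
  shows "n = (n div p i ^ m i) * p i ^ m i" "coprime (n div p i ^ m i) (p i ^ m i)"
    "j \<in> {1..d} \<Longrightarrow> i \<noteq> j \<Longrightarrow> n dvd (n div p i ^ m i) * (n div p j ^ m j)"
proof -
  let ?R = "\<lambda>i. \<Prod>j\<in>{1..d} - {i}. p j ^ m j"
  have rem: "n = p i ^ m i * ?R i" if "i \<in> {1..d}" for i
    unfolding n by (rule prod.remove[OF finite_atLeastAtMost that])
  have div: "n div p i ^ m i = ?R i" if "i \<in> {1..d}" for i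
  proof -
    have "(p i ^ m i * ?R i) div p i ^ m i = ?R i"
      by (rule nonzero_mult_div_cancel_left) (use prime_gt_0_nat[OF prime[OF that]] in simp)
    then show ?thesis unfolding rem[OF that, symmetric] .
  qed
  have mult: "n = (n div p i ^ m i) * p i ^ m i" if "i \<in> {1..d}" for i
    unfolding div[OF that] by (rule trans[OF rem[OF that] mult.commute])
  show "n = (n div p i ^ m i) * p i ^ m i" by (rule mult[OF i])
  show "coprime (n div p i ^ m i) (p i ^ m i)"
    unfolding div[OF i]
  proof (rule prod_coprime_left)
    fix j assume j: "j \<in> {1..d} - {i}"
    then have "p j \<noteq> p i" using inj_onD[OF inj, of j i] i by blast
    then show "coprime (p j ^ m j) (p i ^ m i)"
      using primes_coprime[of "p j" "p i"] prime[of j] prime[OF i] j by simp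
  qed
  assume j: "j \<in> {1..d}" "i \<noteq> j"
  have "p i ^ m i dvd n div p j ^ m j"
    unfolding div[OF j(1)] by (rule dvd_prodI[of "{1..d} - {j}" i "\<lambda>j. p j ^ m j"]) (use i j in auto)
  then have "(n div p i ^ m i) * p i ^ m i dvd (n div p i ^ m i) * (n div p j ^ m j)"
    by (rule mult_dvd_mono[OF dvd_refl])
  then show "n dvd (n div p i ^ m i) * (n div p j ^ m j)" unfolding mult[OF i, symmetric] .
qed


text \<open>Two different tuples of monomials differ at some \<open>i\<close>, and there one of the
  two conjugations belonging to \<open>i\<close> has different eigenvalues; on the other positions
  it acts trivially. This gives independence. Generation holds because every prime factor of
  \<open>N\<close> fails to divide some \<open>n' i\<close>, so \<open>root_in_subring\<close>
  recovers \<open>y\<close> and \<open>z\<close>.\<close>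

lemma (in quantum_pair) tensor_decomposition:
  fixes d :: nat and n' N' :: "nat \<Rightarrow> nat"
  assumes N: "\<And>i. i \<in> {1..d} \<Longrightarrow> N = n' i * N' i" "\<And>i. i \<in> {1..d} \<Longrightarrow> coprime (n' i) (N' i)"
    and dvd: "\<And>i j. i \<in> {1..d} \<Longrightarrow> j \<in> {1..d} \<Longrightarrow> i \<noteq> j \<Longrightarrow> N dvd n' i * n' j"
    and prime: "\<And>r. Factorial_Ring.prime r \<Longrightarrow> r dvd N \<Longrightarrow> \<exists>i\<in>{1..d}. \<not> r dvd n' i"
    and gen: "\<And>W. subring W R \<Longrightarrow> K \<subseteq> W \<Longrightarrow> y \<in> W \<Longrightarrow> z \<in> W \<Longrightarrow> carrier R \<subseteq> W"
  shows "tensor_product_of_subalgebras K R {1..d} (\<lambda>i. generate_ring R (K \<union> {y [^] n' i, z [^] n' i}))"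
proof -
  let ?y = "\<lambda>i. y [^] n' i" and ?z = "\<lambda>i. z [^] n' i" and ?\<omega> = "\<lambda>i. \<omega> [^] (n' i)\<^sup>2"
  let ?V = "\<lambda>i. generate_ring R (K \<union> {?y i, ?z i})"
  let ?J = "\<lambda>i. {..<N' i} \<times> {..<N' i}"
  let ?w = "\<lambda>i (r :: nat \<times> nat). ?y i [^] fst r \<otimes> ?z i [^] snd r"
  have pair: "quantum_pair R K (?\<omega> i) (?y i) (?z i) (N' i)" if "i \<in> {1..d}" for i
    by (rule quantum_pair_power[OF N[OF that]])
  have w: "?w i r = quantum_pair.mono R (?y i) (?z i) r" if "i \<in> {1..d}" for i r
    using quantum_pair.mono_def[OF pair[OF that]] by simp
  have V_eq: "?V i = lincombs (?J i) (?w i)" if i: "i \<in> {1..d}" for i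
    using quantum_pair.generate_B[OF pair[OF i]] quantum_pair.B_def[OF pair[OF i]] w[OF i]
    by (simp only: )
  have KV: "K \<union> {?y i, ?z i} \<subseteq> carrier R" for i using y_closed z_closed by auto
  have yV: "?y i \<in> ?V i" and zV: "?z i \<in> ?V i" for i by (intro generate_ring.incl; simp)+
  have V_commute: "u \<otimes> v = v \<otimes> u"
    if ij: "i \<in> {1..d}" "j \<in> {1..d}" "i \<noteq> j" and u: "u \<in> ?V i" and v: "v \<in> ?V j" for i j u v
  proof (rule generated_commute[OF _ _ _ u v])
    have pow: "u [^] a \<otimes> u [^] b = u [^] b \<otimes> u [^] a" if "u \<in> carrier R" for u and a b :: nat
      using that by (simp add: nat_pow_mult add.commute)
    have "?z i \<otimes> ?y j = ?y j \<otimes> ?z i" "?z j \<otimes> ?y i = ?y i \<otimes> ?z j"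
      by (rule powers_commute[OF dvd[OF ij]], rule powers_commute[OF dvd[OF ij(2,1)]])
        (use ij(3) in simp)
    then show "u' \<otimes> v' = v' \<otimes> u'" if "u' \<in> {?y i, ?z i}" "v' \<in> {?y j, ?z j}" for u' v'
      using that pow[OF y_closed, of "n' i" "n' j"] pow[OF z_closed, of "n' i" "n' j"] by auto
  qed (use y_closed z_closed in auto)
  interpret CS: commuting_subalgebras R K d ?V
  proof (intro commuting_subalgebras.intro central_subfield_axioms commuting_subalgebras_axioms.intro)
    show "subring (?V i) R" for i by (rule generate_ringE(1)[OF KV refl])
    show "K \<subseteq> ?V i" for i using generate_ringE(2)[OF KV refl] by blast
  qed (rule V_commute)
  let ?W = "\<Pi>\<^sub>E i\<in>{1..d}. ?w i ` ?J i"
  let ?g = "\<lambda>(i, b). if b then ?z i else inv (?y i)"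
  \<comment> \<open>Tuples in \<open>?W\<close> consist of ring elements; the exponents from which
    the characters are read off are recovered by choice.\<close>
  define e where "e = (\<lambda>u i. SOME r. r \<in> ?J i \<and> u i = ?w i r)"
  have e: "e u i \<in> ?J i \<and> u i = ?w i (e u i)" if "u \<in> ?W" "i \<in> {1..d}" for u i
    unfolding e_def by (rule someI_ex) (use PiE_mem[OF that] in blast)
  let ?\<chi> = "\<lambda>(i, b) u. ?\<omega> i [^] (if b then fst (e u i) else snd (e u i))"
  have yU: "?y i \<in> Units R" and zU: "?z i \<in> Units R" for i
    by (rule Units_pow[OF y_Unit], rule Units_pow[OF z_Unit])
  have wU: "?w i r \<in> Units R" for i r
    by (rule Units_m_closed[OF Units_pow[OF yU] Units_pow[OF zU]])
  have gU: "?g t \<in> Units R" for t using yU zU by (cases t) simp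
  have uU: "u i \<in> Units R" if "u \<in> ?W" "i \<in> {1..d}" for u i
    using e[OF that] wU by metis
  have uV: "u i \<in> ?V i" if "u \<in> ?W" "i \<in> {1..d}" for u i
  proof -
    have "u i = quantum_pair.mono R (?y i) (?z i) (e u i)" using e[OF that] w[OF that(2)] by simp
    then show ?thesis
      using quantum_pair.mono_in_B[OF pair[OF that(2)]] quantum_pair.generate_B[OF pair[OF that(2)]] by simp
  qed
  have gV: "?g (i, b) \<in> ?V i" if "i \<in> {1..d}" for i b
    using zV[of i] quantum_pair.inv_in_B(1)[OF pair[OF that]]
    unfolding quantum_pair.generate_B[OF pair[OF that]] by (cases b) simp_all
  have eigen: "conj_by (?g (i, b)) (iprod d u) = ?\<chi> (i, b) u \<otimes> iprod d u"
    if i: "i \<in> {1..d}" and u: "u \<in> ?W" for i b u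
  proof -
    interpret Q: quantum_pair R K "?\<omega> i" "?y i" "?z i" "N' i" by (rule pair[OF i])
    have ui: "u i = Q.mono (e u i)" using e[OF u i] w[OF i] by simp
    have "conj_by (?g (i, b)) (iprod d u) =
        (if i \<in> {1..d} then ?\<chi> (i, b) u \<otimes> iprod d u else iprod d u)"
    proof (rule conj_by_iprod[OF gU])
      show "u j \<in> carrier R" if "j \<in> {1..d}" for j using Units_closed[OF uU[OF u that]] .
      show "?g (i, b) \<otimes> u j = u j \<otimes> ?g (i, b)" if "j \<in> {1..d}" "j \<noteq> i" for j
        by (rule V_commute[OF i that(1) that(2)[symmetric] gV[OF i] uV[OF u that(1)]])
      show "?\<chi> (i, b) u \<in> K" unfolding prod.case by (rule K_pow_closed[OF Q.\<omega>_K])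
      show "conj_by (?g (i, b)) (u i) = ?\<chi> (i, b) u \<otimes> u i"
        unfolding ui prod.case
        by (cases b; simp only: if_True if_False Q.conj_z_mono Q.conj_inv_y_mono)
    qed
    then show ?thesis by (simp only: if_P[OF i])
  qed
  show ?thesis
  proof (rule CS.tensor_product_internal[OF _ _ V_eq])
    show "finite (?J i)" for i by simp
    show "?w i \<in> ?J i \<rightarrow> carrier R" for i using Units_closed[OF wU] by blast
    show "lin_indep ?W (iprod d)"
    proof (rule eigenvectors_lin_indep[where D = "\<lambda>t. conj_by (?g t)" and \<chi> = ?\<chi> and \<Theta> = "{1..d} \<times> UNIV"])
      show "lin_map (conj_by (?g t))" for t by (rule lin_map_conj[OF gU])
      show "finite ?W" by (intro finite_PiE finite_imageI) simp_all
      have U: "iprod d u \<in> Units R" if "u \<in> ?W" for u by (rule iprod_Unit[OF uU[OF that]])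
      show "iprod d \<in> ?W \<rightarrow> carrier R" using Units_closed[OF U] by blast
      show "iprod d u \<noteq> \<zero>" if "u \<in> ?W" for u by (rule Units_neq_zero[OF U[OF that]])
      show "conj_by (?g t) (iprod d u) = ?\<chi> t u \<otimes> iprod d u" if "t \<in> {1..d} \<times> UNIV" "u \<in> ?W" for t u
      proof -
        obtain i b where t: "t = (i, b)" by (cases t)
        have "i \<in> {1..d}" using that(1) unfolding t by blast
        then show ?thesis unfolding t by (rule eigen[OF _ that(2)])
      qed
      show "?\<chi> t u \<in> K" if "t \<in> {1..d} \<times> UNIV" for t u
      proof -
        obtain i b where t: "t = (i, b)" by (cases t)
        show ?thesis unfolding t prod.case by (rule K_pow_closed[OF K_pow_closed[OF \<omega>_K]])
      qed
      fix u v assume uv: "u \<in> ?W" "v \<in> ?W" "u \<noteq> v"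
      then obtain i where i: "i \<in> {1..d}" "u i \<noteq> v i" using PiE_ext[OF uv(1,2)] by blast
      interpret Q: quantum_pair R K "?\<omega> i" "?y i" "?z i" "N' i" by (rule pair[OF i(1)])
      note eu = e[OF uv(1) i(1)] and ev = e[OF uv(2) i(1)]
      have "e u i \<noteq> e v i"
      proof
        assume *: "e u i = e v i"
        have "u i = ?w i (e u i)" by (rule conjunct2[OF eu])
        also have "\<dots> = ?w i (e v i)" by (simp only: *)
        also have "\<dots> = v i" by (rule conjunct2[OF ev, symmetric])
        finally show False using i(2) by blast
      qed
      from Q.separated[OF conjunct1[OF eu] conjunct1[OF ev] this]
      obtain b where "?\<chi> (i, b) u \<noteq> ?\<chi> (i, b) v" unfolding prod.case by blast
      moreover have "(i, b) \<in> {1..d} \<times> UNIV" using i(1) by blast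
      ultimately show "\<exists>t\<in>{1..d} \<times> UNIV. ?\<chi> t u \<noteq> ?\<chi> t v" by (rule bexI)
    qed
    fix W assume W: "subring W R" "K \<subseteq> W" "\<And>i. i \<in> {1..d} \<Longrightarrow> ?V i \<subseteq> W"
    have *: "\<exists>k. y [^] (k::nat) \<in> W \<and> \<not> r dvd k" "\<exists>k. z [^] (k::nat) \<in> W \<and> \<not> r dvd k"
      if r: "Factorial_Ring.prime r" "r dvd N" for r
    proof -
      obtain i where "i \<in> {1..d}" "\<not> r dvd n' i" using prime[OF r] by blast
      moreover have "?y i \<in> W" "?z i \<in> W" using W(3)[OF \<open>i \<in> {1..d}\<close>] yV zV by blast+
      ultimately show "\<exists>k. y [^] (k::nat) \<in> W \<and> \<not> r dvd k" "\<exists>k. z [^] (k::nat) \<in> W \<and> \<not> r dvd k"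
        by blast+
    qed
    show "carrier R \<subseteq> W"
      by (rule gen[OF W(1,2) root_in_subring[OF W(1,2) y_closed y_pow_N N_pos *(1)]
            root_in_subring[OF W(1,2) z_closed z_pow_N N_pos *(2)]])
  qed
qed

section \<open>The prime components of the cyclic algebra\<close>

theorem proposition2p25:
  fixes F :: "('a, 'b) ring_scheme"
    and q s a :: 'a
    and n d :: nat
    and p m :: "nat \<Rightarrow> nat"
    and E :: "'a list set ring"
    and \<sigma> :: "'a list set \<Rightarrow> 'a list set"
    and A :: "(nat \<Rightarrow> 'a list set) set ring"
    and \<iota> :: "'a \<Rightarrow> (nat \<Rightarrow> 'a list set) set"
    and h x :: "(nat \<Rightarrow> 'a list set) set"
    and K :: "(nat \<Rightarrow> 'a list set) set set"
    and n' :: "nat \<Rightarrow> nat"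
    and A_sub E_sub :: "nat \<Rightarrow> (nat \<Rightarrow> 'a list set) set set"
  assumes "field F" and "n \<ge> 2" and "primitive_root_of_unity F n q"
    and "s \<in> carrier F" and "a \<in> carrier F"
    and "s \<noteq> \<zero>\<^bsub>F\<^esub>" and "a \<noteq> \<zero>\<^bsub>F\<^esub>"
    \<comment> \<open>\<open>E = F[h]/(h\<^sup>n - s)\<close>, with its \<open>F\<close>-automorphism \<open>\<sigma>\<close>, \<open>\<sigma>(h) = qh\<close>\<close>
    and E_def: "E = radical_algebra F n s"
    and \<sigma>_aut: "\<sigma> \<in> carrier (aut_group E (radical_const F n s ` carrier F))"
    and \<sigma>_h: "\<sigma> (radical_gen F n s) = radical_const F n s q \<otimes>\<^bsub>E\<^esub> radical_gen F n s"
    \<comment> \<open>the algebra \<open>(E, \<sigma>, a)\<close>, the embedding of \<open>F\<close> into it, its generators \<open>h\<close> and \<open>x\<close>,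
        and the image \<open>K\<close> of \<open>F\<close>\<close>
    and A_def: "A = cyclic_algebra E \<sigma> n (radical_const F n s a)"
    and \<iota>_def: "\<And>c. \<iota> c = cyclic_class E \<sigma> n (radical_const F n s a)
                                 (skew_const E (radical_const F n s c))"
    and h_def: "h = cyclic_class E \<sigma> n (radical_const F n s a) (skew_const E (radical_gen F n s))"
    and x_def: "x = cyclic_class E \<sigma> n (radical_const F n s a) (skew_var E)"
    and K_def: "K = \<iota> ` carrier F"
    and Deg_A: "has_Deg K A n"
    \<comment> \<open>the factorization of \<open>n\<close>\<close>
    and "n = (\<Prod>i=1..d. p i ^ m i)"
    and "\<And>i. i \<in> {1..d} \<Longrightarrow> Factorial_Ring.prime (p i)"
    and "inj_on p {1..d}"
    and "\<And>i. i \<in> {1..d} \<Longrightarrow> m i \<ge> 1"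
    and n'_def: "\<And>i. n' i = n div p i ^ m i"
    and A_sub_def: "\<And>i. A_sub i = generate_ring A (K \<union> {h [^]\<^bsub>A\<^esub> n' i, x [^]\<^bsub>A\<^esub> n' i})"
    and E_sub_def: "\<And>i. E_sub i = generate_ring A (K \<union> {h [^]\<^bsub>A\<^esub> n' i})"
  shows "(\<forall>i\<in>{1..d}.
            (pirreducible\<^bsub>F\<^esub> (carrier F) (binomial_poly F (p i ^ m i) s) \<longleftrightarrow>
               s \<notin> (\<Union>j\<in>{1..m i}. kth_powers F (p i ^ j)))
          \<and> (pirreducible\<^bsub>F\<^esub> (carrier F) (binomial_poly F (p i ^ m i) s) \<longrightarrow>
               (let L = A\<lparr>carrier := E_sub i\<rparr>; G = aut_group L K in
                  finite_galois_extension L K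
                \<and> ring.dimension L (p i ^ m i) K (carrier L)
                \<and> (\<exists>!\<sigma>\<^sub>i. \<sigma>\<^sub>i \<in> carrier G
                      \<and> \<sigma>\<^sub>i (h [^]\<^bsub>A\<^esub> n' i) = \<iota> (q [^]\<^bsub>F\<^esub> ((n' i) ^ 2)) \<otimes>\<^bsub>A\<^esub> h [^]\<^bsub>A\<^esub> n' i)
                \<and> (\<forall>\<sigma>\<^sub>i\<in>carrier G.
                      \<sigma>\<^sub>i (h [^]\<^bsub>A\<^esub> n' i) = \<iota> (q [^]\<^bsub>F\<^esub> ((n' i) ^ 2)) \<otimes>\<^bsub>A\<^esub> h [^]\<^bsub>A\<^esub> n' i \<longrightarrow>
                      generate G {\<sigma>\<^sub>i} = carrier G \<and> group.ord G \<sigma>\<^sub>i = p i ^ m i)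
                \<and> group G \<and> cyclic_group G \<and> order G = p i ^ m i))
          \<and> has_Deg K (A\<lparr>carrier := A_sub i\<rparr>) (p i ^ m i))
        \<and> tensor_product_of_subalgebras K A {1..d} A_sub"
proof -
  note hyps = assms
  interpret F: field F by (rule hyps(1))
  have q: "q \<in> carrier F" "q [^]\<^bsub>F\<^esub> n = \<one>\<^bsub>F\<^esub>" "\<And>k. 0 < k \<Longrightarrow> k < n \<Longrightarrow> q [^]\<^bsub>F\<^esub> k \<noteq> \<one>\<^bsub>F\<^esub>"
    using hyps(3) by (auto simp: primitive_root_of_unity_def)
  interpret C: cyclic_algebra_setup F n q s a E \<sigma> A \<iota> h x
    by (rule cyclic_algebra_setup.intro[OF hyps(1) q(1) hyps(4,5) E_def \<sigma>_aut \<sigma>_h A_def \<iota>_def h_def x_def])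
  interpret \<iota>: ring_hom_ring F A \<iota> by (rule ring_hom_ringI2[OF F.ring_axioms C.ring_A C.\<iota>_hom])
  have sub: "subfield K A" and center: "ring_center A = K"
    using Deg_A by (simp_all add: has_Deg_def central_simple_def)
  \<comment> \<open>Central simplicity identifies \<open>K\<close> with the centre, so the scalars
    commute with everything.\<close>
  have "central_subfield A K"
  proof (intro central_subfield.intro C.ring_A central_subfield_axioms.intro sub)
    show "c \<otimes>\<^bsub>A\<^esub> v = v \<otimes>\<^bsub>A\<^esub> c" if "c \<in> K" "v \<in> carrier A" for c v
      using that unfolding center[symmetric] ring_center_def by blast
  qed
  then interpret A: central_subfield A K .
  have inj: "inj_on \<iota> (carrier F)"
  proof (rule \<iota>.non_trivial_field_hom_imp_inj[OF hyps(1)])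
    show "\<iota> ` carrier F \<noteq> {\<zero>\<^bsub>A\<^esub>}"
      using A.one_neq_zero \<iota>.hom_one F.one_closed by (metis imageI singletonD)
  qed
  have \<iota>_neq: "\<iota> u \<noteq> \<iota> v" if "u \<in> carrier F" "v \<in> carrier F" "u \<noteq> v" for u v
    using inj_onD[OF inj _ that(1,2)] that(3) by blast
  have \<iota>K: "\<iota> u \<in> K" if "u \<in> carrier F" for u using K_def that by blast
  have \<iota>_nz: "\<iota> u \<noteq> \<zero>\<^bsub>A\<^esub>" if "u \<in> carrier F" "u \<noteq> \<zero>\<^bsub>F\<^esub>" for u
    using \<iota>_neq[OF that(1) F.zero_closed that(2)] \<iota>.hom_zero by simp
  have \<iota>_pow: "\<iota> (u [^]\<^bsub>F\<^esub> k) = \<iota> u [^]\<^bsub>A\<^esub> k" if "u \<in> carrier F" for u and k :: nat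
    by (rule \<iota>.hom_nat_pow[OF that])
  \<comment> \<open>Injectivity of \<open>\<iota>\<close> keeps \<open>q\<close> a primitive root of
    unity in \<open>A\<close> and keeps the images of \<open>s\<close> and \<open>a\<close>
    nonzero.\<close>
  interpret Q: quantum_pair A K "\<iota> q" h x n
  proof (intro quantum_pair.intro A.central_subfield_axioms quantum_pair_axioms.intro)
    show "n > 0" using hyps(2) by simp
    show "\<iota> q \<in> K" by (rule \<iota>K[OF q(1)])
    show "\<iota> q [^]\<^bsub>A\<^esub> n = \<one>\<^bsub>A\<^esub>" using \<iota>_pow[OF q(1), of n] q(2) \<iota>.hom_one by simp
    show "\<iota> q [^]\<^bsub>A\<^esub> k \<noteq> \<one>\<^bsub>A\<^esub>" if "0 < k" "k < n" for k
      using \<iota>_neq[OF F.nat_pow_closed[OF q(1)] F.one_closed q(3)[OF that]] \<iota>_pow[OF q(1), of k]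
        \<iota>.hom_one by simp
    show "h \<in> carrier A" "x \<in> carrier A" by (rule C.h_closed, rule C.x_closed)
    show "h [^]\<^bsub>A\<^esub> n \<in> K" "h [^]\<^bsub>A\<^esub> n \<noteq> \<zero>\<^bsub>A\<^esub>"
      unfolding C.h_pow by (rule \<iota>K[OF hyps(4)], rule \<iota>_nz[OF hyps(4,6)])
    show "x [^]\<^bsub>A\<^esub> n \<in> K" "x [^]\<^bsub>A\<^esub> n \<noteq> \<zero>\<^bsub>A\<^esub>"
      unfolding C.x_pow by (rule \<iota>K[OF hyps(5)], rule \<iota>_nz[OF hyps(5,7)])
    show "x \<otimes>\<^bsub>A\<^esub> h = \<iota> q \<otimes>\<^bsub>A\<^esub> (h \<otimes>\<^bsub>A\<^esub> x)" by (rule C.x_h)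
  qed
  note n_eq = hyps(17) and prime_p = hyps(18) and inj_p = hyps(19) and m_pos = hyps(20)
  note factors = prime_power_factors[OF n_eq prime_p inj_p]
  have n_split: "n = n' i * p i ^ m i" and n_coprime: "coprime (n' i) (p i ^ m i)"
    if "i \<in> {1..d}" for i
    unfolding n'_def by (rule factors(1)[OF _ that], assumption) (rule factors(2)[OF _ that], assumption)
  have n_dvd: "n dvd n' i * n' j" if "i \<in> {1..d}" "j \<in> {1..d}" "i \<noteq> j" for i j
    unfolding n'_def by (rule factors(3)[OF _ that(1,2,3)])
  have components: "(pirreducible\<^bsub>F\<^esub> (carrier F) (binomial_poly F (p i ^ m i) s) \<longleftrightarrow>
               s \<notin> (\<Union>j\<in>{1..m i}. kth_powers F (p i ^ j)))
          \<and> (pirreducible\<^bsub>F\<^esub> (carrier F) (binomial_poly F (p i ^ m i) s) \<longrightarrow>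
               (let L = A\<lparr>carrier := E_sub i\<rparr>; G = aut_group L K in
                  finite_galois_extension L K
                \<and> ring.dimension L (p i ^ m i) K (carrier L)
                \<and> (\<exists>!\<sigma>\<^sub>i. \<sigma>\<^sub>i \<in> carrier G
                      \<and> \<sigma>\<^sub>i (h [^]\<^bsub>A\<^esub> n' i) = \<iota> (q [^]\<^bsub>F\<^esub> ((n' i) ^ 2)) \<otimes>\<^bsub>A\<^esub> h [^]\<^bsub>A\<^esub> n' i)
                \<and> (\<forall>\<sigma>\<^sub>i\<in>carrier G.
                      \<sigma>\<^sub>i (h [^]\<^bsub>A\<^esub> n' i) = \<iota> (q [^]\<^bsub>F\<^esub> ((n' i) ^ 2)) \<otimes>\<^bsub>A\<^esub> h [^]\<^bsub>A\<^esub> n' i \<longrightarrow>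
                      generate G {\<sigma>\<^sub>i} = carrier G \<and> group.ord G \<sigma>\<^sub>i = p i ^ m i)
                \<and> group G \<and> cyclic_group G \<and> order G = p i ^ m i))
          \<and> has_Deg K (A\<lparr>carrier := A_sub i\<rparr>) (p i ^ m i)"
    if i: "i \<in> {1..d}" for i
  proof -
    let ?y = "h [^]\<^bsub>A\<^esub> n' i" and ?z = "x [^]\<^bsub>A\<^esub> n' i" and ?N = "p i ^ m i"
    interpret P: quantum_pair A K "\<iota> q [^]\<^bsub>A\<^esub> (n' i)\<^sup>2" ?y ?z ?N
      by (rule Q.quantum_pair_power[OF n_split[OF i] n_coprime[OF i]])
    \<comment> \<open>\<open>h [^] n\<close> is the \<open>?N\<close>-th power of \<open>?y\<close>,
      so the constant is the same \<open>s\<close> for every prime.\<close>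
    have yN: "?y [^]\<^bsub>A\<^esub> ?N = \<iota> s"
      using C.cls.S.nat_pow_pow[OF C.h_closed, of "n' i" ?N] n_split[OF i] C.h_pow by simp
    have irr: "pirreducible\<^bsub>F\<^esub> (carrier F) (binomial_poly F ?N s) \<longleftrightarrow> field (A\<lparr>carrier := P.L\<rparr>)"
      by (rule P.pirreducible_iff_field_L[OF hyps(1) C.\<iota>_hom K_def[symmetric] hyps(4) yN[symmetric]])
    \<comment> \<open>A power with exponent \<open>p i ^ j\<close>, \<open>j \<ge> 1\<close>, is in
      particular a \<open>p i\<close>-th power, and \<open>p i\<close> is the only prime dividing
      \<open>?N\<close>; so the union reduces to its member at \<open>j = 1\<close>.\<close>
    have roots: "(\<forall>r. Factorial_Ring.prime r \<and> r dvd ?N \<longrightarrow> (\<forall>c\<in>K. c [^]\<^bsub>A\<^esub> r \<noteq> \<iota> s)) \<longleftrightarrow>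
        s \<notin> (\<Union>j\<in>{1..m i}. kth_powers F (p i ^ j))"
    proof (intro iffI notI allI impI ballI)
      assume *: "\<forall>r. Factorial_Ring.prime r \<and> r dvd ?N \<longrightarrow> (\<forall>c\<in>K. c [^]\<^bsub>A\<^esub> r \<noteq> \<iota> s)"
        and "s \<in> (\<Union>j\<in>{1..m i}. kth_powers F (p i ^ j))"
      then obtain j u where j: "j \<in> {1..m i}" and u: "u \<in> carrier F" "s = u [^]\<^bsub>F\<^esub> (p i ^ j)"
        by (auto simp: kth_powers_def)
      obtain j' where j': "j = Suc j'" using j by (cases j) auto
      have "p i dvd ?N" using m_pos[OF i] by simp
      then have "\<iota> (u [^]\<^bsub>F\<^esub> (p i ^ j')) [^]\<^bsub>A\<^esub> p i \<noteq> \<iota> s"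
        using * prime_p[OF i] \<iota>K[OF F.nat_pow_closed[OF u(1)]] by blast
      moreover have "\<iota> (u [^]\<^bsub>F\<^esub> (p i ^ j')) [^]\<^bsub>A\<^esub> p i = \<iota> s"
        unfolding \<iota>_pow[OF F.nat_pow_closed[OF u(1)], symmetric] F.nat_pow_pow[OF u(1)] u(2) j'
        by (simp add: mult.commute)
      ultimately show False by blast
    next
      fix r c assume s: "s \<notin> (\<Union>j\<in>{1..m i}. kth_powers F (p i ^ j))"
        and r: "Factorial_Ring.prime r \<and> r dvd ?N" and c: "c \<in> K" "c [^]\<^bsub>A\<^esub> r = \<iota> s"
      have "r dvd p i" using r prime_dvd_power by blast
      then have "r = p i" using r prime_p[OF i] primes_dvd_imp_eq by blast
      obtain u where u: "u \<in> carrier F" "c = \<iota> u" using c(1) K_def by blast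
      have "\<iota> (u [^]\<^bsub>F\<^esub> p i) = \<iota> s" using c(2) \<open>r = p i\<close> unfolding u(2) \<iota>_pow[OF u(1)] by simp
      then have "s = u [^]\<^bsub>F\<^esub> (p i ^ 1)"
        using inj_onD[OF inj _ F.nat_pow_closed[OF u(1)] hyps(4), of "p i"] by simp
      then have "s \<in> kth_powers F (p i ^ 1)" unfolding kth_powers_def using u(1) by blast
      then show False using s m_pos[OF i] by (auto simp: Bex_def)
    qed
    have E: "E_sub i = P.L" unfolding E_sub_def by (rule P.generate_L)
    have B: "A_sub i = P.B" unfolding A_sub_def by (rule P.generate_B)
    have part1: "pirreducible\<^bsub>F\<^esub> (carrier F) (binomial_poly F ?N s) \<longleftrightarrow>
        s \<notin> (\<Union>j\<in>{1..m i}. kth_powers F (p i ^ j))"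
      unfolding irr P.field_L_iff yN by (rule roots)
    have part2: "let L' = A\<lparr>carrier := P.L\<rparr>; G = aut_group L' K in
          finite_galois_extension L' K \<and> ring.dimension L' ?N K (carrier L')
        \<and> (\<exists>!\<tau>. \<tau> \<in> carrier G \<and> \<tau> ?y = \<iota> q [^]\<^bsub>A\<^esub> (n' i)\<^sup>2 \<otimes>\<^bsub>A\<^esub> ?y)
        \<and> (\<forall>\<tau>\<in>carrier G. \<tau> ?y = \<iota> q [^]\<^bsub>A\<^esub> (n' i)\<^sup>2 \<otimes>\<^bsub>A\<^esub> ?y \<longrightarrow>
              generate G {\<tau>} = carrier G \<and> group.ord G \<tau> = ?N)
        \<and> group G \<and> cyclic_group G \<and> order G = ?N"
      if L: "field (A\<lparr>carrier := P.L\<rparr>)"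
      unfolding Let_def by (intro conjI P.galois_L[OF L] P.dimension_L)
    show ?thesis
      unfolding E B \<iota>_pow[OF q(1)]
      by (rule conjI[OF part1 conjI[OF impI[OF part2[OF irr[THEN iffD1]]] P.has_Deg_B]])
  qed
  have tensor: "tensor_product_of_subalgebras K A {1..d} A_sub"
  proof -
    have "A_sub = (\<lambda>i. generate_ring A (K \<union> {h [^]\<^bsub>A\<^esub> n' i, x [^]\<^bsub>A\<^esub> n' i}))"
      using A_sub_def by (rule ext)
    moreover have "tensor_product_of_subalgebras K A {1..d} (\<lambda>i. generate_ring A (K \<union> {h [^]\<^bsub>A\<^esub> n' i, x [^]\<^bsub>A\<^esub> n' i}))"
    proof (rule Q.tensor_decomposition[where N' = "\<lambda>i. p i ^ m i"])
      fix r assume r: "Factorial_Ring.prime r" "r dvd n"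
      then have "r dvd (\<Prod>i=1..d. p i ^ m i)" using n_eq by simp
      then obtain i where i: "i \<in> {1..d}" "r dvd p i ^ m i"
        using prime_dvd_prod_iff[of "{1..d}" r "\<lambda>i. p i ^ m i"] r(1) by auto
      have "\<not> r dvd n' i"
      proof
        assume "r dvd n' i"
        then have "is_unit r" using coprime_common_divisor[OF n_coprime[OF i(1)] _ i(2)] by blast
        then show False using r(1) not_prime_unit by blast
      qed
      then show "\<exists>i\<in>{1..d}. \<not> r dvd n' i" using i(1) by blast
    next
      fix W assume "subring W A" "K \<subseteq> W" "h \<in> W" "x \<in> W"
      then show "carrier A \<subseteq> W" using C.generated_by[of W] unfolding K_def by blast
    qed (fact n_split n_coprime n_dvd)+
    ultimately show ?thesis by simp
  qed
  show ?thesis using components tensor by blast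
qed

end
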